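(* For an integer $d\ge 1$ let $\alpha_t=\frac{t}{d+2-t}$ for $t\in\{2,\dots,d\}$ and $\beta_t=\frac{t}{d+1-t}$ for $t\in\{1,\dots,d\}$. (Upper bounds.) Let $d,s,m,n$ be positive integers and $\alpha>0$ such that $n=m^{\alpha}$, and let $\mathbb{F}$ be a field. Let $\mathcal{P}$ be a set of $m$ points and $\mathcal{H}$ be a set of $n$ hyperplanes in $\mathbb{F}^d$ such that the incidence graph of $(\mathcal{P},\mathcal{H})$ is $K_{s,s}$-free. Then $$I(\mathcal{P},\mathcal{H})\leq \begin{cases} O_{s,d}(m) & \text{if } \alpha\in(0,\beta_1],\\ O_{s,d}\big(m^{1-\frac{1}{d+2-t}}n\big) & \text{if } \alpha\in[\beta_{t-1},\alpha_t] \text{ for some } t\in\{2,\dots,d\},\\ O_{s,d}\big(mn^{1-\frac1t}\big) & \text{if } \alpha\in[\alpha_t,\beta_t]\text{ for some } t\in\{2,\dots,d\},\\ O_{s,d}(n) & \text{if } \alpha\in[\beta_d,\infty).\end{cases}$$ (Tightness.) For every $d\ge 2$ there exist a positive integer $s=s(d)$ and a constant $c=c(d)>0$ such that the following holds. For every $\alpha>0$ and every sufficiently large integer $m$ there exist a field $\mathbb{F}=\mathbb{F}(d,m,\alpha)$, a set $\mathcal{P}$ of $m$ points and a set $\mathcal{H}$ of $n=\lfloor m^{\alpha}\rfloor$ hyperplanes in $\mathbb{F}^d$ such that the incidence graph of $(\mathcal{P},\mathcal{H})$ is $K_{s,s}$-free and $$I(\mathcal{P},\mathcal{H})\geq \begin{cases}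 m & \text{if } \alpha\in(0,\beta_1],\\ c\,m^{1-\frac{1}{d+2-t}}n & \text{if } \alpha\in[\beta_{t-1},\alpha_t] \text{ for some } t\in\{2,\dots,d\},\\ c\,mn^{1-\frac1t} & \text{if } \alpha\in[\alpha_t,\beta_t]\text{ for some } t\in\{2,\dots,d\},\\ n & \text{if } \alpha\in[\beta_d,\infty).\end{cases}$$
   Context: Hyperplanes are affine hyperplanes. The incidence graph of $(\mathcal{P},\mathcal{H})$ is the bipartite graph with vertex classes $\mathcal{P}$ and $\mathcal{H}$ in which $x\in\mathcal{P}$ and $H\in\mathcal{H}$ are adjacent iff $x\in H$; $I(\mathcal{P},\mathcal{H})$ is its number of edges. $K_{s,s}$ is the complete bipartite graph with both classes of size $s$; $K_{s,s}$-free means not containing it as a (not necessarily induced) subgraph. $O_{s,d}(\cdot)$ hides a constant depending only on $s$ and $d$. "Sufficiently large $m$" may depend on $d$ and $\alpha$. *)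

theory Defs
  imports Complex_Main "HOL-Library.FuncSet" "HOL-Algebra.Ring"
begin

definition alpha_exp :: "nat \<Rightarrow> nat \<Rightarrow> real" where
  "alpha_exp d t = real t / (real d + 2 - real t)"

definition beta_exp :: "nat \<Rightarrow> nat \<Rightarrow> real" where
  "beta_exp d t = real t / (real d + 1 - real t)"


(* Fields are HOL-Algebra structures, so that a field can be existentially quantified.
   Points of F^d are the extensional functions on {..<d}: undefined outside {..<d}, so that
   equality of points is equality of coordinates. *)

definition affine_space :: "'a ring \<Rightarrow> nat \<Rightarrow> (nat \<Rightarrow> 'a) set" where
  "affine_space F d = {..<d} \<rightarrow>\<^sub>E carrier F"

definition affine_hyperplane :: "'a ring \<Rightarrow> nat \<Rightarrow> (nat \<Rightarrow> 'a) set \<Rightarrow> bool" where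
  "affine_hyperplane F d h \<longleftrightarrow>
     (\<exists>a \<in> affine_space F d. \<exists>b \<in> carrier F.
        (\<exists>i<d. a i \<noteq> \<zero>\<^bsub>F\<^esub>) \<and>
        h = {x \<in> affine_space F d. (\<Oplus>\<^bsub>F\<^esub>i\<in>{..<d}. a i \<otimes>\<^bsub>F\<^esub> x i) = b})"


(* A simple graph is given by its vertex set and its set of edges, which are two-element sets of
   vertices.  Since s-element classes are disjoint and all cross pairs are edges, this is
   containment of K_{s,s} as a not necessarily induced subgraph. *)

definition contains_biclique :: "nat \<Rightarrow> 'v set \<Rightarrow> 'v set set \<Rightarrow> bool" where
  "contains_biclique s V E \<longleftrightarrow>
     (\<exists>A B. A \<subseteq> V \<and> B \<subseteq> V \<and> A \<inter> B = {} \<and> finite A \<and> finite B \<and> card A = s \<and> card B = s \<and>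
        (\<forall>a\<in>A. \<forall>b\<in>B. {a, b} \<in> E))"

definition incidence_vertices :: "'p set \<Rightarrow> 'p set set \<Rightarrow> ('p + 'p set) set" where
  "incidence_vertices P H = P <+> H"

definition incidence_edges :: "'p set \<Rightarrow> 'p set set \<Rightarrow> ('p + 'p set) set set" where
  "incidence_edges P H = {{Inl x, Inr h} | x h. x \<in> P \<and> h \<in> H \<and> x \<in> h}"

definition incidences :: "'p set \<Rightarrow> 'p set set \<Rightarrow> nat" where
  "incidences P H = card (incidence_edges P H)"

definition biclique_free :: "nat \<Rightarrow> 'p set \<Rightarrow> 'p set set \<Rightarrow> bool" where
  "biclique_free s P H \<longleftrightarrow>
     \<not> contains_biclique s (incidence_vertices P H) (incidence_edges P H)"


(* The upper bounds over the field F, in dimension d, with implied constant C. *)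

definition upper_bounds :: "'a ring \<Rightarrow> nat \<Rightarrow> nat \<Rightarrow> real \<Rightarrow> bool" where
  "upper_bounds F d s C \<longleftrightarrow>
     (\<forall>(m::nat) (n::nat) (\<alpha>::real) P H.
        m > 0 \<longrightarrow> n > 0 \<longrightarrow> \<alpha> > 0 \<longrightarrow> real n = real m powr \<alpha> \<longrightarrow>
        P \<subseteq> affine_space F d \<longrightarrow> finite P \<longrightarrow> card P = m \<longrightarrow>
        (\<forall>h\<in>H. affine_hyperplane F d h) \<longrightarrow> finite H \<longrightarrow> card H = n \<longrightarrow>
        biclique_free s P H \<longrightarrow>
        (\<alpha> \<in> {0<..beta_exp d 1} \<longrightarrow> real (incidences P H) \<le> C * real m) \<and>
        (\<forall>t\<in>{2..d}. \<alpha> \<in> {beta_exp d (t - 1)..alpha_exp d t} \<longrightarrow>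
           real (incidences P H) \<le> C * (real m powr (1 - 1 / (real d + 2 - real t)) * real n)) \<and>
        (\<forall>t\<in>{2..d}. \<alpha> \<in> {alpha_exp d t..beta_exp d t} \<longrightarrow>
           real (incidences P H) \<le> C * (real m * real n powr (1 - 1 / real t))) \<and>
        (\<alpha> \<in> {beta_exp d d..} \<longrightarrow> real (incidences P H) \<le> C * real n))"


(* The constant implied by O_{s,d} must not depend on the field, but HOL cannot quantify over the
   carrier type of the field inside a formula: in "\<exists>C. \<forall>F :: 'a ring. ..." the constant C could
   depend on 'a.  Hence the constant is given as a closed term without type variables.  It is any
   constant that is valid for the fields with carrier in int, and nothing is lost by this choice:
   finitely many points and hyperplanes are defined over a finitely generated, hence countable,
   subfield of F, and every countable field has a copy with carrier in int. *)

definition upper_const :: "nat \<Rightarrow> nat \<Rightarrow> real" where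
  "upper_const s d = (SOME C. \<forall>F :: int ring. field F \<longrightarrow> upper_bounds F d s C)"

end

(*
  Upper bound. Let a + b = d + 1. If the number of incidences is large compared with
  m n^(1-1/a) + m^(1-1/b) n, then there are many copies of K_{a,b}, and most of them consist of
  points x_1, ..., x_a and hyperplanes h_1, ..., h_b such that the x_i have many common hyperplanes,
  the h_j have many common points, no x_i lies on all common hyperplanes of its predecessors, and
  dually. As the graph is K_{s,s}-free, some common point of the h_j avoids some common hyperplane
  of the x_i. This gives d + 2 points and hyperplanes with a triangular incidence pattern, hence
  d + 2 independent vectors in F^(d+1).

  Lower bound. Over a field with q elements, subspace-evasive sets give q^(d+2-t) points and q^t
  hyperplanes such that s of the points span a flat of dimension at least t - 1 and the dual holds
  for the hyperplanes, which excludes K_{s,s}. Translating the hyperplanes makes every point lie on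
  every hyperplane for exactly one translation, so some translation has incidence density 1/q.
  All exponents with beta_(t-1) < alpha <= beta_t are obtained from subsets of such a configuration.
*)

theory Submission
  imports Defs "HOL-Library.Function_Algebras" "HOL-Library.Z2" "HOL-Library.Countable_Set"
    "HOL-Algebra.Generated_Fields" "HOL-Algebra.Algebraic_Closure_Type"
begin

section \<open>Homomorphisms of complete bipartite graphs\<close>

text \<open>A pair with a + b = d + 1 gives an upper bound with two terms, which balance where
  n^(1/a) = m^(1/b), that is at \<alpha> = a/b = \<open>beta_exp d a\<close>. The lower bound for
  \<open>t\<close> is the smaller of two terms with the exponents \<open>t\<close> and d + 2 - t,
  whose sum is d + 2, and these balance at \<open>alpha_exp d t\<close>. This shift by one is why
  both families of thresholds occur. Freeness enters the upper bound twice: it makes degenerate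
  tuples rare and it supplies the non-incident pair in the middle of the triangular pattern. In the
  lower bound the evasive sets come from the pigeonhole principle, so nothing is known about their
  incidences, and the two sides must be evasive in mutually dual senses. Hyperplanes are therefore
  graphs parametrized by points of the same space. One construction then serves both sides, freeness
  holds for every translation, and the translation is left free for averaging. Fields of size 2^k
  suffice, since the size of the field matters only up to a constant factor.\<close>

lemma power_mean_nat:
  fixes f :: "'a \<Rightarrow> nat"
  assumes "finite S" "k \<ge> 1"
  shows "(\<Sum>i\<in>S. f i) ^ k \<le> card S ^ (k - 1) * (\<Sum>i\<in>S. f i ^ k)"
  using assms(2)
proof (induction k rule: dec_induct)
  case base
  then show ?case by simp
next
  case (step k)
  \<comment> \<open>Chebyshev's sum inequality: \<open>f\<close> and its power are similarly
    ordered, so pairing equal indices gives the larger sum. The sign is checked in the integers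
    because subtraction of naturals truncates.\<close>
  have cheb: "(\<Sum>i\<in>S. f i) * (\<Sum>i\<in>S. f i ^ k) \<le> card S * (\<Sum>i\<in>S. f i ^ Suc k)"
  proof -
    have *: "f i * f j ^ k + f j * f i ^ k \<le> f i ^ Suc k + f j ^ Suc k" for i j
    proof -
      have "0 \<le> (int (f i) - int (f j)) * (int (f i) ^ k - int (f j) ^ k)"
        by (cases "f i \<le> f j") (auto simp: power_mono mult_nonneg_nonneg mult_nonpos_nonpos)
      then have "int (f i * f j ^ k + f j * f i ^ k) \<le> int (f i ^ Suc k + f j ^ Suc k)"
        by (simp add: algebra_simps)
      then show ?thesis by linarith
    qed
    have "2 * ((\<Sum>i\<in>S. f i) * (\<Sum>i\<in>S. f i ^ k))
        = (\<Sum>i\<in>S. \<Sum>j\<in>S. f i * f j ^ k) + (\<Sum>j\<in>S. \<Sum>i\<in>S. f i * f j ^ k)"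
      by (simp add: sum_product) (rule sum.swap)
    also have "\<dots> = (\<Sum>i\<in>S. \<Sum>j\<in>S. f i * f j ^ k + f j * f i ^ k)"
      by (simp add: sum.distrib)
    also have "\<dots> \<le> (\<Sum>i\<in>S. \<Sum>j\<in>S. f i ^ Suc k + f j ^ Suc k)"
      by (intro sum_mono *)
    also have "\<dots> = 2 * (card S * (\<Sum>i\<in>S. f i ^ Suc k))"
      by (simp add: sum.distrib flip: sum_distrib_left)
    finally show ?thesis by simp
  qed
  have "(\<Sum>i\<in>S. f i) ^ Suc k = (\<Sum>i\<in>S. f i) * (\<Sum>i\<in>S. f i) ^ k" by simp
  also have "\<dots> \<le> (\<Sum>i\<in>S. f i) * (card S ^ (k - 1) * (\<Sum>i\<in>S. f i ^ k))"
    using step.IH by (rule mult_left_mono) simp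
  also have "\<dots> = card S ^ (k - 1) * ((\<Sum>i\<in>S. f i) * (\<Sum>i\<in>S. f i ^ k))" by (simp only: mult_ac)
  also have "\<dots> \<le> card S ^ (k - 1) * (card S * (\<Sum>i\<in>S. f i ^ Suc k))"
    using cheb by (rule mult_left_mono) simp
  also have "\<dots> = card S ^ (Suc k - 1) * (\<Sum>i\<in>S. f i ^ Suc k)"
    using step.hyps by (cases k) (auto simp: mult_ac)
  finally show ?case .
qed

section \<open>Homomorphisms of K_{a,b}, common neighbourhoods and degenerate tuples\<close>

definition tuples :: "'a set \<Rightarrow> nat \<Rightarrow> 'a list set" where
  "tuples S k = {xs. set xs \<subseteq> S \<and> length xs = k}"

definition common :: "('a \<Rightarrow> 'b \<Rightarrow> bool) \<Rightarrow> 'b set \<Rightarrow> 'a list \<Rightarrow> 'b set" where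
  "common r H xs = {h \<in> H. \<forall>x\<in>set xs. r x h}"

text \<open>Lists may repeat entries. Counting homomorphisms instead of copies turns the count into
  sums of powers of neighbourhood sizes, to which convexity applies without lower-order
  terms.\<close>

definition homs :: "('a \<Rightarrow> 'b \<Rightarrow> bool) \<Rightarrow> 'a set \<Rightarrow> 'b set \<Rightarrow> nat \<Rightarrow> nat \<Rightarrow> ('a list \<times> 'b list) set" where
  "homs r P H a b = {(xs, ys). xs \<in> tuples P a \<and> ys \<in> tuples H b \<and> (\<forall>x\<in>set xs. \<forall>y\<in>set ys. r x y)}"

definition no_biclique :: "nat \<Rightarrow> ('a \<Rightarrow> 'b \<Rightarrow> bool) \<Rightarrow> 'a set \<Rightarrow> 'b set \<Rightarrow> bool" where
  "no_biclique s r P H \<longleftrightarrow>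
     (\<forall>A B. A \<subseteq> P \<longrightarrow> B \<subseteq> H \<longrightarrow> finite A \<longrightarrow> finite B \<longrightarrow> card A = s \<longrightarrow> card B = s \<longrightarrow>
        (\<exists>x\<in>A. \<exists>h\<in>B. \<not> r x h))"

text \<open>The negation says that every entry strictly shrinks the set of common neighbours of its
  prefix. It thus provides, for each entry, a common neighbour of the prefix that misses the entry,
  as a triangular pattern requires.\<close>

definition degenerate :: "('a \<Rightarrow> 'b \<Rightarrow> bool) \<Rightarrow> 'b set \<Rightarrow> 'a list \<Rightarrow> bool" where
  "degenerate r H xs \<longleftrightarrow> (\<exists>i<length xs. \<forall>h\<in>common r H (take i xs). r (xs ! i) h)"

lemma finite_tuples: "finite S \<Longrightarrow> finite (tuples S k)"
  unfolding tuples_def by (rule finite_lists_length_eq)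

lemma card_tuples: "finite S \<Longrightarrow> card (tuples S k) = card S ^ k"
  unfolding tuples_def by (rule card_lists_length_eq)

lemma finite_common: "finite H \<Longrightarrow> finite (common r H xs)"
  unfolding common_def by simp

lemma homs_conv: "homs (\<lambda>y x. r x y) H P b a = prod.swap ` homs r P H a b"
  unfolding homs_def by auto

lemma card_homs_conv: "card (homs (\<lambda>y x. r x y) H P b a) = card (homs r P H a b)"
  unfolding homs_conv[of r] by (simp add: card_image)

lemma homs_eq_Sigma: "homs r P H a b = (SIGMA xs:tuples P a. tuples (common r H xs) b)"
  unfolding homs_def tuples_def common_def by auto

lemma finite_homs: "finite P \<Longrightarrow> finite H \<Longrightarrow> finite (homs r P H a b)"
  unfolding homs_eq_Sigma by (auto intro: finite_tuples finite_common)

lemma card_homs: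
  assumes "finite P" "finite H"
  shows "card (homs r P H a b) = (\<Sum>xs\<in>tuples P a. card (common r H xs) ^ b)"
  unfolding homs_eq_Sigma using assms
  by (subst card_SigmaI) (auto simp: finite_tuples finite_common card_tuples)

lemma no_biclique_conv: "no_biclique s (\<lambda>y x. r x y) H P \<longleftrightarrow> no_biclique s r P H"
  unfolding no_biclique_def by blast

lemma no_bicliqueD:
  assumes "no_biclique s r P H" "A \<subseteq> P" "B \<subseteq> H" "finite A" "finite B" "card A \<ge> s" "card B \<ge> s"
  shows "\<exists>x\<in>A. \<exists>h\<in>B. \<not> r x h"
proof -
  obtain A' where "A' \<subseteq> A" "card A' = s" "finite A'"
    using obtain_subset_with_card_n[OF assms(6)] by metis
  moreover obtain B' where "B' \<subseteq> B" "card B' = s" "finite B'"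
    using obtain_subset_with_card_n[OF assms(7)] by metis
  ultimately have "\<exists>x\<in>A'. \<exists>h\<in>B'. \<not> r x h"
    using assms(1)[unfolded no_biclique_def, rule_format, of A' B'] assms(2,3) by blast
  then show ?thesis using \<open>A' \<subseteq> A\<close> \<open>B' \<subseteq> B\<close> by blast
qed

text \<open>Convexity is applied twice, through stars with one hyperplane and \<open>a\<close>
  points. The edge count is a sum of degrees over hyperplanes. The star count is the sum of their
  \<open>a\<close>-th powers and also a sum over \<open>a\<close>-tuples of points, whose
  \<open>b\<close>-th powers count K_{a,b}.\<close>

lemma card_homs_lower:
  assumes fin: "finite P" "finite H" and ab: "a \<ge> 1" "b \<ge> 1"
  shows "card {(x, h). x \<in> P \<and> h \<in> H \<and> r x h} ^ (a * b)
           \<le> card H ^ ((a - 1) * b) * card P ^ (a * (b - 1)) * card (homs r P H a b)"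
proof -
  let ?E = "{(x, h). x \<in> P \<and> h \<in> H \<and> r x h}"
  let ?r' = "\<lambda>y x. r x y"
  have stars: "card (homs r P H k 1) = (\<Sum>xs\<in>tuples P k. card (common r H xs))" for k
    by (simp add: card_homs[OF fin])
  have stars': "card (homs r P H k 1) = (\<Sum>ys\<in>tuples H 1. card (common ?r' P ys) ^ k)" for k
    using card_homs[OF fin(2,1), of ?r' 1 k] card_homs_conv[of r H P 1 k] by simp
  have "bij_betw (\<lambda>(x, h). ([x], [h])) ?E (homs r P H 1 1)"
    by (rule bij_betw_byWitness[where f' = "\<lambda>(xs, ys). (hd xs, hd ys)"])
       (auto simp: homs_def tuples_def length_Suc_conv)
  then have E: "card ?E = card (homs r P H 1 1)"
    by (rule bij_betw_same_card)
  have cH: "card (tuples H 1) = card H"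
    using fin by (simp add: card_tuples)
  have 1: "card ?E ^ a \<le> card H ^ (a - 1) * card (homs r P H a 1)"
    using power_mean_nat[OF finite_tuples[OF fin(2)] ab(1), of "\<lambda>ys. card (common ?r' P ys)" 1]
    unfolding E stars' cH power_one_right .
  have 2: "card (homs r P H a 1) ^ b \<le> (card P ^ a) ^ (b - 1) * card (homs r P H a b)"
    using power_mean_nat[OF finite_tuples[OF fin(1)] ab(2), of "\<lambda>xs. card (common r H xs)" a]
    unfolding stars card_homs[OF fin, of r a b] card_tuples[OF fin(1)] .
  have "card ?E ^ (a * b) \<le> (card H ^ (a - 1) * card (homs r P H a 1)) ^ b"
    unfolding power_mult by (rule power_mono[OF 1]) simp
  also have "\<dots> = card H ^ ((a - 1) * b) * card (homs r P H a 1) ^ b"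
    by (simp add: power_mult_distrib power_mult)
  also have "\<dots> \<le> card H ^ ((a - 1) * b) * ((card P ^ a) ^ (b - 1) * card (homs r P H a b))"
    by (rule mult_left_mono[OF 2]) simp
  finally show ?thesis by (simp add: power_mult mult_ac)
qed

lemma card_homs_poor:
  assumes fin: "finite P" "finite H"
  shows "card {(xs, ys) \<in> homs r P H a b. card (common r H xs) < R} \<le> card P ^ a * R ^ b"
proof -
  have "{(xs, ys) \<in> homs r P H a b. card (common r H xs) < R}
      = (SIGMA xs:{xs \<in> tuples P a. card (common r H xs) < R}. tuples (common r H xs) b)"
    unfolding homs_eq_Sigma by auto
  then have "card {(xs, ys) \<in> homs r P H a b. card (common r H xs) < R}
      = (\<Sum>xs\<in>{xs \<in> tuples P a. card (common r H xs) < R}. card (common r H xs) ^ b)"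
    using fin by (simp add: finite_tuples finite_common card_tuples)
  also have "\<dots> \<le> (\<Sum>xs\<in>{xs \<in> tuples P a. card (common r H xs) < R}. R ^ b)"
    by (rule sum_mono) (auto intro: power_mono)
  also have "\<dots> \<le> (\<Sum>xs\<in>tuples P a. R ^ b)"
    by (rule sum_mono2) (auto simp: finite_tuples fin)
  finally show ?thesis by (simp add: card_tuples fin)
qed

text \<open>If the whole tuple has \<open>s\<close> common neighbours, so does each prefix; the
  points incident to all of them number fewer than \<open>s\<close>, as there is no K_{s,s}. A
  degenerate entry is one of these, so at one of the \<open>a\<close> positions fewer than
  \<open>s\<close> choices remain once the predecessors are fixed.\<close>

lemma card_degenerate:
  assumes fin: "finite P" "finite H" and free: "no_biclique s r P H" and R: "s \<le> R"
    and S: "S \<subseteq> P"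
  shows "card {xs \<in> tuples S a. R \<le> card (common r H xs) \<and> degenerate r H xs}
           \<le> a * (s * card S ^ (a - 1))"
proof -
  define cl where "cl us = {x \<in> S. \<forall>h\<in>common r H us. r x h}" for us
  define D where "D i = {xs \<in> tuples S a. R \<le> card (common r H xs) \<and> xs ! i \<in> cl (take i xs)}" for i
  have finS: "finite S" using S fin(1) by (rule finite_subset)
  have D: "card (D i) \<le> s * card S ^ (a - 1)" if i: "i < a" for i
  proof -
    let ?U = "tuples S i \<times> tuples S (a - 1 - i)"
    \<comment> \<open>Replacing large closures by the empty set loses no tuple counted here and
      bounds every fibre of the sum by \<open>s\<close>.\<close>
    let ?cl = "\<lambda>us. if card (cl us) < s then cl us else {}"
    let ?f = "\<lambda>((us, vs), x). us @ x # vs"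
    have "D i \<subseteq> ?f ` (SIGMA u:?U. ?cl (fst u))"
    proof
      fix xs assume xs: "xs \<in> D i"
      then have len: "length xs = a" and sub: "set xs \<subseteq> S" and rich: "R \<le> card (common r H xs)"
        and x: "xs ! i \<in> cl (take i xs)"
        by (auto simp: D_def tuples_def)
      have "common r H xs \<subseteq> common r H (take i xs)"
        by (auto simp: common_def dest: in_set_takeD)
      then have "s \<le> card (common r H (take i xs))"
        using rich R card_mono[OF finite_common[OF fin(2)]] by (meson order_trans)
      then have "card (cl (take i xs)) < s"
        using no_bicliqueD[OF free, of "cl (take i xs)" "common r H (take i xs)"] S finS fin
        by (force simp: cl_def common_def)
      moreover have "(take i xs, drop (Suc i) xs) \<in> ?U"
        using len sub i by (auto simp: tuples_def dest: in_set_takeD in_set_dropD)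
      moreover have "xs = take i xs @ xs ! i # drop (Suc i) xs"
        using i len by (simp add: id_take_nth_drop)
      ultimately show "xs \<in> ?f ` (SIGMA u:?U. ?cl (fst u))"
        using x by (intro image_eqI[where x = "((take i xs, drop (Suc i) xs), xs ! i)"]) auto
    qed
    moreover have finU: "finite ?U" using finS by (simp add: finite_tuples)
    moreover have fincl: "finite (?cl us)" for us using finS by (simp add: cl_def)
    ultimately have "card (D i) \<le> card (SIGMA u:?U. ?cl (fst u))"
      by (intro surj_card_le[of _ _ ?f]) (blast intro: finite_SigmaI)+
    also have "\<dots> = (\<Sum>u\<in>?U. card (?cl (fst u)))"
      using finU fincl by (subst card_SigmaI) auto
    also have "\<dots> \<le> (\<Sum>u\<in>?U. s)" by (rule sum_mono) auto
    also have "\<dots> = s * card S ^ (a - 1)"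
      using i by (simp add: card_cartesian_product card_tuples finS flip: power_add)
    finally show ?thesis .
  qed
  have "{xs \<in> tuples S a. R \<le> card (common r H xs) \<and> degenerate r H xs} \<subseteq> (\<Union>i<a. D i)"
  proof
    fix xs assume "xs \<in> {xs \<in> tuples S a. R \<le> card (common r H xs) \<and> degenerate r H xs}"
    then have xs: "xs \<in> tuples S a" "R \<le> card (common r H xs)"
      and "degenerate r H xs" and len: "length xs = a" and sub: "set xs \<subseteq> S"
      by (auto simp: tuples_def)
    then obtain i where i: "i < a" "\<forall>h\<in>common r H (take i xs). r (xs ! i) h"
      unfolding degenerate_def by blast
    moreover have "xs ! i \<in> S" using i(1) len sub nth_mem by blast
    ultimately show "xs \<in> (\<Union>i<a. D i)"
      using xs unfolding D_def cl_def by blast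
  qed
  then have "card {xs \<in> tuples S a. R \<le> card (common r H xs) \<and> degenerate r H xs}
               \<le> card (\<Union>i<a. D i)"
    by (intro card_mono) (auto simp: D_def finite_tuples finS)
  also have "\<dots> \<le> (\<Sum>i<a. card (D i))" by (rule card_UN_le) simp
  also have "\<dots> \<le> (\<Sum>i<a. s * card S ^ (a - 1))" by (rule sum_mono) (use D in auto)
  finally show ?thesis by simp
qed

text \<open>If \<open>ys\<close> has N common points, the degenerate \<open>xs\<close> are at most a
  fraction a * s / N of the N^a tuples of such points, and N is at least \<open>R\<close>.
  Multiplying by \<open>R\<close> avoids the division.\<close>

lemma card_homs_degenerate:
  assumes fin: "finite P" "finite H" and free: "no_biclique s r P H" and R: "s \<le> R" and a: "a \<ge> 1"
  shows "R * card {(xs, ys) \<in> homs r P H a b. R \<le> card (common r H xs) \<and>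
             R \<le> card (common (\<lambda>y x. r x y) P ys) \<and> degenerate r H xs}
           \<le> a * s * card (homs r P H a b)"
    (is "R * card ?D \<le> _")
proof -
  let ?N = "\<lambda>ys. common (\<lambda>y x. r x y) P ys"
  let ?T = "{ys \<in> tuples H b. R \<le> card (?N ys)}"
  let ?B = "\<lambda>ys. {xs \<in> tuples (?N ys) a. R \<le> card (common r H xs) \<and> degenerate r H xs}"
  have finT: "finite ?T" using fin by (simp add: finite_tuples)
  have "?D = prod.swap ` (SIGMA ys:?T. ?B ys)"
    by (force simp: homs_def tuples_def common_def)
  then have "card ?D = card (SIGMA ys:?T. ?B ys)"
    by (simp add: card_image)
  also have "\<dots> = (\<Sum>ys\<in>?T. card (?B ys))"
    using finT fin by (intro card_SigmaI) (auto simp: finite_tuples finite_common)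
  also have "\<dots> \<le> (\<Sum>ys\<in>?T. a * (s * card (?N ys) ^ (a - 1)))"
    by (intro sum_mono card_degenerate[OF fin free R]) (auto simp: common_def)
  finally have "R * card ?D \<le> R * (\<Sum>ys\<in>?T. a * (s * card (?N ys) ^ (a - 1)))"
    by (rule mult_le_mono2)
  also have "\<dots> = (\<Sum>ys\<in>?T. R * (a * (s * card (?N ys) ^ (a - 1))))"
    by (rule sum_distrib_left)
  also have "\<dots> \<le> (\<Sum>ys\<in>?T. card (?N ys) * (a * (s * card (?N ys) ^ (a - 1))))"
    by (rule sum_mono) (auto intro: mult_right_mono)
  also have "\<dots> = (\<Sum>ys\<in>?T. a * s * card (?N ys) ^ a)"
    using a by (intro sum.cong) (auto simp: power_eq_if mult_ac)
  also have "\<dots> \<le> (\<Sum>ys\<in>tuples H b. a * s * card (?N ys) ^ a)"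
    by (rule sum_mono2) (auto simp: finite_tuples fin)
  also have "\<dots> = a * s * card (homs r P H a b)"
    using card_homs[OF fin(2,1), of "\<lambda>y x. r x y" b a] card_homs_conv[of r H P b a]
    by (simp add: sum_distrib_left)
  finally show ?thesis .
qed

text \<open>By \<open>none\<close>, a homomorphism with at least \<open>R\<close> common neighbours
  on both sides is degenerate on one of them. The choice of \<open>R\<close> makes the two
  degenerate proportions a * s / R and b * s / R add up to 1/2, so the homomorphisms with a poor
  side are at least half of all.\<close>

lemma card_homs_upper:
  assumes fin: "finite P" "finite H" and free: "no_biclique s r P H"
    and ab: "a \<ge> 1" "b \<ge> 1" and s: "s \<ge> 1" and R: "R = 2 * (a + b) * s"
    and none: "\<And>xs ys. (xs, ys) \<in> homs r P H a b \<Longrightarrow> s \<le> card (common r H xs) \<Longrightarrow>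
       s \<le> card (common (\<lambda>y x. r x y) P ys) \<Longrightarrow> degenerate r H xs \<or> degenerate (\<lambda>y x. r x y) P ys"
  shows "card (homs r P H a b) \<le> 2 * (card P ^ a * R ^ b + card H ^ b * R ^ a)"
proof -
  let ?r' = "\<lambda>y x. r x y"
  let ?h = "card (homs r P H a b)"
  have sR: "s \<le> R" using R ab by simp
  define A1 where "A1 = {(xs, ys) \<in> homs r P H a b. card (common r H xs) < R}"
  define A2 where "A2 = {(xs, ys) \<in> homs r P H a b. card (common ?r' P ys) < R}"
  define D1 where "D1 = {(xs, ys) \<in> homs r P H a b. R \<le> card (common r H xs) \<and>
     R \<le> card (common ?r' P ys) \<and> degenerate r H xs}"
  define D2 where "D2 = {(xs, ys) \<in> homs r P H a b. R \<le> card (common r H xs) \<and>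
     R \<le> card (common ?r' P ys) \<and> degenerate ?r' P ys}"
  have A1: "card A1 \<le> card P ^ a * R ^ b"
    unfolding A1_def by (rule card_homs_poor[OF fin])
  have "A2 = prod.swap ` {(ys, xs) \<in> homs ?r' H P b a. card (common ?r' P ys) < R}"
    unfolding A2_def homs_conv[of r] by force
  then have "card A2 = card {(ys, xs) \<in> homs ?r' H P b a. card (common ?r' P ys) < R}"
    by (simp add: card_image)
  then have A2: "card A2 \<le> card H ^ b * R ^ a"
    using card_homs_poor[OF fin(2,1), of ?r' b a R] by simp
  have D1: "R * card D1 \<le> a * s * ?h"
    unfolding D1_def by (rule card_homs_degenerate[OF fin free sR ab(1)])
  have "D2 = prod.swap ` {(ys, xs) \<in> homs ?r' H P b a. R \<le> card (common ?r' P ys) \<and>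
     R \<le> card (common r H xs) \<and> degenerate ?r' P ys}"
    unfolding D2_def homs_conv[of r] by force
  then have "card D2 = card {(ys, xs) \<in> homs ?r' H P b a. R \<le> card (common ?r' P ys) \<and>
     R \<le> card (common r H xs) \<and> degenerate ?r' P ys}"
    by (simp add: card_image)
  then have D2: "R * card D2 \<le> b * s * ?h"
    using card_homs_degenerate[OF fin(2,1) free[folded no_biclique_conv[of s r]] sR ab(2), of a]
    by (simp add: card_homs_conv[of r])
  have "R * (card D1 + card D2) \<le> (a + b) * s * ?h"
    using add_mono[OF D1 D2] unfolding distrib_left distrib_right .
  moreover have "R * (card D1 + card D2) = ((a + b) * s) * (2 * (card D1 + card D2))"
    unfolding R by (simp only: mult_ac)
  ultimately have "((a + b) * s) * (2 * (card D1 + card D2)) \<le> ((a + b) * s) * ?h"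
    by (simp only:)
  moreover have "(a + b) * s > 0" using ab s by simp
  ultimately have D: "2 * (card D1 + card D2) \<le> ?h"
    by (simp only: nat_mult_le_cancel1)
  have "u \<in> (A1 \<union> A2) \<union> (D1 \<union> D2)" if "u \<in> homs r P H a b" for u
  proof -
    obtain xs ys where u: "u = (xs, ys)" by (cases u)
    have *: "(xs, ys) \<in> homs r P H a b" using that u by simp
    show ?thesis
    proof (cases "R \<le> card (common r H xs) \<and> R \<le> card (common ?r' P ys)")
      case True
      then have "degenerate r H xs \<or> degenerate ?r' P ys"
        using none[OF *] sR by linarith
      then show ?thesis using True * unfolding u D1_def D2_def by blast
    next
      case False
      then show ?thesis using * unfolding u A1_def A2_def not_le by (auto simp: not_le)
    qed
  qed
  then have "homs r P H a b \<subseteq> (A1 \<union> A2) \<union> (D1 \<union> D2)"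
    by blast
  moreover have "finite ((A1 \<union> A2) \<union> (D1 \<union> D2))"
    using finite_homs[OF fin, of r a b]
    unfolding A1_def A2_def D1_def D2_def by (rule rev_finite_subset) blast
  ultimately have "?h \<le> card ((A1 \<union> A2) \<union> (D1 \<union> D2))"
    by (rule card_mono[rotated])
  also have "\<dots> \<le> (card A1 + card A2) + (card D1 + card D2)"
    by (meson add_mono card_Un_le order_trans)
  finally have "?h \<le> (card A1 + card A2) + (card D1 + card D2)" .
  moreover have "h \<le> 2 * (p + q)" if "h \<le> (k + l) + e" "k \<le> p" "l \<le> q" "2 * e \<le> h"
    for h k l e p q :: nat
    using that by presburger
  from this[OF calculation A1 A2 D] show ?thesis .
qed

section \<open>The upper bound over one field\<close>

text \<open>Gaussian elimination in the coordinates: a coordinate where \<open>u 0\<close> is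
  nonzero is cleared from the other \<open>u i\<close> and then deleted, which removes one vector
  and one coordinate.\<close>

lemma triangular_pairing_bound:
  assumes F: "field F" and "finite S"
    and "\<And>i c. i < k \<Longrightarrow> c \<in> S \<Longrightarrow> u i c \<in> carrier F"
    and "\<And>i c. i < k \<Longrightarrow> c \<in> S \<Longrightarrow> v i c \<in> carrier F"
    and "\<And>i j. j < i \<Longrightarrow> i < k \<Longrightarrow> (\<Oplus>\<^bsub>F\<^esub>c\<in>S. u j c \<otimes>\<^bsub>F\<^esub> v i c) = \<zero>\<^bsub>F\<^esub>"
    and "\<And>i. i < k \<Longrightarrow> (\<Oplus>\<^bsub>F\<^esub>c\<in>S. u i c \<otimes>\<^bsub>F\<^esub> v i c) \<noteq> \<zero>\<^bsub>F\<^esub>"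
  shows "k \<le> card S"
  using assms(2-)
proof (induction k arbitrary: S u v)
  case 0
  then show ?case by simp
next
  case (Suc k)
  interpret field F by fact
  note finS = Suc.prems(1) and uc = Suc.prems(2) and vc = Suc.prems(3)
  have "\<exists>c\<in>S. u 0 c \<noteq> \<zero>\<^bsub>F\<^esub>"
  proof (rule ccontr)
    assume "\<not> ?thesis"
    then have "(\<Oplus>\<^bsub>F\<^esub>c\<in>S. u 0 c \<otimes>\<^bsub>F\<^esub> v 0 c) = (\<Oplus>\<^bsub>F\<^esub>c\<in>S. \<zero>\<^bsub>F\<^esub>)"
      using vc by (intro finsum_cong') auto
    then show False using Suc.prems(5)[of 0] by simp
  qed
  then obtain c where c: "c \<in> S" "u 0 c \<noteq> \<zero>\<^bsub>F\<^esub>" by blast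
  have u0c: "u 0 c \<in> Units F" using c uc[of 0 c] by (simp add: field_Units)
  define t where "t i = \<ominus>\<^bsub>F\<^esub> (u i c \<otimes>\<^bsub>F\<^esub> inv\<^bsub>F\<^esub> u 0 c)" for i
  define u' where "u' i x = u (Suc i) x \<oplus>\<^bsub>F\<^esub> t (Suc i) \<otimes>\<^bsub>F\<^esub> u 0 x" for i x
  have tc: "t i \<in> carrier F" if "i < Suc k" for i
    using uc[OF that c(1)] u0c by (simp add: t_def)
  have u'c: "u' i x \<in> carrier F" if "i < k" "x \<in> S" for i x
    using uc[of "Suc i" x] uc[of 0 x] tc[of "Suc i"] that by (simp add: u'_def)
  have u'0: "u' i c = \<zero>\<^bsub>F\<^esub>" if "i < k" for i
  proof -
    have "t (Suc i) \<otimes>\<^bsub>F\<^esub> u 0 c = \<ominus>\<^bsub>F\<^esub> (u (Suc i) c \<otimes>\<^bsub>F\<^esub> (inv\<^bsub>F\<^esub> u 0 c \<otimes>\<^bsub>F\<^esub> u 0 c))"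
      using uc[of "Suc i" c] uc[of 0 c] c u0c that by (simp add: t_def l_minus m_assoc)
    then show ?thesis
      using uc[of "Suc i" c] c u0c that by (simp add: u'_def r_neg)
  qed
  \<comment> \<open>Adding a multiple of \<open>u 0\<close> is invisible to the later
    \<open>v i\<close>, since \<open>u 0\<close> pairs to zero with them, and the deleted coordinate
    contributes nothing because \<open>u'\<close> vanishes there.\<close>
  have pairing: "(\<Oplus>\<^bsub>F\<^esub>x\<in>S - {c}. u' j x \<otimes>\<^bsub>F\<^esub> v (Suc i) x)
      = (\<Oplus>\<^bsub>F\<^esub>x\<in>S. u (Suc j) x \<otimes>\<^bsub>F\<^esub> v (Suc i) x)"
    if ij: "j < k" "i < k" for i j
  proof -
    have vi: "v (Suc i) x \<in> carrier F" if "x \<in> S" for x using vc[of "Suc i" x] ij that by simp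
    have uj: "u (Suc j) x \<in> carrier F" if "x \<in> S" for x using uc[of "Suc j" x] ij that by simp
    have u0: "u 0 x \<in> carrier F" if "x \<in> S" for x using uc[of 0 x] that by simp
    have tj: "t (Suc j) \<in> carrier F" using tc ij by simp
    have "(\<Oplus>\<^bsub>F\<^esub>x\<in>S. u' j x \<otimes>\<^bsub>F\<^esub> v (Suc i) x)
        = (\<Oplus>\<^bsub>F\<^esub>x\<in>insert c (S - {c}). u' j x \<otimes>\<^bsub>F\<^esub> v (Suc i) x)"
      using c by (simp add: insert_absorb)
    also have "\<dots> = u' j c \<otimes>\<^bsub>F\<^esub> v (Suc i) c \<oplus>\<^bsub>F\<^esub> (\<Oplus>\<^bsub>F\<^esub>x\<in>S - {c}. u' j x \<otimes>\<^bsub>F\<^esub> v (Suc i) x)"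
      using finS c vi u'c ij by (intro finsum_insert) auto
    also have "\<dots> = (\<Oplus>\<^bsub>F\<^esub>x\<in>S - {c}. u' j x \<otimes>\<^bsub>F\<^esub> v (Suc i) x)"
      using c vi u'c ij by (subst u'0) (auto intro!: l_zero finsum_closed)
    finally have "(\<Oplus>\<^bsub>F\<^esub>x\<in>S - {c}. u' j x \<otimes>\<^bsub>F\<^esub> v (Suc i) x)
        = (\<Oplus>\<^bsub>F\<^esub>x\<in>S. u' j x \<otimes>\<^bsub>F\<^esub> v (Suc i) x)" by simp
    also have "\<dots> = (\<Oplus>\<^bsub>F\<^esub>x\<in>S. u (Suc j) x \<otimes>\<^bsub>F\<^esub> v (Suc i) x
                        \<oplus>\<^bsub>F\<^esub> t (Suc j) \<otimes>\<^bsub>F\<^esub> (u 0 x \<otimes>\<^bsub>F\<^esub> v (Suc i) x))"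
      using vi uj u0 tj by (intro finsum_cong') (auto simp: u'_def l_distr m_assoc)
    also have "\<dots> = (\<Oplus>\<^bsub>F\<^esub>x\<in>S. u (Suc j) x \<otimes>\<^bsub>F\<^esub> v (Suc i) x)
                        \<oplus>\<^bsub>F\<^esub> (\<Oplus>\<^bsub>F\<^esub>x\<in>S. t (Suc j) \<otimes>\<^bsub>F\<^esub> (u 0 x \<otimes>\<^bsub>F\<^esub> v (Suc i) x))"
      using vi uj u0 tj by (intro finsum_addf) auto
    also have "(\<Oplus>\<^bsub>F\<^esub>x\<in>S. t (Suc j) \<otimes>\<^bsub>F\<^esub> (u 0 x \<otimes>\<^bsub>F\<^esub> v (Suc i) x))
        = t (Suc j) \<otimes>\<^bsub>F\<^esub> (\<Oplus>\<^bsub>F\<^esub>x\<in>S. u 0 x \<otimes>\<^bsub>F\<^esub> v (Suc i) x)"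
      using vi u0 tj finS by (intro finsum_rdistr[symmetric]) auto
    also have "\<dots> = \<zero>\<^bsub>F\<^esub>"
      using Suc.prems(4)[of 0 "Suc i"] ij tj by simp
    finally show ?thesis
      using vi uj by (simp add: finsum_closed)
  qed
  have "k \<le> card (S - {c})"
  proof (rule Suc.IH[of _ u' "\<lambda>i. v (Suc i)"])
    show "finite (S - {c})" using finS by simp
    show "u' i x \<in> carrier F" if "i < k" "x \<in> S - {c}" for i x using u'c that by blast
    show "v (Suc i) x \<in> carrier F" if "i < k" "x \<in> S - {c}" for i x
      using vc[of "Suc i" x] that by simp
    show "(\<Oplus>\<^bsub>F\<^esub>x\<in>S - {c}. u' j x \<otimes>\<^bsub>F\<^esub> v (Suc i) x) = \<zero>\<^bsub>F\<^esub>" if "j < i" "i < k" for i j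
      using pairing[of j i] Suc.prems(4)[of "Suc j" "Suc i"] that by simp
    show "(\<Oplus>\<^bsub>F\<^esub>x\<in>S - {c}. u' i x \<otimes>\<^bsub>F\<^esub> v (Suc i) x) \<noteq> \<zero>\<^bsub>F\<^esub>" if "i < k" for i
      using pairing[of i i] Suc.prems(5)[of "Suc i"] that by simp
  qed
  moreover have "card (S - {c}) < card S" using c finS by (intro card_Diff1_less)
  ultimately show ?case by simp
qed

text \<open>Homogenization: a point gets the extra coordinate 1 and a hyperplane the extra
  coefficient -b, so that incidence becomes the vanishing of a bilinear pairing in dimension
  \<open>Suc d\<close>.\<close>

lemma hyperplane_chain_bound:
  assumes F: "field F"
    and x: "\<And>i. i < k \<Longrightarrow> x i \<in> affine_space F d"
    and h: "\<And>i. i < k \<Longrightarrow> affine_hyperplane F d (h i)"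
    and inc: "\<And>i j. j < i \<Longrightarrow> i < k \<Longrightarrow> x i \<in> h j"
    and ninc: "\<And>i. i < k \<Longrightarrow> x i \<notin> h i"
  shows "k \<le> Suc d"
proof -
  interpret field F by fact
  have "\<forall>i\<in>{..<k}. \<exists>p. fst p \<in> affine_space F d \<and> snd p \<in> carrier F \<and>
     h i = {x \<in> affine_space F d. (\<Oplus>\<^bsub>F\<^esub>l\<in>{..<d}. fst p l \<otimes>\<^bsub>F\<^esub> x l) = snd p}"
    (is "\<forall>i\<in>_. \<exists>p. ?Q i p")
  proof
    fix i assume "i \<in> {..<k}"
    then have "affine_hyperplane F d (h i)" using h by simp
    then obtain a b where "a \<in> affine_space F d" "b \<in> carrier F"
      "h i = {x \<in> affine_space F d. (\<Oplus>\<^bsub>F\<^esub>l\<in>{..<d}. a l \<otimes>\<^bsub>F\<^esub> x l) = b}"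
      unfolding affine_hyperplane_def by blast
    then have "?Q i (a, b)" by simp
    then show "\<exists>p. ?Q i p" by blast
  qed
  from bchoice[OF this] obtain ab where Q: "\<forall>i\<in>{..<k}. ?Q i (ab i)" by blast
  define a where "a i = fst (ab i)" for i
  define b where "b i = snd (ab i)" for i
  have ab: "a i \<in> affine_space F d" "b i \<in> carrier F"
    "h i = {x \<in> affine_space F d. (\<Oplus>\<^bsub>F\<^esub>l\<in>{..<d}. a i l \<otimes>\<^bsub>F\<^esub> x l) = b i}"
    if "i < k" for i
    using Q[rule_format, of i] that unfolding a_def b_def by simp_all
  define u where "u i l = (if l < d then a i l else \<ominus>\<^bsub>F\<^esub> b i)" for i l
  define v where "v i l = (if l < d then x i l else \<one>\<^bsub>F\<^esub>)" for i l
  have ac: "a i l \<in> carrier F" if "i < k" "l < d" for i l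
    using ab(1)[OF that(1)] that(2) by (auto simp: affine_space_def)
  have xc: "x i l \<in> carrier F" if "i < k" "l < d" for i l
    using x[OF that(1)] that(2) by (auto simp: affine_space_def)
  have pairing: "(\<Oplus>\<^bsub>F\<^esub>l\<in>{..<Suc d}. u j l \<otimes>\<^bsub>F\<^esub> v i l) = \<zero>\<^bsub>F\<^esub> \<longleftrightarrow> x i \<in> h j"
    if ij: "i < k" "j < k" for i j
  proof -
    have cl: "(\<Oplus>\<^bsub>F\<^esub>l\<in>{..<d}. a j l \<otimes>\<^bsub>F\<^esub> x i l) \<in> carrier F"
      using ac xc ij by (intro finsum_closed) auto
    have "(\<Oplus>\<^bsub>F\<^esub>l\<in>{..<Suc d}. u j l \<otimes>\<^bsub>F\<^esub> v i l)
        = u j d \<otimes>\<^bsub>F\<^esub> v i d \<oplus>\<^bsub>F\<^esub> (\<Oplus>\<^bsub>F\<^esub>l\<in>{..<d}. u j l \<otimes>\<^bsub>F\<^esub> v i l)"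
      unfolding lessThan_Suc using ac xc ab(2) ij
      by (intro finsum_insert) (auto simp: u_def v_def)
    also have "(\<Oplus>\<^bsub>F\<^esub>l\<in>{..<d}. u j l \<otimes>\<^bsub>F\<^esub> v i l) = (\<Oplus>\<^bsub>F\<^esub>l\<in>{..<d}. a j l \<otimes>\<^bsub>F\<^esub> x i l)"
      using ac xc ij by (intro finsum_cong') (auto simp: u_def v_def)
    also have "u j d \<otimes>\<^bsub>F\<^esub> v i d = \<ominus>\<^bsub>F\<^esub> b j" using ab(2) ij by (simp add: u_def v_def)
    also have "(\<ominus>\<^bsub>F\<^esub> b j \<oplus>\<^bsub>F\<^esub> (\<Oplus>\<^bsub>F\<^esub>l\<in>{..<d}. a j l \<otimes>\<^bsub>F\<^esub> x i l) = \<zero>\<^bsub>F\<^esub>)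
        \<longleftrightarrow> (\<Oplus>\<^bsub>F\<^esub>l\<in>{..<d}. a j l \<otimes>\<^bsub>F\<^esub> x i l) = b j"
      using cl ab(2)[OF ij(2)] by (metis a_comm a_inv_closed minus_equality minus_minus r_neg)
    finally show ?thesis using ab(3)[OF ij(2)] x[OF ij(1)] by simp
  qed
  have "k \<le> card {..<Suc d}"
  proof (rule triangular_pairing_bound[OF F, of _ k u v])
    show "u i c \<in> carrier F" if "i < k" for i c
      using ac[OF that] ab(2)[OF that] by (simp add: u_def)
    show "v i c \<in> carrier F" if "i < k" for i c
      using xc[OF that] by (simp add: v_def)
    show "(\<Oplus>\<^bsub>F\<^esub>l\<in>{..<Suc d}. u j l \<otimes>\<^bsub>F\<^esub> v i l) = \<zero>\<^bsub>F\<^esub>" if "j < i" "i < k" for i j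
      using pairing[of i j] inc that by simp
    show "(\<Oplus>\<^bsub>F\<^esub>l\<in>{..<Suc d}. u i l \<otimes>\<^bsub>F\<^esub> v i l) \<noteq> \<zero>\<^bsub>F\<^esub>" if "i < k" for i
      using pairing[of i i] ninc that by simp
  qed simp
  then show ?thesis by simp
qed

lemma degenerate_of_homs:
  assumes F: "field F" and P: "P \<subseteq> affine_space F d" and H: "\<forall>h\<in>H. affine_hyperplane F d h"
    and fin: "finite P" "finite H"
    and free: "no_biclique s (\<in>) P H" and ab: "a + b = d + 1"
    and hom: "(xs, ys) \<in> homs (\<in>) P H a b"
    and rich: "s \<le> card (common (\<in>) H xs)" "s \<le> card (common (\<lambda>y x. x \<in> y) P ys)"
  shows "degenerate (\<in>) H xs \<or> degenerate (\<lambda>y x. x \<in> y) P ys"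
proof (rule ccontr)
  assume "\<not> ?thesis"
  then have nd: "\<not> degenerate (\<in>) H xs" "\<not> degenerate (\<lambda>y x. x \<in> y) P ys" by auto
  have len: "length xs = a" "length ys = b" and sub: "set xs \<subseteq> P" "set ys \<subseteq> H"
    and inc: "\<And>x y. x \<in> set xs \<Longrightarrow> y \<in> set ys \<Longrightarrow> x \<in> y"
    using hom by (auto simp: homs_def tuples_def)
  have "\<forall>i\<in>{..<a}. \<exists>g. g \<in> common (\<in>) H (take i xs) \<and> xs ! i \<notin> g"
    using nd(1) len by (simp add: degenerate_def Bex_def)
  from bchoice[OF this]
  obtain g where g: "\<And>i. i < a \<Longrightarrow> g i \<in> common (\<in>) H (take i xs) \<and> xs ! i \<notin> g i"
    by auto
  have "\<forall>i\<in>{..<b}. \<exists>z. z \<in> common (\<lambda>y x. x \<in> y) P (take i ys) \<and> z \<notin> ys ! i"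
    using nd(2) len by (simp add: degenerate_def Bex_def)
  from bchoice[OF this]
  obtain z where z: "\<And>i. i < b \<Longrightarrow> z i \<in> common (\<lambda>y x. x \<in> y) P (take i ys) \<and> z i \<notin> ys ! i"
    by auto
  obtain x h where x: "x \<in> common (\<lambda>y x. x \<in> y) P ys" and h: "h \<in> common (\<in>) H xs" and xh: "x \<notin> h"
    using no_bicliqueD[OF free _ _ _ _ rich(2,1)] fin by (auto simp: common_def)
  \<comment> \<open>The triangular order: witnesses \<open>z\<close> against \<open>ys\<close>, then
    the non-incident pair \<open>x\<close>, \<open>h\<close>, then \<open>xs\<close> against the
    witnesses \<open>g\<close> in reverse. The reversal is forced because \<open>g l\<close>
    contains the entries of \<open>xs\<close> before position \<open>l\<close>, while the chain
    wants later points on earlier hyperplanes. This makes a + b + 1 = d + 2 members, one too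
    many.\<close>
  define p where "p i = (if i < b then z i else if i = b then x else xs ! (a + b - i))" for i
  define k where "k i = (if i < b then ys ! i else if i = b then h else g (a + b - i))" for i
  have gin: "xs ! l \<in> g i" if "l < i" "i < a" for l i
    using g[OF that(2)] nth_mem[of l "take i xs"] that len by (auto simp: common_def)
  have zin: "z i \<in> ys ! l" if "l < i" "i < b" for l i
    using z[OF that(2)] nth_mem[of l "take i ys"] that len by (auto simp: common_def)
  have xsP: "xs ! l \<in> P" "xs ! l \<in> set xs" if "l < a" for l
    using that len sub by auto
  have ysH: "ys ! l \<in> H" "ys ! l \<in> set ys" if "l < b" for l
    using that len sub by auto
  have xP: "x \<in> P" "\<And>y. y \<in> set ys \<Longrightarrow> x \<in> y" and hH: "h \<in> H" "\<And>x. x \<in> set xs \<Longrightarrow> x \<in> h"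
    using x h by (auto simp: common_def)
  have "a + b + 1 \<le> Suc d"
  proof (rule hyperplane_chain_bound[OF F, of _ p d k])
    fix i assume i: "i < a + b + 1"
    have "p i \<in> P"
      using z[of i] xP xsP[of "a + b - i"] i by (auto simp: p_def common_def)
    then show "p i \<in> affine_space F d" using P by blast
    have "k i \<in> H"
      using g[of "a + b - i"] hH ysH[of i] i by (auto simp: k_def common_def)
    then show "affine_hyperplane F d (k i)" using H by blast
    show "p i \<notin> k i"
      using z[of i] g[of "a + b - i"] xh i by (auto simp: p_def k_def)
  next
    fix i j assume ij: "j < i" "i < a + b + 1"
    consider "i < b" | "i = b" | "j < b" "b < i" | "j = b" "b < i" | "b < j"
      using ij by linarith
    then show "p i \<in> k j"
    proof cases
      case 1 then show ?thesis using zin[of j i] ij by (simp add: p_def k_def)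
    next
      case 2 then show ?thesis using xP ysH[of j] ij by (simp add: p_def k_def)
    next
      case 3 then show ?thesis
        using inc xsP(2)[of "a + b - i"] ysH(2)[of j] ij by (simp add: p_def k_def)
    next
      case 4 then show ?thesis
        using hH xsP(2)[of "a + b - i"] ij by (simp add: p_def k_def)
    next
      case 5 then show ?thesis
        using gin[of "a + b - i" "a + b - j"] ij by (simp add: p_def k_def)
    qed
  qed
  then show False using ab by simp
qed

section \<open>Incidence graphs as relations between points and hyperplanes\<close>

lemma incidences_eq: "incidences P H = card {(x, h). x \<in> P \<and> h \<in> H \<and> x \<in> h}"
proof -
  have "incidence_edges P H = (\<lambda>(x, h). {Inl x, Inr h}) ` {(x, h). x \<in> P \<and> h \<in> H \<and> x \<in> h}"
    unfolding incidence_edges_def by force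
  moreover have "inj_on (\<lambda>(x, h). {Inl x, Inr h}) {(x, h). x \<in> P \<and> h \<in> H \<and> x \<in> h}"
    by (auto simp: inj_on_def doubleton_eq_iff)
  ultimately show ?thesis unfolding incidences_def by (simp add: card_image)
qed

lemma biclique_free_iff:
  fixes P :: "'a set"
  assumes s: "s \<ge> 1"
  shows "biclique_free s P H \<longleftrightarrow> no_biclique s (\<in>) P H"
proof
  assume free: "biclique_free s P H"
  show "no_biclique s (\<in>) P H"
    unfolding no_biclique_def
  proof (intro allI impI, rule ccontr)
    fix A B assume AB: "A \<subseteq> P" "B \<subseteq> H" "finite A" "finite B" "card A = s" "card B = s"
      and "\<not> (\<exists>x\<in>A. \<exists>h\<in>B. x \<notin> h)"
    then have inc: "\<And>x h. x \<in> A \<Longrightarrow> h \<in> B \<Longrightarrow> x \<in> h" by blast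
    have "contains_biclique s (incidence_vertices P H) (incidence_edges P H)"
      unfolding contains_biclique_def
    proof (intro exI conjI)
      show "Inl ` A \<subseteq> incidence_vertices P H" "Inr ` B \<subseteq> incidence_vertices P H"
        unfolding incidence_vertices_def Plus_def using AB(1,2) by blast+
      show "\<forall>a\<in>Inl ` A. \<forall>b\<in>Inr ` B. {a, b} \<in> incidence_edges P H"
      proof (intro ballI)
        fix a b assume "a \<in> (Inl ` A :: ('a + 'a set) set)" "b \<in> (Inr ` B :: ('a + 'a set) set)"
        then obtain x h where "a = Inl x" "x \<in> A" "b = Inr h" "h \<in> B" by blast
        moreover from this have "x \<in> P" "h \<in> H" "x \<in> h" using AB(1,2) inc by auto
        ultimately show "{a, b} \<in> incidence_edges P H"
          unfolding incidence_edges_def by (intro CollectI exI[of _ x] exI[of _ h]) simp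
      qed
      show "finite (Inl ` A)" "finite (Inr ` B)" using AB by simp_all
      show "card (Inl ` A) = s" "card (Inr ` B) = s" by (simp_all add: card_image AB)
      show "Inl ` A \<inter> Inr ` B = {}" by blast
    qed
    then show False using free unfolding biclique_free_def by simp
  qed
next
  assume free: "no_biclique s (\<in>) P H"
  show "biclique_free s P H"
    unfolding biclique_free_def contains_biclique_def
  proof (rule notI, elim exE conjE)
    fix A B assume AB: "finite A" "finite B" "card A = s" "card B = s"
      and edges: "\<forall>a\<in>A. \<forall>b\<in>B. {a, b} \<in> incidence_edges P H"
    have edge: "(\<exists>x h. a = Inl x \<and> b = Inr h \<and> x \<in> P \<and> h \<in> H \<and> x \<in> h) \<or>
        (\<exists>x h. b = Inl x \<and> a = Inr h \<and> x \<in> P \<and> h \<in> H \<and> x \<in> h)" if "a \<in> A" "b \<in> B" for a b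
    proof -
      have "{a, b} \<in> incidence_edges P H" using edges that by blast
      then obtain x h where "{a, b} = {Inl x, Inr h}" "x \<in> P" "h \<in> H" "x \<in> h"
        unfolding incidence_edges_def by blast
      then show ?thesis unfolding doubleton_eq_iff by metis
    qed
    have no: False
      if ST: "S = Inl ` S'" "T = Inr ` T'" "finite S" "finite T" "card S = s" "card T = s"
        and e: "\<And>x h. x \<in> S' \<Longrightarrow> h \<in> T' \<Longrightarrow> x \<in> P \<and> h \<in> H \<and> x \<in> h"
      for S T :: "('a + 'a set) set" and S' T'
    proof -
      have "finite S'" "finite T'" "card S' = s" "card T' = s"
        using ST(3-6) unfolding ST(1,2) by (simp_all add: card_image finite_image_iff)
      moreover from this s have "S' \<noteq> {}" "T' \<noteq> {}" by auto
      then have "S' \<subseteq> P" "T' \<subseteq> H" using e by blast+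
      ultimately have "\<exists>x\<in>S'. \<exists>h\<in>T'. x \<notin> h" by (intro no_bicliqueD[OF free]) auto
      then show False using e by blast
    qed
    \<comment> \<open>The classes of a biclique are not labelled as points or hyperplanes. One
      vertex of \<open>A\<close> fixes the side of all of \<open>B\<close>, and a vertex of
      \<open>B\<close> then fixes the side of all of \<open>A\<close>; both classes are nonempty
      because \<open>s\<close> is positive.\<close>
    obtain a0 b0 where ab0: "a0 \<in> A" "b0 \<in> B"
      using AB s by (metis One_nat_def card.empty equals0I not_one_le_zero)
    show False
    proof (cases a0)
      case (Inl x0)
      then have B: "\<exists>h. b = Inr h" if "b \<in> B" for b using edge[OF ab0(1) that] by auto
      then have A: "\<exists>x. a = Inl x" if "a \<in> A" for a using edge[OF that ab0(2)] B[OF ab0(2)] by auto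
      show False
      proof (rule no[of A "{x. Inl x \<in> A}" B "{h. Inr h \<in> B}"])
        show "A = Inl ` {x. Inl x \<in> A}" using A by force
        show "B = Inr ` {h. Inr h \<in> B}" using B by force
        show "x \<in> P \<and> h \<in> H \<and> x \<in> h" if "x \<in> {x. Inl x \<in> A}" "h \<in> {h. Inr h \<in> B}" for x h
          using edge[of "Inl x" "Inr h"] that by auto
      qed (use AB in auto)
    next
      case (Inr h0)
      then have B: "\<exists>x. b = Inl x" if "b \<in> B" for b using edge[OF ab0(1) that] by auto
      then have A: "\<exists>h. a = Inr h" if "a \<in> A" for a using edge[OF that ab0(2)] B[OF ab0(2)] by auto
      show False
      proof (rule no[of B "{x. Inl x \<in> B}" A "{h. Inr h \<in> A}"])
        show "A = Inr ` {h. Inr h \<in> A}" using A by force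
        show "B = Inl ` {x. Inl x \<in> B}" using B by force
        show "x \<in> P \<and> h \<in> H \<and> x \<in> h" if "x \<in> {x. Inl x \<in> B}" "h \<in> {h. Inr h \<in> A}" for x h
          using edge[of "Inr h" "Inl x"] that by auto
      qed (use AB in auto)
    qed
  qed
qed

text \<open>\<open>M\<close> is the larger of the two target terms. Raised to the power a * b, these
  terms become exactly the two monomials left after combining the lower and the upper count of
  homomorphisms.\<close>

lemma incidences_bound:
  fixes a b :: nat
  assumes F: "field F" and P: "P \<subseteq> affine_space F d" and H: "\<forall>h\<in>H. affine_hyperplane F d h"
    and fin: "finite P" "finite H" and ne: "card P > 0" "card H > 0"
    and free: "biclique_free s P H" and s: "s \<ge> 1"
    and ab: "a \<ge> 1" "b \<ge> 1" "a + b = d + 1"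
  shows "real (incidences P H) \<le> 4 * (2 * (real d + 1) * real s) ^ (d + 1) *
     max (real (card P) * real (card H) powr (1 - 1 / a))
         (real (card P) powr (1 - 1 / b) * real (card H))"
proof -
  define R where "R = 2 * (a + b) * s"
  define m where "m = card P"
  define n where "n = card H"
  define e where "e = incidences P H"
  define M where "M = max (real m * real n powr (1 - 1 / a)) (real m powr (1 - 1 / b) * real n)"
  have mn: "m > 0" "n > 0" using ne by (simp_all add: m_def n_def)
  have R1: "R \<ge> 1" using s ab by (simp add: R_def)
  have nb: "no_biclique s (\<in>) P H" using free s by (simp add: biclique_free_iff)
  have "card (homs (\<in>) P H a b) \<le> 2 * (m ^ a * R ^ b + n ^ b * R ^ a)"
    unfolding m_def n_def
    by (rule card_homs_upper[OF fin nb ab(1,2) s R_def])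
       (rule degenerate_of_homs[OF F P H fin nb ab(3)])
  moreover have "e ^ (a * b) \<le> n ^ ((a - 1) * b) * m ^ (a * (b - 1)) * card (homs (\<in>) P H a b)"
    unfolding e_def incidences_eq m_def n_def by (rule card_homs_lower[OF fin ab(1,2)])
  ultimately have "e ^ (a * b)
      \<le> n ^ ((a - 1) * b) * m ^ (a * (b - 1)) * (2 * (m ^ a * R ^ b + n ^ b * R ^ a))"
    by (meson mult_le_mono2 order_trans)
  also have "\<dots>
      \<le> n ^ ((a - 1) * b) * m ^ (a * (b - 1)) * (2 * (m ^ a * R ^ (a + b) + n ^ b * R ^ (a + b)))"
    using R1 by (intro mult_le_mono2 add_mono power_increasing) auto
  also have "\<dots> = 2 * R ^ (a + b) * (m ^ (a * (b - 1) + a) * n ^ ((a - 1) * b)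
                                    + m ^ (a * (b - 1)) * n ^ ((a - 1) * b + b))"
    by (simp add: power_add algebra_simps)
  also have "a * (b - 1) + a = a * b" using ab by (cases b) auto
  also have "(a - 1) * b + b = a * b" using ab by (cases a) auto
  finally have E: "e ^ (a * b) \<le> 2 * R ^ (a + b) * (m ^ (a * b) * n ^ ((a - 1) * b)
                                    + m ^ (a * (b - 1)) * n ^ (a * b))" .
  have M0: "M \<ge> 0" unfolding M_def by (simp add: le_max_iff_disj)
  have pw: "(real k powr (1 - 1 / real c)) ^ (c * l) = real k ^ ((c - 1) * l)"
    if "k > 0" "c \<ge> 1" for k c l :: nat
  proof -
    have "(1 - 1 / real c) * real (c * l) = real ((c - 1) * l)"
      using that by (simp add: field_simps of_nat_diff)
    then have "(real k powr (1 - 1 / real c)) powr real (c * l) = real k powr real ((c - 1) * l)"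
      by (simp only: powr_powr)
    then show ?thesis
      using that by (subst (asm) (1 2) powr_realpow) auto
  qed
  have "(real m * real n powr (1 - 1 / a)) ^ (a * b) \<le> M ^ (a * b)"
    by (rule power_mono) (auto simp: M_def)
  then have M1: "real m ^ (a * b) * real n ^ ((a - 1) * b) \<le> M ^ (a * b)"
    using pw[OF mn(2) ab(1), of b] by (simp add: power_mult_distrib)
  have "(real m powr (1 - 1 / b) * real n) ^ (a * b) \<le> M ^ (a * b)"
    by (rule power_mono) (auto simp: M_def)
  then have M2: "real m ^ (a * (b - 1)) * real n ^ (a * b) \<le> M ^ (a * b)"
    using pw[OF mn(1) ab(2), of a] by (simp add: power_mult_distrib mult.commute)
  have "real e ^ (a * b) \<le> 2 * real R ^ (a + b) * (real m ^ (a * b) * real n ^ ((a - 1) * b)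
                                    + real m ^ (a * (b - 1)) * real n ^ (a * b))"
    using of_nat_mono[OF E, where 'a = real] by simp
  also have "\<dots> \<le> 2 * real R ^ (a + b) * (M ^ (a * b) + M ^ (a * b))"
    by (intro mult_left_mono add_mono M1 M2) auto
  also have "\<dots> = 4 * real R ^ (a + b) * M ^ (a * b)" by simp
  \<comment> \<open>The constant is at least 1, so it may be replaced by its own power; taking the
    root of order a * b then returns it unchanged instead of producing a fractional
    exponent.\<close>
  also have "\<dots> \<le> (4 * real R ^ (a + b)) ^ (a * b) * M ^ (a * b)"
  proof (rule mult_right_mono)
    have "1 \<le> real R ^ (a + b)" using R1 by (intro one_le_power) simp
    then have "(4 * real R ^ (a + b)) ^ 1 \<le> (4 * real R ^ (a + b)) ^ (a * b)"
      using ab by (intro power_increasing) auto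
    then show "4 * real R ^ (a + b) \<le> (4 * real R ^ (a + b)) ^ (a * b)" by simp
  qed (use M0 in simp)
  finally have "real e ^ (a * b) \<le> (4 * real R ^ (a + b) * M) ^ (a * b)"
    by (simp only: power_mult_distrib)
  then have "real e \<le> 4 * real R ^ (a + b) * M"
    using ab M0 by (subst (asm) power_mono_iff) auto
  moreover have "real R = 2 * (real d + 1) * real s"
    unfolding R_def ab(3) by (simp add: algebra_simps)
  ultimately show ?thesis
    unfolding ab(3) by (simp add: e_def M_def m_def n_def)
qed

section \<open>Comparison of the two terms and the ranges of \<alpha>\<close>

lemma powr_le_cases:
  fixes m n \<alpha> p q :: real
  assumes "m \<ge> 1" "n = m powr \<alpha>" "p > 0" "q > 0"
  shows "\<alpha> * q \<le> p \<Longrightarrow> m powr (1 - 1 / q) * n \<le> m * n powr (1 - 1 / p)"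
    and "p \<le> \<alpha> * q \<Longrightarrow> m * n powr (1 - 1 / p) \<le> m powr (1 - 1 / q) * n"
proof -
  have 1: "m powr (1 - 1 / q) * n = m powr (1 - 1 / q + \<alpha>)"
    using assms by (simp add: powr_add)
  have 2: "m * n powr (1 - 1 / p) = m powr (1 + \<alpha> * (1 - 1 / p))"
    using assms by (simp add: powr_add powr_powr)
  show "m powr (1 - 1 / q) * n \<le> m * n powr (1 - 1 / p)" if "\<alpha> * q \<le> p"
    unfolding 1 2 using that assms by (intro powr_mono) (auto simp: field_simps)
  show "m * n powr (1 - 1 / p) \<le> m powr (1 - 1 / q) * n" if "p \<le> \<alpha> * q"
    unfolding 1 2 using that assms by (intro powr_mono) (auto simp: field_simps)
qed

text \<open>Every range is one choice of (a, b): (1, d), (t - 1, d + 2 - t), (t, d + 1 - t) and (d,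
  1). At the two ends one factor has exponent 0, which gives the linear bounds.\<close>

lemma upper_bounds_field:
  assumes F: "field F" and d: "d \<ge> 1" and s: "s \<ge> 1"
  shows "upper_bounds F d s (4 * (2 * (real d + 1) * real s) ^ (d + 1))"
  unfolding upper_bounds_def
proof (intro allI impI)
  fix m n :: nat and \<alpha> :: real and P H
  assume m: "m > 0" and n: "n > 0" and \<alpha>: "\<alpha> > 0" and nm: "real n = real m powr \<alpha>"
    and P: "P \<subseteq> affine_space F d" "finite P" "card P = m"
    and H: "\<forall>h\<in>H. affine_hyperplane F d h" "finite H" "card H = n"
    and free: "biclique_free s P H"
  let ?C = "4 * (2 * (real d + 1) * real s) ^ (d + 1)"
  let ?I = "real (incidences P H)"
  have C0: "?C \<ge> 0" by simp
  have main: "?I \<le> ?C * max (real m * real n powr (1 - 1 / a)) (real m powr (1 - 1 / b) * real n)"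
    if "a \<ge> 1" "b \<ge> 1" "a + b = d + 1" for a b :: nat
    using incidences_bound[OF F P(1) H(1) P(2) H(2) _ _ free s that] P(3) H(3) m n by simp
  have m1: "real m \<ge> 1" using m by simp
  note cmp = powr_le_cases[OF m1 nm]
  have A: "?I \<le> ?C * (real m * real n powr (1 - 1 / a))"
    if "a \<ge> 1" "b \<ge> 1" "a + b = d + 1" "\<alpha> * b \<le> a" for a b :: nat
  proof -
    have "max (real m * real n powr (1 - 1 / a)) (real m powr (1 - 1 / b) * real n)
        = real m * real n powr (1 - 1 / a)"
      using cmp(1)[of a b] that by (intro max_absorb1) simp
    then show ?thesis using main[OF that(1-3)] by simp
  qed
  have B: "?I \<le> ?C * (real m powr (1 - 1 / b) * real n)"
    if "a \<ge> 1" "b \<ge> 1" "a + b = d + 1" "a \<le> \<alpha> * b" for a b :: nat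
  proof -
    have "max (real m * real n powr (1 - 1 / a)) (real m powr (1 - 1 / b) * real n)
        = real m powr (1 - 1 / b) * real n"
      using cmp(2)[of a b] that by (intro max_absorb2) simp
    then show ?thesis using main[OF that(1-3)] by simp
  qed
  show "(\<alpha> \<in> {0<..beta_exp d 1} \<longrightarrow> ?I \<le> ?C * real m) \<and>
        (\<forall>t\<in>{2..d}. \<alpha> \<in> {beta_exp d (t - 1)..alpha_exp d t} \<longrightarrow>
           ?I \<le> ?C * (real m powr (1 - 1 / (real d + 2 - real t)) * real n)) \<and>
        (\<forall>t\<in>{2..d}. \<alpha> \<in> {alpha_exp d t..beta_exp d t} \<longrightarrow>
           ?I \<le> ?C * (real m * real n powr (1 - 1 / real t))) \<and>
        (\<alpha> \<in> {beta_exp d d..} \<longrightarrow> ?I \<le> ?C * real n)"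
  proof (intro conjI impI ballI)
    assume "\<alpha> \<in> {0<..beta_exp d 1}"
    then show "?I \<le> ?C * real m"
      using A[of 1 d] d n by (simp add: beta_exp_def field_simps)
  next
    fix t assume t: "t \<in> {2..d}" and "\<alpha> \<in> {beta_exp d (t - 1)..alpha_exp d t}"
    then have "real (t - 1) \<le> \<alpha> * real (d + 2 - t)"
      by (simp add: beta_exp_def field_simps of_nat_diff)
    then have "?I \<le> ?C * (real m powr (1 - 1 / real (d + 2 - t)) * real n)"
      using t by (intro B[of "t - 1"]) auto
    moreover have "real (d + 2 - t) = real d + 2 - real t" using t by (simp add: of_nat_diff)
    ultimately show "?I \<le> ?C * (real m powr (1 - 1 / (real d + 2 - real t)) * real n)"
      by (simp only:)
  next
    fix t assume t: "t \<in> {2..d}" and "\<alpha> \<in> {alpha_exp d t..beta_exp d t}"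
    then have "\<alpha> * real (d + 1 - t) \<le> real t"
      by (simp add: beta_exp_def field_simps of_nat_diff)
    then show "?I \<le> ?C * (real m * real n powr (1 - 1 / real t))"
      using t by (intro A[of t "d + 1 - t"]) auto
  next
    assume "\<alpha> \<in> {beta_exp d d..}"
    then show "?I \<le> ?C * real n"
      using B[of d 1] d m by (simp add: beta_exp_def)
  qed
qed

section \<open>Transfer of configurations to fields of integers\<close>

text \<open>The generated field is contained in the union of countable stages, each obtained from
  the previous one by one round of field operations.\<close>

lemma countable_generate_field:
  assumes "countable H"
  shows "countable (generate_field R H)"
proof -
  define step where "step S = S \<union> (\<lambda>x. \<ominus>\<^bsub>R\<^esub> x) ` S \<union> (\<lambda>x. inv\<^bsub>R\<^esub> x) ` S \<union>
     (\<lambda>(x, y). x \<oplus>\<^bsub>R\<^esub> y) ` (S \<times> S) \<union> (\<lambda>(x, y). x \<otimes>\<^bsub>R\<^esub> y) ` (S \<times> S)" for S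
  define T where "T n = (step ^^ n) (insert \<one>\<^bsub>R\<^esub> H)" for n
  have T_Suc: "T (Suc n) = step (T n)" for n by (simp add: T_def)
  have "countable (T n)" for n
    by (induction n) (use assms in \<open>auto simp: T_Suc step_def, simp add: T_def\<close>)
  then have "countable (\<Union>n. T n)" by simp
  moreover have "generate_field R H \<subseteq> (\<Union>n. T n)"
  proof
    have mono: "T i \<subseteq> T j" if "i \<le> j" for i j
      using that by (rule lift_Suc_mono_le[rotated]) (auto simp: T_Suc step_def)
    have un: "\<exists>n. f x \<in> T n" if "x \<in> T i" "\<And>S. x \<in> S \<Longrightarrow> f x \<in> step S" for f x i
      using that T_Suc by blast
    have bin: "\<exists>n. f x y \<in> T n"
      if "x \<in> T i" "y \<in> T j" "\<And>S. x \<in> S \<Longrightarrow> y \<in> S \<Longrightarrow> f x y \<in> step S" for f x y i j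
      using that(3)[of "T (max i j)"] that(1,2) mono[of i "max i j"] mono[of j "max i j"]
        T_Suc[of "max i j"] by (metis max.cobounded1 max.cobounded2 subsetD)
    fix x assume "x \<in> generate_field R H"
    then have "\<exists>n. x \<in> T n"
    proof induction
      case one
      have "\<one>\<^bsub>R\<^esub> \<in> T 0" by (simp add: T_def)
      then show ?case ..
    next
      case (incl h)
      then have "h \<in> T 0" by (simp add: T_def)
      then show ?case ..
    next
      case (a_inv h)
      then obtain i where "h \<in> T i" by blast
      then show ?case by (rule un) (auto simp: step_def)
    next
      case (m_inv h)
      then obtain i where "h \<in> T i" by blast
      then show ?case by (rule un) (auto simp: step_def)
    next
      case (eng_add h1 h2)
      then obtain i j where "h1 \<in> T i" "h2 \<in> T j" by blast
      then show ?case by (rule bin) (auto simp: step_def)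
    next
      case (eng_mult h1 h2)
      then obtain i j where "h1 \<in> T i" "h2 \<in> T j" by blast
      then show ?case by (rule bin) (auto simp: step_def)
    qed
    then show "x \<in> (\<Union>n. T n)" by blast
  qed
  ultimately show ?thesis by (rule countable_subset[rotated])
qed

text \<open>Finitely many field elements describe the configuration. The subfield that they generate
  is countable, so a numbering of it transports the field structure to integers.\<close>

lemma configuration_int_copy:
  fixes F :: "'a ring"
  assumes F: "field F" and P: "finite P" "P \<subseteq> affine_space F d"
    and H: "finite H" "\<forall>h\<in>H. affine_hyperplane F d h"
  obtains G :: "int ring" and f g where "field G" "inj_on f P" "f ` P \<subseteq> affine_space G d"
    "inj_on g H" "\<forall>h\<in>g ` H. affine_hyperplane G d h"
    "\<And>x h. x \<in> P \<Longrightarrow> h \<in> H \<Longrightarrow> f x \<in> g h \<longleftrightarrow> x \<in> h"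
proof -
  interpret F: field F by fact
  have "\<forall>h\<in>H. \<exists>p. fst p \<in> affine_space F d \<and> snd p \<in> carrier F \<and> (\<exists>i<d. fst p i \<noteq> \<zero>\<^bsub>F\<^esub>) \<and>
     h = {x \<in> affine_space F d. (\<Oplus>\<^bsub>F\<^esub>l\<in>{..<d}. fst p l \<otimes>\<^bsub>F\<^esub> x l) = snd p}"
    (is "\<forall>h\<in>_. \<exists>p. ?Q h p")
  proof
    fix h assume "h \<in> H"
    then have "affine_hyperplane F d h" using H by blast
    then obtain a b where "a \<in> affine_space F d" "b \<in> carrier F" "\<exists>i<d. a i \<noteq> \<zero>\<^bsub>F\<^esub>"
      "h = {x \<in> affine_space F d. (\<Oplus>\<^bsub>F\<^esub>l\<in>{..<d}. a l \<otimes>\<^bsub>F\<^esub> x l) = b}"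
      unfolding affine_hyperplane_def by blast
    then have "?Q h (a, b)" by simp
    then show "\<exists>p. ?Q h p" by blast
  qed
  from bchoice[OF this] obtain ab where Q: "\<forall>h\<in>H. ?Q h (ab h)" by blast
  define a where "a h = fst (ab h)" for h
  define b where "b h = snd (ab h)" for h
  have a: "a h \<in> affine_space F d" and b: "b h \<in> carrier F" and a0: "\<exists>i<d. a h i \<noteq> \<zero>\<^bsub>F\<^esub>"
    and heq: "h = {x \<in> affine_space F d. (\<Oplus>\<^bsub>F\<^esub>l\<in>{..<d}. a h l \<otimes>\<^bsub>F\<^esub> x l) = b h}"
    if "h \<in> H" for h
    using Q[rule_format, OF that] unfolding a_def b_def by blast+
  \<comment> \<open>Distinct hyperplanes over the field may have the same trace on the points over a subfield;
     points that separate them prevent this.\<close>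
  define w where "w h h' = (SOME x. x \<in> h \<longleftrightarrow> x \<notin> h')" for h h' :: "(nat \<Rightarrow> 'a) set"
  have w: "w h h' \<in> h \<longleftrightarrow> w h h' \<notin> h'" if "h \<noteq> h'" for h h'
    unfolding w_def using that by (intro someI_ex[of "\<lambda>x. x \<in> h \<longleftrightarrow> x \<notin> h'"]) blast
  define W where "W = {w h h' | h h'. h \<in> H \<and> h' \<in> H \<and> h \<noteq> h'}"
  have "W \<subseteq> (\<lambda>(h, h'). w h h') ` (H \<times> H)" unfolding W_def by blast
  then have finW: "finite W" using H(1) by (meson finite_SigmaI finite_imageI finite_subset)
  have W: "W \<subseteq> affine_space F d"
  proof
    fix x assume "x \<in> W"
    then obtain h h' where "x = w h h'" "h \<in> H" "h' \<in> H" "h \<noteq> h'" unfolding W_def by blast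
    then show "x \<in> affine_space F d" using w[of h h'] heq[of h] heq[of h'] by blast
  qed
  \<comment> \<open>The coordinates of the separating points are included along with those of
    \<open>P\<close> and the coefficients, so that these points survive the passage to the
    subfield.\<close>
  define C where "C = (\<Union>x\<in>P \<union> W \<union> a ` H. x ` {..<d}) \<union> b ` H"
  have Cc: "C \<subseteq> carrier F"
    using P(2) W a b unfolding C_def affine_space_def by (auto simp: PiE_def Pi_def)
  have "finite C" unfolding C_def using P(1) finW H(1) by simp
  define K where "K = generate_field F C"
  have CK: "C \<subseteq> K" unfolding K_def by (auto intro: generate_field.incl)
  have Kc: "K \<subseteq> carrier F" unfolding K_def by (rule F.generate_field_incl[OF Cc])
  have cK: "countable K"
    unfolding K_def using \<open>finite C\<close> by (intro countable_generate_field countable_finite)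
  interpret K: field "F\<lparr>carrier := K\<rparr>"
    unfolding K_def by (rule F.generate_field_is_field[OF Cc])
  \<comment> \<open>An arbitrary numbering: the operations of \<open>G\<close> are those of the
    subfield carried along it and have nothing to do with integer arithmetic.\<close>
  define \<iota> where "\<iota> x = int (to_nat_on K x)" for x
  have inj: "inj_on \<iota> K"
    using inj_on_to_nat_on[OF cK] unfolding \<iota>_def by (auto simp: inj_on_def)
  define G where "G = image_ring \<iota> (F\<lparr>carrier := K\<rparr>)"
  have inj': "inj_on \<iota> (carrier (F\<lparr>carrier := K\<rparr>))" using inj by simp
  have G: "field G" unfolding G_def by (rule K.inj_imp_image_ring_is_field[OF inj'])
  interpret G: field G by fact
  have "\<iota> \<in> ring_iso (F\<lparr>carrier := K\<rparr>) G"
    unfolding G_def by (rule inj_imp_image_ring_iso[OF inj'])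
  then have hom: "\<iota> \<in> ring_hom (F\<lparr>carrier := K\<rparr>) G" by (simp add: ring_iso_def)
  have \<iota>_closed: "\<iota> x \<in> carrier G" if "x \<in> K" for x
    using ring_hom_closed[OF hom] that by simp
  have \<iota>_add: "\<iota> (x \<oplus>\<^bsub>F\<^esub> y) = \<iota> x \<oplus>\<^bsub>G\<^esub> \<iota> y" if "x \<in> K" "y \<in> K" for x y
    using ring_hom_add[OF hom, of x y] that by simp
  have \<iota>_mult: "\<iota> (x \<otimes>\<^bsub>F\<^esub> y) = \<iota> x \<otimes>\<^bsub>G\<^esub> \<iota> y" if "x \<in> K" "y \<in> K" for x y
    using ring_hom_mult[OF hom, of x y] that by simp
  have \<iota>_zero: "\<iota> \<zero>\<^bsub>F\<^esub> = \<zero>\<^bsub>G\<^esub>"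
    unfolding G_def image_ring_zero by simp
  have K_zero: "\<zero>\<^bsub>F\<^esub> \<in> K" using K.zero_closed by simp
  have K_add: "x \<oplus>\<^bsub>F\<^esub> y \<in> K" if "x \<in> K" "y \<in> K" for x y
    using K.add.m_closed[of x y] that by simp
  have K_mult: "x \<otimes>\<^bsub>F\<^esub> y \<in> K" if "x \<in> K" "y \<in> K" for x y
    using K.m_closed[of x y] that by simp
  have sum: "(\<Oplus>\<^bsub>F\<^esub>i\<in>S. u i) \<in> K \<and> \<iota> (\<Oplus>\<^bsub>F\<^esub>i\<in>S. u i) = (\<Oplus>\<^bsub>G\<^esub>i\<in>S. \<iota> (u i))"
    if "finite S" "\<And>i. i \<in> S \<Longrightarrow> u i \<in> K" for S :: "nat set" and u
    using that
  proof (induction S)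
    case empty
    then show ?case by (simp add: K_zero \<iota>_zero)
  next
    case (insert i S)
    have "(\<Oplus>\<^bsub>F\<^esub>i\<in>insert i S. u i) = u i \<oplus>\<^bsub>F\<^esub> (\<Oplus>\<^bsub>F\<^esub>i\<in>S. u i)"
      using insert Kc by (intro F.finsum_insert) auto
    moreover have "(\<Oplus>\<^bsub>G\<^esub>i\<in>insert i S. \<iota> (u i)) = \<iota> (u i) \<oplus>\<^bsub>G\<^esub> (\<Oplus>\<^bsub>G\<^esub>i\<in>S. \<iota> (u i))"
      using insert \<iota>_closed by (intro G.finsum_insert) auto
    ultimately show ?case using insert K_add \<iota>_add by simp
  qed
  define f where "f x = restrict (\<lambda>i. \<iota> (x i)) {..<d}" for x :: "nat \<Rightarrow> 'a"
  \<comment> \<open>A hyperplane is moved by its equation, because its point set may contain points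
    with coordinates outside the subfield, where \<open>f\<close> has no meaning.\<close>
  define g where "g h = {x \<in> affine_space G d. (\<Oplus>\<^bsub>G\<^esub>l\<in>{..<d}. f (a h) l \<otimes>\<^bsub>G\<^esub> x l) = \<iota> (b h)}" for h
  define A where "A = {x \<in> affine_space F d. x ` {..<d} \<subseteq> K}"
  have PA: "P \<subseteq> A" "W \<subseteq> A" "a ` H \<subseteq> A"
  proof -
    have *: "Q \<subseteq> A" if Q: "Q \<subseteq> affine_space F d" "(\<Union>x\<in>Q. x ` {..<d}) \<subseteq> C" for Q
    proof
      fix x assume "x \<in> Q"
      then have "x \<in> affine_space F d" "x ` {..<d} \<subseteq> C" using Q by blast+
      then show "x \<in> A" using CK unfolding A_def by blast
    qed
    show "P \<subseteq> A" using P(2) by (rule *) (auto simp: C_def)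
    show "W \<subseteq> A" using W by (rule *) (auto simp: C_def)
    show "a ` H \<subseteq> A" by (rule *) (use a in \<open>auto simp: C_def\<close>)
  qed
  have bK: "b h \<in> K" if "h \<in> H" for h using that CK unfolding C_def by blast
  have fA: "f x \<in> affine_space G d" if "x \<in> A" for x
    using that \<iota>_closed unfolding A_def f_def affine_space_def by (auto simp: PiE_def)
  have finj: "inj_on f A"
  proof (rule inj_onI)
    fix x y assume xy: "x \<in> A" "y \<in> A" "f x = f y"
    have "x i = y i" if "i < d" for i
    proof -
      have "\<iota> (x i) = \<iota> (y i)" using fun_cong[OF xy(3), of i] that by (simp add: f_def)
      then show ?thesis using inj xy that unfolding A_def by (auto dest: inj_onD)
    qed
    then show "x = y" using xy unfolding A_def affine_space_def by (auto intro: PiE_ext)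
  qed
  have mem: "f x \<in> g h \<longleftrightarrow> x \<in> h" if x: "x \<in> A" and h: "h \<in> H" for x h
  proof -
    have ah: "a h l \<in> K" "x l \<in> K" if "l < d" for l
      using PA(3) h x that unfolding A_def by blast+
    have "(\<Oplus>\<^bsub>G\<^esub>l\<in>{..<d}. f (a h) l \<otimes>\<^bsub>G\<^esub> f x l) = (\<Oplus>\<^bsub>G\<^esub>l\<in>{..<d}. \<iota> (a h l \<otimes>\<^bsub>F\<^esub> x l))"
      using ah by (intro G.finsum_cong') (auto simp: f_def \<iota>_mult \<iota>_closed)
    also have "\<dots> = \<iota> (\<Oplus>\<^bsub>F\<^esub>l\<in>{..<d}. a h l \<otimes>\<^bsub>F\<^esub> x l)"
      using sum[of "{..<d}" "\<lambda>l. a h l \<otimes>\<^bsub>F\<^esub> x l"] ah K_mult by simp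
    finally have "f x \<in> g h \<longleftrightarrow> \<iota> (\<Oplus>\<^bsub>F\<^esub>l\<in>{..<d}. a h l \<otimes>\<^bsub>F\<^esub> x l) = \<iota> (b h)"
      using fA[OF x] unfolding g_def by simp
    also have "\<dots> \<longleftrightarrow> (\<Oplus>\<^bsub>F\<^esub>l\<in>{..<d}. a h l \<otimes>\<^bsub>F\<^esub> x l) = b h"
      using sum[of "{..<d}" "\<lambda>l. a h l \<otimes>\<^bsub>F\<^esub> x l"] ah K_mult
      by (intro inj_on_eq_iff[OF inj _ bK[OF h]]) simp
    also have "\<dots> \<longleftrightarrow> x \<in> h"
      using x by (subst (2) heq[OF h]) (simp add: A_def)
    finally show ?thesis .
  qed
  show thesis
  proof (rule that[OF G])
    show "inj_on f P" using finj PA(1) by (rule inj_on_subset)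
    show "f ` P \<subseteq> affine_space G d" using fA PA(1) by blast
    show "inj_on g H"
    proof (rule inj_onI, rule ccontr)
      fix h h' assume hh: "h \<in> H" "h' \<in> H" "g h = g h'" "h \<noteq> h'"
      then have "w h h' \<in> A" using PA(2) unfolding W_def by blast
      then show False using mem[of "w h h'"] w[OF hh(4)] hh by blast
    qed
    show "\<forall>h\<in>g ` H. affine_hyperplane G d h"
    proof
      fix k assume "k \<in> g ` H"
      then obtain h where h: "h \<in> H" "k = g h" by blast
      obtain i where i: "i < d" "a h i \<noteq> \<zero>\<^bsub>F\<^esub>" using a0[OF h(1)] by blast
      have "a h i \<in> K" using PA(3) h i unfolding A_def by blast
      then have "f (a h) i \<noteq> \<zero>\<^bsub>G\<^esub>"
        using i inj_on_eq_iff[OF inj _ K_zero] by (simp add: f_def flip: \<iota>_zero)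
      moreover have "f (a h) \<in> affine_space G d" using fA PA(3) h by blast
      moreover have "\<iota> (b h) \<in> carrier G" using \<iota>_closed bK h by blast
      ultimately show "affine_hyperplane G d k"
        unfolding affine_hyperplane_def h(2) g_def using i(1) by blast
    qed
    show "f x \<in> g h \<longleftrightarrow> x \<in> h" if "x \<in> P" "h \<in> H" for x h
      using mem that PA(1) by blast
  qed
qed

section \<open>Transport of incidences and bicliques\<close>

lemma incidences_image:
  assumes "inj_on f P" "inj_on g H" "\<And>x h. x \<in> P \<Longrightarrow> h \<in> H \<Longrightarrow> f x \<in> g h \<longleftrightarrow> x \<in> h"
  shows "incidences (f ` P) (g ` H) = incidences P H"
proof -
  have "bij_betw (map_prod f g) {(x, h). x \<in> P \<and> h \<in> H \<and> x \<in> h}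
     {(x, h). x \<in> f ` P \<and> h \<in> g ` H \<and> x \<in> h}"
    unfolding bij_betw_def
  proof
    show "inj_on (map_prod f g) {(x, h). x \<in> P \<and> h \<in> H \<and> x \<in> h}"
      using assms(1,2) by (auto simp: inj_on_def)
    show "map_prod f g ` {(x, h). x \<in> P \<and> h \<in> H \<and> x \<in> h} = {(x, h). x \<in> f ` P \<and> h \<in> g ` H \<and> x \<in> h}"
      using assms(3) by (auto simp: image_iff)
  qed
  then show ?thesis unfolding incidences_eq by (rule bij_betw_same_card[symmetric])
qed

lemma biclique_free_image:
  assumes s: "s \<ge> 1" and free: "biclique_free s P H"
    and inj: "inj_on f P" "inj_on g H" and mem: "\<And>x h. x \<in> P \<Longrightarrow> h \<in> H \<Longrightarrow> f x \<in> g h \<longleftrightarrow> x \<in> h"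
  shows "biclique_free s (f ` P) (g ` H)"
  unfolding biclique_free_iff[OF s] no_biclique_def
proof (intro allI impI)
  fix A B assume AB: "A \<subseteq> f ` P" "B \<subseteq> g ` H" "finite A" "finite B" "card A = s" "card B = s"
  obtain A' where A': "A' \<subseteq> P" "A = f ` A'" using AB(1) by (meson subset_imageE)
  obtain B' where B': "B' \<subseteq> H" "B = g ` B'" using AB(2) by (meson subset_imageE)
  have inj': "inj_on f A'" "inj_on g B'" using A' B' inj by (meson inj_on_subset)+
  have "\<exists>x\<in>A'. \<exists>h\<in>B'. x \<notin> h"
  proof (rule no_bicliqueD)
    show "no_biclique s (\<in>) P H" using free s by (simp add: biclique_free_iff)
    show "finite A'" "finite B'"
      using AB(3,4) inj' unfolding A' B' by (simp_all add: finite_image_iff)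
    show "s \<le> card A'" "s \<le> card B'"
      using AB(5,6) inj' unfolding A' B' by (simp_all add: card_image)
  qed (use A' B' in auto)
  then show "\<exists>x\<in>A. \<exists>h\<in>B. x \<notin> h" using mem A' B' by blast
qed

text \<open>Cardinalities, incidences and freeness are preserved by an integer copy, so a constant
  valid for integer carriers is valid for every carrier type.\<close>

lemma upper_bounds_transfer:
  fixes F :: "'a ring"
  assumes int: "\<And>G :: int ring. field G \<Longrightarrow> upper_bounds G d s C" and F: "field F" and s: "s \<ge> 1"
  shows "upper_bounds F d s C"
  unfolding upper_bounds_def
proof (intro allI impI, goal_cases)
  case (1 m n \<alpha> P H)
  obtain G :: "int ring" and f g where G: "field G" "inj_on f P" "f ` P \<subseteq> affine_space G d"
    "inj_on g H" "\<forall>h\<in>g ` H. affine_hyperplane G d h"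
    and mem: "\<And>x h. x \<in> P \<Longrightarrow> h \<in> H \<Longrightarrow> f x \<in> g h \<longleftrightarrow> x \<in> h"
    using configuration_int_copy[OF F 1(6) 1(5) 1(9) 1(8)] by blast
  have "biclique_free s (f ` P) (g ` H)"
    by (rule biclique_free_image[OF s 1(11) G(2,4) mem])
  moreover have "card (f ` P) = m" "card (g ` H) = n"
    using G(2,4) 1 by (simp_all add: card_image)
  ultimately have "(\<alpha> \<in> {0<..beta_exp d 1} \<longrightarrow> real (incidences (f ` P) (g ` H)) \<le> C * real m) \<and>
        (\<forall>t\<in>{2..d}. \<alpha> \<in> {beta_exp d (t - 1)..alpha_exp d t} \<longrightarrow>
           real (incidences (f ` P) (g ` H))
             \<le> C * (real m powr (1 - 1 / (real d + 2 - real t)) * real n)) \<and>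
        (\<forall>t\<in>{2..d}. \<alpha> \<in> {alpha_exp d t..beta_exp d t} \<longrightarrow>
           real (incidences (f ` P) (g ` H)) \<le> C * (real m * real n powr (1 - 1 / real t))) \<and>
        (\<alpha> \<in> {beta_exp d d..} \<longrightarrow> real (incidences (f ` P) (g ` H)) \<le> C * real n)"
    using int[OF G(1), unfolded upper_bounds_def, rule_format, of m n \<alpha> "f ` P" "g ` H"] G 1
    by blast
  moreover have "incidences (f ` P) (g ` H) = incidences P H"
    using G(2,4) mem by (rule incidences_image)
  ultimately show ?case by (simp only:)
qed

theorem upper_bounds_upper_const:
  fixes F :: "'a ring"
  assumes "d \<ge> 1" "s \<ge> 1" "field F"
  shows "upper_bounds F d s (upper_const s d)"
proof (rule upper_bounds_transfer[OF _ assms(3,2)])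
  have "\<exists>C. \<forall>F :: int ring. field F \<longrightarrow> upper_bounds F d s C"
    using upper_bounds_field assms by blast
  from someI_ex[OF this]
  show "upper_bounds G d s (upper_const s d)" if "field G" for G :: "int ring"
    using that unfolding upper_const_def by blast
qed

section \<open>Finite sets cut out by diagonal equations\<close>

definition fscale :: "'f::field \<Rightarrow> ('x \<Rightarrow> 'f) \<Rightarrow> 'x \<Rightarrow> 'f" where
  "fscale c g = (\<lambda>x. c * g x)"

text \<open>A function on \<open>A\<close> is a total function that vanishes off \<open>A\<close>.
  Linear relations that hold only on \<open>A\<close> thus become relations in one fixed vector
  space.\<close>

definition on :: "'x set \<Rightarrow> ('x \<Rightarrow> 'f::field) \<Rightarrow> 'x \<Rightarrow> 'f" where
  "on A g = (\<lambda>x. if x \<in> A then g x else 0)"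

interpretation fun_space: vector_space fscale
  by unfold_locales (auto simp: fscale_def fun_eq_iff algebra_simps)

interpretation fun_form: vector_space_pair fscale "(*) :: 'f::field \<Rightarrow> 'f \<Rightarrow> 'f"
  by unfold_locales (auto simp: algebra_simps)

lemma on_add: "on A (\<lambda>x. g x + h x) = on A g + on A h"
  by (auto simp: on_def fun_eq_iff)

lemma on_scale: "on A (\<lambda>x. c * g x) = fscale c (on A g)"
  by (auto simp: on_def fscale_def fun_eq_iff)

lemma on_const: "on A (\<lambda>x. c) = fscale c (on A (\<lambda>x. 1))"
  by (auto simp: on_def fscale_def fun_eq_iff)

lemma on_mult: "on A (\<lambda>x. g x * h x) = on A g * on A h"
  by (auto simp: on_def fun_eq_iff)

lemma on_sum: "on A (\<lambda>x. \<Sum>i\<in>I. g i x) = (\<Sum>i\<in>I. on A (g i))"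
proof (induction I rule: infinite_finite_induct)
  case (insert i I)
  then show ?case by (simp add: on_add)
qed (auto simp: on_def fun_eq_iff)

lemma on_cong: "(\<And>x. x \<in> A \<Longrightarrow> g x = h x) \<Longrightarrow> on A g = on A h"
  by (auto simp: on_def fun_eq_iff)

lemma subspace_times:
  assumes "fun_space.subspace V"
  shows "fun_space.subspace {g. g * h \<in> V}"
proof (rule fun_space.subspaceI)
  show "0 \<in> {g. g * h \<in> V}" using fun_space.subspace_0[OF assms] by simp
  show "g1 + g2 \<in> {g. g * h \<in> V}" if "g1 \<in> {g. g * h \<in> V}" "g2 \<in> {g. g * h \<in> V}" for g1 g2
    using fun_space.subspace_add[OF assms] that by (simp add: distrib_right)
  show "fscale c g \<in> {g. g * h \<in> V}" if "g \<in> {g. g * h \<in> V}" for c g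
  proof -
    have "fscale c g * h = fscale c (g * h)" by (auto simp: fscale_def fun_eq_iff)
    then show ?thesis using fun_space.subspace_scale[OF assms] that by simp
  qed
qed

text \<open>Bilinearity, one argument at a time. It makes a filtration by spans of monomials of
  bounded weight multiplicative.\<close>

lemma span_times:
  assumes "g \<in> fun_space.span S" "h \<in> fun_space.span T"
    and "\<And>a b. a \<in> S \<Longrightarrow> b \<in> T \<Longrightarrow> a * b \<in> fun_space.span U"
  shows "g * h \<in> fun_space.span U"
proof -
  have 1: "g * b \<in> fun_space.span U" if "b \<in> T" for b
  proof -
    have "fun_space.span S \<subseteq> {g. g * b \<in> fun_space.span U}"
      by (rule fun_space.span_minimal)
         (use assms(3) that in \<open>auto intro: subspace_times fun_space.subspace_span\<close>)
    then show ?thesis using assms(1) by blast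
  qed
  have "fun_space.span T \<subseteq> {h. h * g \<in> fun_space.span U}"
    by (rule fun_space.span_minimal)
       (use 1 in \<open>auto intro: subspace_times fun_space.subspace_span simp: mult.commute\<close>)
  then show ?thesis using assms(2) by (auto simp: mult.commute)
qed

text \<open>A basis of the span stays independent when \<open>g\<close> is added, so the values 1 at
  \<open>g\<close> and 0 on the basis can be prescribed.\<close>

lemma functional_separating:
  assumes "g \<notin> fun_space.span S"
  obtains \<phi> where "Vector_Spaces.linear fscale (*) \<phi>" "\<phi> g = 1" "\<And>h. h \<in> fun_space.span S \<Longrightarrow> \<phi> h = 0"
proof -
  obtain B where B: "B \<subseteq> S" "fun_space.independent B" "S \<subseteq> fun_space.span B"
    by (rule fun_space.maximal_independent_subset)
  have sp: "fun_space.span S = fun_space.span B"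
    using B(1,3)
    by (intro fun_space.span_eq[THEN iffD2]) (auto intro: fun_space.span_superset[THEN subsetD])
  then have g: "g \<notin> fun_space.span B" using assms by simp
  then have "fun_space.independent (insert g B)" using B(2) by (rule fun_space.independent_insertI)
  from fun_form.linear_independent_extend[OF this, of "\<lambda>x. if x = g then 1 else 0"]
  obtain \<phi> where \<phi>: "Vector_Spaces.linear fscale (*) \<phi>"
    "\<forall>x\<in>insert g B. \<phi> x = (if x = g then 1 else 0)"
    by blast
  have "\<phi> x = 0" if "x \<in> B" for x
    using \<phi>(2) that g fun_space.span_base[of x B] by auto
  then have "\<phi> h = 0" if "h \<in> fun_space.span S" for h
    using fun_form.linear_eq_0_on_span[OF \<phi>(1)] that sp by blast
  then show thesis using that \<phi> by simp
qed

lemma card_le_of_deltas_in_span: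
  fixes A :: "'x set" and T :: "('x \<Rightarrow> 'f::field) set"
  assumes A: "finite A" and T: "finite T" and \<delta>: "\<And>z. z \<in> A \<Longrightarrow> on {z} (\<lambda>x. 1) \<in> fun_space.span T"
  shows "card A \<le> card T"
proof -
  define \<delta> :: "'x \<Rightarrow> 'x \<Rightarrow> 'f" where "\<delta> z = on {z} (\<lambda>x. 1)" for z
  have inj: "inj_on \<delta> A"
    by (rule inj_onI) (auto simp: \<delta>_def on_def fun_eq_iff split: if_splits)
  have "fun_space.independent (\<delta> ` A)"
  proof
    assume "fun_space.dependent (\<delta> ` A)"
    then obtain u z where z: "z \<in> A" "u (\<delta> z) \<noteq> 0" and 0: "(\<Sum>v\<in>\<delta> ` A. fscale (u v) v) = 0"
      using fun_space.dependent_finite[of "\<delta> ` A"] A by auto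
    have "(\<Sum>y\<in>A. fscale (u (\<delta> y)) (\<delta> y)) = 0"
      using 0 by (simp add: sum.reindex[OF inj])
    then have "(\<Sum>y\<in>A. fscale (u (\<delta> y)) (\<delta> y)) z = 0" by simp
    moreover have "(\<Sum>y\<in>B. fscale (u (\<delta> y)) (\<delta> y)) z = (\<Sum>y\<in>B. if z = y then u (\<delta> y) else 0)"
      if "finite B" for B
      using that by (induction B) (auto simp: fscale_def \<delta>_def on_def)
    ultimately show False using A z by simp
  qed
  then have "card (\<delta> ` A) \<le> card T"
    using fun_space.independent_span_bound[OF T, of "\<delta> ` A"] \<delta> by (auto simp: \<delta>_def)
  then show ?thesis using inj by (simp add: card_image)
qed

text \<open>
  If \<open>e\<close> is injective on \<open>{..<d}\<close>, these are the pivot columns of an echelon form of the affine hull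
  of \<open>A\<close>, for the order of the coordinates by decreasing \<open>e\<close>; their number is the affine dimension.
\<close>

definition coord_pivots :: "nat \<Rightarrow> (nat \<Rightarrow> nat) \<Rightarrow> (nat \<Rightarrow> 'f::field) set \<Rightarrow> nat set" where
  "coord_pivots d e A = {j. j < d \<and> on A (\<lambda>x. x j) \<notin>
     fun_space.span (insert (on A (\<lambda>x. 1)) ((\<lambda>i. on A (\<lambda>x. x i)) ` {i. i < d \<and> e j < e i}))}"

text \<open>By definition a non-pivot is a combination of all coordinates with larger
  \<open>e\<close>. The non-pivots among these are replaced recursively; \<open>e\<close> grows
  strictly and is bounded by its maximum, so this ends.\<close>

lemma coord_pivots_span:
  assumes "j < d" "j \<notin> coord_pivots d e A"
  shows "on A (\<lambda>x. x j) \<in> fun_space.span (insert (on A (\<lambda>x. 1))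
     ((\<lambda>i. on A (\<lambda>x. x i)) ` {i \<in> coord_pivots d e A. e j < e i}))"
  using assms
proof (induction "Max (e ` {..<d}) - e j" arbitrary: j rule: less_induct)
  case less
  let ?V = "\<lambda>j. fun_space.span (insert (on A (\<lambda>x. 1))
     ((\<lambda>i. on A (\<lambda>x. x i)) ` {i \<in> coord_pivots d e A. e j < e i}))"
  have "on A (\<lambda>x. x j) \<in> fun_space.span (insert (on A (\<lambda>x. 1))
     ((\<lambda>i. on A (\<lambda>x. x i)) ` {i. i < d \<and> e j < e i}))"
    using less.prems unfolding coord_pivots_def by blast
  moreover have "\<dots> \<subseteq> ?V j"
  proof (rule fun_space.span_minimal)
    have "on A (\<lambda>x. x i) \<in> ?V j" if i: "i < d" "e j < e i" for i
    proof (cases "i \<in> coord_pivots d e A")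
      case True
      then show ?thesis using i by (intro fun_space.span_base) auto
    next
      case False
      have "e i \<le> Max (e ` {..<d})" using i by (intro Max_ge) auto
      then have "Max (e ` {..<d}) - e i < Max (e ` {..<d}) - e j" using i by linarith
      then have "on A (\<lambda>x. x i) \<in> ?V i" using i(1) False by (rule less.hyps)
      moreover have "?V i \<subseteq> ?V j" using i by (intro fun_space.span_mono) auto
      ultimately show ?thesis by blast
    qed
    then show "insert (on A (\<lambda>x. 1)) ((\<lambda>i. on A (\<lambda>x. x i)) ` {i. i < d \<and> e j < e i}) \<subseteq> ?V j"
      by (auto intro: fun_space.span_base)
  qed (rule fun_space.subspace_span)
  ultimately show ?case by blast
qed

text \<open>
  Give \<open>x i\<close> the weight \<open>N / e i\<close>. On \<open>A\<close> the power \<open>x i ^ e i\<close> of a pivot coordinate, of weight \<open>N\<close>, is a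
  polynomial in the pivot coordinates of weight less than \<open>N\<close>. Hence the monomials with exponents
  below \<open>e i\<close> span all functions on \<open>A\<close>.
\<close>

lemma card_le_prod_pivot_degrees:
  fixes A :: "(nat \<Rightarrow> 'f::field) set" and e :: "nat \<Rightarrow> nat"
  assumes A: "finite A" and e: "\<And>i. i < d \<Longrightarrow> e i \<ge> 1"
    and ext: "\<And>x y. x \<in> A \<Longrightarrow> y \<in> A \<Longrightarrow> (\<And>i. i < d \<Longrightarrow> x i = y i) \<Longrightarrow> x = y"
    and J: "J = coord_pivots d e A"
    and sol: "\<And>i. i \<in> J \<Longrightarrow> \<exists>c w. \<forall>x\<in>A. x i ^ e i = c + (\<Sum>j\<in>{..<d} - J. w j * x j ^ e j)"
  shows "card A \<le> (\<Prod>i\<in>J. e i)"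
proof -
  have Jd: "J \<subseteq> {..<d}" unfolding J coord_pivots_def by auto
  have finJ: "finite J" using Jd by (rule finite_subset) simp
  \<comment> \<open>The product is a common multiple of all \<open>e i\<close>, so the weights are
    integers and every power \<open>x i ^ e i\<close> has the same weight.\<close>
  define N where "N = (\<Prod>i<d. e i)"
  define W where "W i = N div e i" for i
  have N: "N \<ge> 1" unfolding N_def using e by (intro prod_ge_1) auto
  have We: "W i * e i = N" if "i < d" for i
    unfolding W_def N_def using that by (intro dvd_div_mult_self dvd_prodI) auto
  have W1: "W i \<ge> 1" if "i < d" for i using We[OF that] N by (cases "W i") auto
  have W_less: "W i < W j" if "i < d" "j < d" "e j < e i" for i j
  proof (rule ccontr)
    assume "\<not> W i < W j"
    then have "W j * e j \<le> W i * e j" by simp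
    also have "\<dots> < W i * e i" using that W1[OF that(1)] by simp
    finally have "W j * e j < W i * e i" .
    then show False using We that by simp
  qed
  define mon :: "(nat \<Rightarrow> nat) \<Rightarrow> (nat \<Rightarrow> 'f) \<Rightarrow> 'f" where
    "mon a = on A (\<lambda>x. \<Prod>i\<in>J. x i ^ a i)" for a
  define wt where "wt a = (\<Sum>i\<in>J. a i * W i)" for a :: "nat \<Rightarrow> nat"
  define U where "U w = fun_space.span (mon ` {a. wt a \<le> w})" for w
  have U_sub: "fun_space.subspace (U w)" for w unfolding U_def by (rule fun_space.subspace_span)
  have U_mono: "U v \<subseteq> U w" if "v \<le> w" for v w
    unfolding U_def using that by (intro fun_space.span_mono) auto
  have mon_mult: "mon a * mon b = mon (\<lambda>i. a i + b i)" for a b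
    unfolding mon_def by (subst on_mult[symmetric]) (simp add: prod.distrib power_add)
  have wt_add: "wt (\<lambda>i. a i + b i) = wt a + wt b" for a b
    by (simp add: wt_def sum.distrib distrib_right)
  have U_mult: "g * h \<in> U (v + w)" if "g \<in> U v" "h \<in> U w" for g h v w
    using that unfolding U_def
  proof (rule span_times)
    fix a b assume "a \<in> mon ` {a. wt a \<le> v}" "b \<in> mon ` {a. wt a \<le> w}"
    then obtain a' b' where "a = mon a'" "wt a' \<le> v" "b = mon b'" "wt b' \<le> w" by blast
    then show "a * b \<in> fun_space.span (mon ` {a. wt a \<le> v + w})"
      by (intro fun_space.span_base) (auto simp: mon_mult wt_add intro!: imageI)
  qed
  have U_mon: "mon a \<in> U w" if "wt a \<le> w" for a w
    unfolding U_def using that by (intro fun_space.span_base) auto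
  have U_one: "on A (\<lambda>x. 1) \<in> U w" for w
    using U_mon[of "\<lambda>_. 0" w] by (simp add: wt_def mon_def)
  have U_const: "on A (\<lambda>x. c) \<in> U w" for c w
    unfolding on_const[of A c] by (rule fun_space.subspace_scale[OF U_sub U_one])
  have U_power: "on A (\<lambda>x. g x ^ k) \<in> U (k * v)" if "on A g \<in> U v" for g k v
  proof (induction k)
    case 0
    then show ?case by (simp add: U_one)
  next
    case (Suc k)
    have "on A (\<lambda>x. g x * g x ^ k) = on A g * on A (\<lambda>x. g x ^ k)" by (rule on_mult)
    then show ?case using U_mult[OF that Suc] by (simp only: power_Suc mult_Suc)
  qed
  have U_pivot: "on A (\<lambda>x. x i) \<in> U (W i)" if "i \<in> J" for i
  proof -
    let ?a = "\<lambda>l. if l = i then 1 else 0"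
    have "mon ?a = on A (\<lambda>x. x i)"
      unfolding mon_def using that finJ
      by (intro on_cong) (simp add: if_distrib[of "\<lambda>n. _ ^ n"] prod.delta cong: if_cong)
    moreover have "wt ?a = W i"
      unfolding wt_def using that finJ by (simp add: if_distrib[of "\<lambda>n. n * _"] cong: if_cong)
    ultimately show ?thesis using U_mon[of ?a "W i"] by simp
  qed
  \<comment> \<open>Only pivots with larger \<open>e\<close> occur here, and their weight is
    strictly smaller than \<open>W j\<close>. This gain of 1 drives the reduction below.\<close>
  have U_dep: "on A (\<lambda>x. x j) \<in> U (W j - 1)" if j: "j < d" "j \<notin> J" for j
  proof -
    have "fun_space.span (insert (on A (\<lambda>x. 1)) ((\<lambda>i. on A (\<lambda>x. x i)) ` {i \<in> J. e j < e i}))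
        \<subseteq> U (W j - 1)"
    proof (rule fun_space.span_minimal[OF _ U_sub])
      have "on A (\<lambda>x. x i) \<in> U (W j - 1)" if "i \<in> J" "e j < e i" for i
      proof -
        have "W i \<le> W j - 1" using W_less[OF _ j(1) that(2)] that(1) Jd by fastforce
        then show ?thesis using U_pivot[OF that(1)] U_mono by blast
      qed
      then show "insert (on A (\<lambda>x. 1)) ((\<lambda>i. on A (\<lambda>x. x i)) ` {i \<in> J. e j < e i}) \<subseteq> U (W j - 1)"
        using U_one by auto
    qed
    then show ?thesis using coord_pivots_span[of j d e A] j unfolding J by blast
  qed
  have U_coord: "\<exists>w. on A (\<lambda>x. x j) \<in> U w" if "j < d" for j
    using U_pivot U_dep that by blast
  have U_dep_power: "on A (\<lambda>x. x j ^ e j) \<in> U (N - 1)" if j: "j < d" "j \<notin> J" for j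
  proof -
    have "e j * (W j - 1) = N - e j"
      using We[OF j(1)] by (simp add: right_diff_distrib' mult.commute)
    then have "e j * (W j - 1) \<le> N - 1" using e[OF j(1)] by simp
    then show ?thesis using U_power[OF U_dep[OF j], of "e j"] U_mono by blast
  qed
  have U_pivot_power: "on A (\<lambda>x. x i ^ e i) \<in> U (N - 1)" if i: "i \<in> J" for i
  proof -
    obtain c w where "\<forall>x\<in>A. x i ^ e i = c + (\<Sum>j\<in>{..<d} - J. w j * x j ^ e j)"
      using sol[OF i] by blast
    then have "on A (\<lambda>x. x i ^ e i) = on A (\<lambda>x. c + (\<Sum>j\<in>{..<d} - J. w j * x j ^ e j))"
      by (intro on_cong) blast
    also have "\<dots> = on A (\<lambda>x. c) + (\<Sum>j\<in>{..<d} - J. fscale (w j) (on A (\<lambda>x. x j ^ e j)))"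
      by (simp add: on_add on_sum on_scale)
    also have "\<dots> \<in> U (N - 1)"
      using U_dep_power
      by (intro fun_space.subspace_add[OF U_sub] U_const fun_space.subspace_sum[OF U_sub]
          fun_space.subspace_scale[OF U_sub]) auto
    finally show ?thesis .
  qed
  define T where "T = mon ` (PiE J (\<lambda>i. {..<e i}))"
  \<comment> \<open>A monomial with too large an exponent contains a factor \<open>x i ^ e i\<close>
    of weight \<open>N\<close>, which is rewritten in weight below \<open>N\<close>. The total
    weight drops, so the rewriting ends at exponents below \<open>e i\<close>.\<close>
  have mon_T: "mon a \<in> fun_space.span T" for a
  proof (induction "wt a" arbitrary: a rule: less_induct)
    case less
    show ?case
    proof (cases "\<forall>i\<in>J. a i < e i")
      case True
      have "mon a = mon (restrict a J)" unfolding mon_def by (intro on_cong) auto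
      also have "\<dots> \<in> fun_space.span T"
        unfolding T_def using True by (intro fun_space.span_base) auto
      finally show ?thesis .
    next
      case False
      then obtain i where i: "i \<in> J" "e i \<le> a i" by (auto simp: not_less)
      have id: "i < d" using i Jd by auto
      define b where "b l = (if l = i then a i - e i else a l)" for l
      define u where "u l = (if l = i then e i else 0)" for l
      have ub: "(\<lambda>l. u l + b l) = a" using i by (auto simp: u_def b_def fun_eq_iff)
      have "wt u = N"
        unfolding wt_def u_def using i finJ We[OF id]
        by (simp add: if_distrib[of "\<lambda>n. n * _"] mult.commute[of "e i"] cong: if_cong)
      then have wa: "wt a = N + wt b" using wt_add[of u b] ub by simp
      have "mon u = on A (\<lambda>x. x i ^ e i)"
        unfolding mon_def u_def using i finJ
        by (intro on_cong) (simp add: if_distrib[of "\<lambda>n. _ ^ n"] prod.delta cong: if_cong)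
      then have "mon a = on A (\<lambda>x. x i ^ e i) * mon b"
        using mon_mult[of u b] ub by simp
      also have "\<dots> \<in> U (N - 1 + wt b)"
        by (rule U_mult[OF U_pivot_power[OF i(1)] U_mon]) simp
      also have "U (N - 1 + wt b) \<subseteq> fun_space.span T"
        unfolding U_def
        by (rule fun_space.span_minimal) (use less wa N in \<open>auto intro: fun_space.subspace_span\<close>)
      finally show ?thesis .
    qed
  qed
  have U_T: "U w \<subseteq> fun_space.span T" for w
    unfolding U_def
    by (rule fun_space.span_minimal) (use mon_T in \<open>auto intro: fun_space.subspace_span\<close>)
  have \<delta>_T: "on {z} (\<lambda>x. 1) \<in> fun_space.span T" if z: "z \<in> A" for z
  proof -
    have "\<exists>l. l < d \<and> y l \<noteq> z l" if "y \<in> A - {z}" for y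
      using ext[of y z] that z by blast
    then obtain l where l: "\<And>y. y \<in> A - {z} \<Longrightarrow> l y < d \<and> y (l y) \<noteq> z (l y)" by metis
    \<comment> \<open>Interpolation: for each other point \<open>y\<close>, an affine function of a
      coordinate separating \<open>y\<close> from \<open>z\<close>, with value 0 at \<open>y\<close>
      and 1 at \<open>z\<close>.\<close>
    define g where "g y x = (x (l y) + (- y (l y))) * inverse (z (l y) - y (l y))"
      for y x :: "nat \<Rightarrow> 'f"
    have "\<exists>w. on A (\<lambda>x. \<Prod>y\<in>B. g y x) \<in> U w" if "finite B" "B \<subseteq> A - {z}" for B
      using that
    proof (induction B)
      case empty
      then show ?case using U_one by auto
    next
      case (insert y B)
      then obtain w where w: "on A (\<lambda>x. \<Prod>y\<in>B. g y x) \<in> U w" by auto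
      have "l y < d" using l insert by blast
      then obtain v where v: "on A (\<lambda>x. x (l y)) \<in> U v" using U_coord by blast
      have "on A (\<lambda>x. x (l y) + (- y (l y))) \<in> U v"
        unfolding on_add by (rule fun_space.subspace_add[OF U_sub v U_const])
      then have "on A (g y) \<in> U (v + 0)"
        unfolding g_def on_mult by (rule U_mult[OF _ U_const])
      then have "on A (\<lambda>x. g y x * (\<Prod>y\<in>B. g y x)) \<in> U (v + 0 + w)"
        unfolding on_mult by (rule U_mult[OF _ w])
      then show ?case using insert by auto
    qed
    then have "on A (\<lambda>x. \<Prod>y\<in>A - {z}. g y x) \<in> fun_space.span T"
      using A U_T by blast
    moreover have "on A (\<lambda>x. \<Prod>y\<in>A - {z}. g y x) = on {z} (\<lambda>x. 1)"
    proof
      fix x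
      have "(\<Prod>y\<in>A - {z}. g y z) = 1"
        using l by (intro prod.neutral) (force simp: g_def)
      moreover have "(\<Prod>y\<in>A - {z}. g y x) = 0" if "x \<in> A" "x \<noteq> z"
        using that A by (intro prod_zero) (auto simp: g_def intro!: bexI[of _ x])
      ultimately show "on A (\<lambda>x. \<Prod>y\<in>A - {z}. g y x) x = on {z} (\<lambda>x. 1) x"
        using z by (auto simp: on_def)
    qed
    ultimately show ?thesis by simp
  qed
  have finT: "finite T" unfolding T_def using finJ by (intro finite_imageI finite_PiE) auto
  have "card A \<le> card T" by (rule card_le_of_deltas_in_span[OF A finT \<delta>_T])
  also have "\<dots> \<le> card (PiE J (\<lambda>i. {..<e i}))"
    unfolding T_def using finJ by (intro card_image_le finite_PiE) auto
  also have "\<dots> = (\<Prod>i\<in>J. e i)" using finJ by (simp add: card_PiE)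
  finally show ?thesis .
qed

text \<open>
  With opposite orders of the first \<open>d - 1\<close> coordinates, a pivot for the points is never a pivot for the
  hyperplanes. This replaces the duality between flats of dimension \<open>k\<close> and of codimension \<open>k\<close>.
\<close>

lemma pivots_disjoint:
  fixes A B :: "(nat \<Rightarrow> 'f::field) set"
  assumes ne: "A \<noteq> {}" "B \<noteq> {}" and d: "d \<ge> 1"
    and inc: "\<And>x y. x \<in> A \<Longrightarrow> y \<in> B \<Longrightarrow> x (d - 1) + y (d - 1) + \<tau> = (\<Sum>i<d - 1. x i * y i)"
    and eA: "\<And>i j. i < j \<Longrightarrow> j < d \<Longrightarrow> eA j < eA i"
    and eB: "\<And>i j. i < j \<Longrightarrow> j < d - 1 \<Longrightarrow> eB i < eB j" "\<And>i. i < d - 1 \<Longrightarrow> eB (d - 1) < eB i"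
  shows "coord_pivots d eA A \<union> coord_pivots d eB B \<subseteq> {..<d - 1}"
    and "coord_pivots d eA A \<inter> coord_pivots d eB B = {}"
proof -
  \<comment> \<open>Incidence with one fixed member of the other side writes the last coordinate as
    an affine function of the others. It comes last in both orders, so it is never a pivot.\<close>
  have last: "on C (\<lambda>x. x (d - 1)) \<in> fun_space.span (insert (on C (\<lambda>x. 1))
      ((\<lambda>i. on C (\<lambda>x. x i)) ` {i. i < d \<and> e (d - 1) < e i}))"
    if e: "\<And>i. i < d - 1 \<Longrightarrow> e (d - 1) < e i"
      and eq: "\<And>x. x \<in> C \<Longrightarrow> x (d - 1) = c + (\<Sum>i<d - 1. z i * x i)"
    for C :: "(nat \<Rightarrow> 'f) set" and c and z :: "nat \<Rightarrow> 'f" and e :: "nat \<Rightarrow> nat"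
  proof -
    have "on C (\<lambda>x. x (d - 1)) = on C (\<lambda>x. c + (\<Sum>i<d - 1. z i * x i))"
      using eq by (intro on_cong)
    also have "\<dots> = fscale c (on C (\<lambda>x. 1)) + (\<Sum>i<d - 1. fscale (z i) (on C (\<lambda>x. x i)))"
      by (simp only: on_add on_sum on_scale on_const[of C c])
    also have "\<dots> \<in> fun_space.span (insert (on C (\<lambda>x. 1))
        ((\<lambda>i. on C (\<lambda>x. x i)) ` {i. i < d \<and> e (d - 1) < e i}))"
      using e
      by (intro fun_space.span_add fun_space.span_scale fun_space.span_sum fun_space.span_base) auto
    finally show ?thesis .
  qed
  obtain x0 y0 where x0: "x0 \<in> A" and y0: "y0 \<in> B" using ne by blast
  have "d - 1 \<notin> coord_pivots d eA A"
    using last[of eA A "- y0 (d - 1) - \<tau>" y0] eA inc[OF _ y0] d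
    by (auto simp: coord_pivots_def algebra_simps)
  moreover have "d - 1 \<notin> coord_pivots d eB B"
    using last[of eB B "- x0 (d - 1) - \<tau>" x0] eB inc[OF x0] d
    by (auto simp: coord_pivots_def algebra_simps)
  moreover have "j < d - 1" if "j < d" "j \<noteq> d - 1" for j using that by simp
  ultimately show sub: "coord_pivots d eA A \<union> coord_pivots d eB B \<subseteq> {..<d - 1}"
    by (auto simp: coord_pivots_def)
  have "j \<notin> coord_pivots d eB B" if j: "j \<in> coord_pivots d eA A" for j
  proof -
    have jd: "j < d - 1" using sub j by auto
    have "on A (\<lambda>x. x j) \<notin> fun_space.span (insert (on A (\<lambda>x. 1))
        ((\<lambda>i. on A (\<lambda>x. x i)) ` {i. i < d \<and> eA j < eA i}))"
      using j by (simp add: coord_pivots_def)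
    then obtain \<phi> where \<phi>: "Vector_Spaces.linear fscale (*) \<phi>" "\<phi> (on A (\<lambda>x. x j)) = 1"
      and \<phi>0: "\<And>h. h \<in> fun_space.span (insert (on A (\<lambda>x. 1))
        ((\<lambda>i. on A (\<lambda>x. x i)) ` {i. i < d \<and> eA j < eA i})) \<Longrightarrow> \<phi> h = 0"
      by (rule functional_separating) blast
    note lin = fun_form.linear_add[OF \<phi>(1)] fun_form.linear_scale[OF \<phi>(1)]
      fun_form.linear_sum[OF \<phi>(1)]
    have \<phi>1: "\<phi> (on A (\<lambda>x. 1)) = 0" by (rule \<phi>0) (auto intro: fun_space.span_base)
    \<comment> \<open>\<open>\<mu>\<close> acts as a direction vector of the affine hull of
      \<open>A\<close> whose first nonzero coordinate is the \<open>j\<close>-th. Applying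
      \<open>\<phi>\<close> to the incidence equation kills its constant terms and allows solving
      for \<open>y j\<close> in terms of later coordinates, which precede \<open>j\<close> in the
      order used for \<open>B\<close>.\<close>
    define \<mu> where "\<mu> i = \<phi> (on A (\<lambda>x. x i))" for i
    have \<mu>0: "\<mu> i = 0" if "i < j" for i
      unfolding \<mu>_def using that jd eA[of i j] by (intro \<phi>0 fun_space.span_base) auto
    have \<mu>j: "\<mu> j = 1" using \<phi>(2) by (simp add: \<mu>_def)
    have eq: "y j = \<mu> (d - 1) + (\<Sum>i\<in>{j<..<d - 1}. - \<mu> i * y i)" if y: "y \<in> B" for y
    proof -
      have "on A (\<lambda>x. x (d - 1) + (y (d - 1) + \<tau>)) = on A (\<lambda>x. \<Sum>i<d - 1. y i * x i)"
        using inc[OF _ y] by (intro on_cong) (simp add: algebra_simps)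
      then have "on A (\<lambda>x. x (d - 1)) + fscale (y (d - 1) + \<tau>) (on A (\<lambda>x. 1))
          = (\<Sum>i<d - 1. fscale (y i) (on A (\<lambda>x. x i)))"
        by (simp only: on_add[of A "\<lambda>x. x (d - 1)" "\<lambda>x. y (d - 1) + \<tau>"]
            on_sum on_scale on_const[of A "y (d - 1) + \<tau>"])
      from arg_cong[OF this, of \<phi>] have "\<mu> (d - 1) = (\<Sum>i<d - 1. y i * \<mu> i)"
        by (simp add: lin \<phi>1 \<mu>_def)
      also have "\<dots> = (\<Sum>i\<in>insert j {j<..<d - 1}. y i * \<mu> i)"
        using jd \<mu>0 by (intro sum.mono_neutral_right) auto
      also have "\<dots> = y j + (\<Sum>i\<in>{j<..<d - 1}. \<mu> i * y i)"
        by (simp add: \<mu>j mult.commute)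
      finally show ?thesis by (simp add: sum_negf)
    qed
    have "on B (\<lambda>y. y j) = on B (\<lambda>y. \<mu> (d - 1) + (\<Sum>i\<in>{j<..<d - 1}. - \<mu> i * y i))"
      using eq by (intro on_cong)
    also have "\<dots> = fscale (\<mu> (d - 1)) (on B (\<lambda>x. 1))
        + (\<Sum>i\<in>{j<..<d - 1}. fscale (- \<mu> i) (on B (\<lambda>x. x i)))"
      by (simp only: on_add on_sum on_scale on_const[of B "\<mu> (d - 1)"])
    also have "\<dots> \<in> fun_space.span (insert (on B (\<lambda>x. 1))
        ((\<lambda>i. on B (\<lambda>x. x i)) ` {i. i < d \<and> eB j < eB i}))"
      using eB(1)
      by (intro fun_space.span_add fun_space.span_scale fun_space.span_sum fun_space.span_base) auto
    finally show ?thesis by (simp add: coord_pivots_def)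
  qed
  then show "coord_pivots d eA A \<inter> coord_pivots d eB B = {}" by blast
qed

section \<open>Finite subfields and evasive sets\<close>

definition subfield_set :: "'f::field set \<Rightarrow> bool" where
  "subfield_set K \<longleftrightarrow> 0 \<in> K \<and> 1 \<in> K \<and> (\<forall>x\<in>K. \<forall>y\<in>K. x + y \<in> K \<and> x * y \<in> K) \<and>
     (\<forall>x\<in>K. - x \<in> K \<and> inverse x \<in> K)"

lemma subfield_set_sum:
  assumes "subfield_set K" "\<And>i. i \<in> I \<Longrightarrow> g i \<in> K"
  shows "sum g I \<in> K"
  using assms(2)
proof (induction I rule: infinite_finite_induct)
  case (insert i I)
  then show ?case using assms(1) by (simp add: subfield_set_def)
qed (use assms(1) in \<open>auto simp: subfield_set_def\<close>)

lemma subfield_set_power: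
  assumes "subfield_set K" "x \<in> K"
  shows "x ^ n \<in> K"
  using assms by (induction n) (auto simp: subfield_set_def)

text \<open>Pigeonhole in averaged form. It chooses the right-hand sides of the diagonal equations
  and later the translation of the hyperplanes.\<close>

lemma exists_large_fiber:
  assumes "finite S" "finite T" "f ` S \<subseteq> T" "T \<noteq> {}"
  obtains c where "c \<in> T" "card S \<le> card {x \<in> S. f x = c} * card T"
proof -
  let ?F = "\<lambda>c. card {x \<in> S. f x = c}"
  have ne: "?F ` T \<noteq> {}" "finite (?F ` T)" using assms by auto
  obtain c where c: "c \<in> T" "?F c = Max (?F ` T)" using Max_in[OF ne(2,1)] by auto
  have "card S = (\<Sum>c\<in>T. ?F c)"
    using sum.group[OF assms(1-3), of "\<lambda>_. 1::nat"] by simp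
  also have "\<dots> \<le> (\<Sum>c'\<in>T. ?F c)" unfolding c(2) using ne(2) by (intro sum_mono Max_ge) auto
  finally show thesis using that c(1) by (simp add: mult.commute)
qed

text \<open>
  This is the construction of subspace-evasive sets by Dvir and Lovett, with a Vandermonde matrix
  as Polynomial.coefficient matrix and with the right-hand sides chosen by the pigeonhole principle.
\<close>

lemma exists_evasive_set:
  fixes K :: "'f::field set" and e :: "nat \<Rightarrow> nat"
  assumes K: "subfield_set K" "finite K" and d: "d \<le> card K" and k: "k \<le> d"
    and e: "\<And>i. i < d \<Longrightarrow> 1 \<le> e i \<and> e i \<le> D"
  obtains E where "E \<subseteq> {..<d} \<rightarrow>\<^sub>E K" "card K ^ (d - k) \<le> card E"
    "\<And>A. A \<subseteq> E \<Longrightarrow> card (coord_pivots d e A) \<le> k \<Longrightarrow> card A \<le> D ^ d"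
proof -
  define q where "q = card K"
  have q0: "q > 0" unfolding q_def using K by (auto simp: subfield_set_def card_gt_0_iff)
  \<comment> \<open>The distinct nodes of the Vandermonde matrix; for them the field must have at
    least \<open>d\<close> elements.\<close>
  obtain \<Gamma> where \<Gamma>: "\<Gamma> \<subseteq> K" "card \<Gamma> = d" "finite \<Gamma>" using obtain_subset_with_card_n[OF d] by metis
  obtain \<gamma> where "bij_betw \<gamma> {..<d} \<Gamma>"
    using \<Gamma> by (metis atLeast0LessThan ex_bij_betw_nat_finite)
  then have \<gamma>: "inj_on \<gamma> {..<d}" "\<And>l. l < d \<Longrightarrow> \<gamma> l \<in> K"
    using \<Gamma>(1) by (auto simp: bij_betw_def)
  define V where "V = ({..<d} \<rightarrow>\<^sub>E K)"
  define \<Phi> where "\<Phi> x = restrict (\<lambda>r. \<Sum>l<d. \<gamma> l ^ r * x l ^ e l) {..<k}" for x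
  have finV: "finite V" unfolding V_def using K(2) by (simp add: finite_PiE)
  have cV: "card V = q ^ d" unfolding V_def q_def by (simp add: card_PiE)
  have "\<Phi> x \<in> {..<k} \<rightarrow>\<^sub>E K" if x: "x \<in> V" for x
  proof -
    have "\<gamma> l ^ r * x l ^ e l \<in> K" if "l < d" for l r
      using K(1) subfield_set_power[OF K(1)] \<gamma>(2)[OF that] x that
      by (auto simp: subfield_set_def V_def PiE_def Pi_def)
    then show ?thesis unfolding \<Phi>_def by (auto intro!: subfield_set_sum[OF K(1)])
  qed
  then have \<Phi>: "\<Phi> ` V \<subseteq> ({..<k} \<rightarrow>\<^sub>E K)" by blast
  have "finite ({..<k} \<rightarrow>\<^sub>E K)" using K(2) by (simp add: finite_PiE)
  moreover have "({..<k} \<rightarrow>\<^sub>E K) \<noteq> {}" using K(1) by (auto simp: PiE_eq_empty_iff subfield_set_def)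
  ultimately obtain c where "c \<in> ({..<k} \<rightarrow>\<^sub>E K)"
    and c: "card V \<le> card {x \<in> V. \<Phi> x = c} * card ({..<k} \<rightarrow>\<^sub>E K)"
    by (rule exists_large_fiber[OF finV _ \<Phi>])
  define E where "E = {x \<in> V. \<Phi> x = c}"
  have "q ^ (d - k) * q ^ k \<le> card E * q ^ k"
  proof -
    have "card ({..<k} \<rightarrow>\<^sub>E K) = q ^ k" unfolding q_def by (simp add: card_PiE)
    then have "q ^ d \<le> card E * q ^ k" using c unfolding cV E_def[symmetric] by (simp only:)
    moreover have "q ^ d = q ^ (d - k) * q ^ k" using k by (simp flip: power_add)
    ultimately show ?thesis by (simp only:)
  qed
  then have "q ^ (d - k) \<le> card E" using q0 by simp
  moreover have "E \<subseteq> {..<d} \<rightarrow>\<^sub>E K" unfolding E_def V_def by blast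
  moreover have "card A \<le> D ^ d" if A: "A \<subseteq> E" and kA: "card (coord_pivots d e A) \<le> k" for A
  proof -
    define J where "J = coord_pivots d e A"
    have Jd: "J \<subseteq> {..<d}" unfolding J_def coord_pivots_def by auto
    have finJ: "finite J" using Jd by (rule finite_subset) simp
    have AV: "A \<subseteq> V" using A unfolding E_def by blast
    have E_eq: "(\<Sum>l<d. \<gamma> l ^ r * x l ^ e l) = c r" if "x \<in> A" "r < k" for x r
    proof -
      have "\<Phi> x = c" using that A unfolding E_def by blast
      then show ?thesis using that(2) unfolding \<Phi>_def by auto
    qed
    have "card A \<le> (\<Prod>i\<in>J. e i)"
    proof (rule card_le_prod_pivot_degrees[OF _ _ _ J_def])
      show "finite A" using AV finV by (rule finite_subset)
      show "1 \<le> e i" if "i < d" for i using e[OF that] by simp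
      show "x = y" if "x \<in> A" "y \<in> A" "\<And>i. i < d \<Longrightarrow> x i = y i" for x y
        using that AV unfolding V_def by (intro PiE_ext[of x "{..<d}" "\<lambda>_. K" y]) auto
      fix i assume i: "i \<in> J"
      \<comment> \<open>The coefficients of \<open>p\<close> combine the \<open>k\<close> equations
        so that every pivot except \<open>i\<close> gets coefficient 0; this is possible because the
        degree of \<open>p\<close> is below \<open>k\<close>. Dividing by the value at
        \<open>\<gamma> i\<close> then solves for \<open>x i ^ e i\<close> in terms of the
        non-pivots.\<close>
      define p where "p = (\<Prod>l\<in>J - {i}. [:- \<gamma> l, 1:])"
      have "Polynomial.degree p = card (J - {i})"
        unfolding p_def by (subst degree_prod_eq_sum_degree) auto
      also have "\<dots> < card J" using i finJ by (intro card_Diff1_less)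
      finally have deg: "Polynomial.degree p < k" using kA unfolding J_def by simp
      have p0: "poly p (\<gamma> l) = 0" if "l \<in> J - {i}" for l
        unfolding p_def poly_prod using that finJ by (intro prod_zero) auto
      have "poly p (\<gamma> i) \<noteq> 0"
        unfolding p_def poly_prod using i finJ Jd inj_on_eq_iff[OF \<gamma>(1)]
        by (auto simp: prod_zero_iff)
      define a where "a = inverse (poly p (\<gamma> i))"
      have a: "a * poly p (\<gamma> i) = 1" using \<open>poly p (\<gamma> i) \<noteq> 0\<close> by (simp add: a_def)
      show "\<exists>c w. \<forall>x\<in>A. x i ^ e i = c + (\<Sum>j\<in>{..<d} - J. w j * x j ^ e j)"
      proof (intro exI ballI)
        fix x assume x: "x \<in> A"
        have "(\<Sum>l<d. poly p (\<gamma> l) * x l ^ e l)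
            = (\<Sum>l<d. \<Sum>r\<le>Polynomial.degree p. Polynomial.coeff p r * (\<gamma> l ^ r * x l ^ e l))"
          by (simp only: poly_altdef sum_distrib_right mult.assoc)
        also have "\<dots> = (\<Sum>r\<le>Polynomial.degree p. Polynomial.coeff p r * (\<Sum>l<d. \<gamma> l ^ r * x l ^ e l))"
          by (subst sum.swap) (simp only: sum_distrib_left)
        also have "\<dots> = (\<Sum>r\<le>Polynomial.degree p. Polynomial.coeff p r * c r)"
          using E_eq[OF x] deg by (intro sum.cong) auto
        finally have "(\<Sum>r\<le>Polynomial.degree p. Polynomial.coeff p r * c r)
            = (\<Sum>l\<in>insert i ({..<d} - J). poly p (\<gamma> l) * x l ^ e l)"
          using p0 i Jd by (subst sum.mono_neutral_left[of "{..<d}"]) auto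
        also have "\<dots> = poly p (\<gamma> i) * x i ^ e i + (\<Sum>l\<in>{..<d} - J. poly p (\<gamma> l) * x l ^ e l)"
          using i by simp
        finally have "a * (\<Sum>r\<le>Polynomial.degree p. Polynomial.coeff p r * c r)
            = a * poly p (\<gamma> i) * x i ^ e i + a * (\<Sum>l\<in>{..<d} - J. poly p (\<gamma> l) * x l ^ e l)"
          by (simp only: distrib_left mult.assoc)
        moreover have "(\<Sum>j\<in>{..<d} - J. (- a * poly p (\<gamma> j)) * x j ^ e j)
            = - (a * (\<Sum>l\<in>{..<d} - J. poly p (\<gamma> l) * x l ^ e l))"
          by (simp only: sum_distrib_left sum_negf[symmetric] mult_minus_left mult.assoc)
        moreover have "y = t + - u" if "t = b * y + u" "b = 1" for t y u b :: 'f
          using that by simp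
        ultimately show "x i ^ e i = a * (\<Sum>r\<le>Polynomial.degree p. Polynomial.coeff p r * c r)
            + (\<Sum>j\<in>{..<d} - J. (- a * poly p (\<gamma> j)) * x j ^ e j)"
          using a by (simp only:)
      qed
    qed
    also have "\<dots> \<le> (\<Prod>i\<in>J. D)" using e Jd by (intro prod_mono) auto
    also have "\<dots> \<le> D ^ d"
    proof (cases "J = {}")
      case True
      then show ?thesis using e[of 0] by (cases d) auto
    next
      case False
      then have "D \<ge> 1" using e Jd by force
      moreover have "card J \<le> d" using card_mono[OF _ Jd] by simp
      ultimately show ?thesis by (simp add: power_increasing)
    qed
    finally show ?thesis .
  qed
  ultimately show thesis using that unfolding q_def by blast
qed

section \<open>Configurations over finite fields\<close>

text \<open>The fixed points of a power of the Frobenius map form a subfield. They are the roots of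
  X^q - X, which are distinct because \<open>q\<close> vanishes in characteristic 2 and the
  derivative is -1. One type thus holds fields of all sizes 2^k.\<close>

lemma exists_subfield_set_card:
  assumes k: "k \<ge> 1"
  shows "\<exists>K :: bit alg_closure set. subfield_set K \<and> finite K \<and> card K = 2 ^ k"
proof -
  define q :: nat where "q = 2 ^ k"
  have q2: "q \<ge> 2" unfolding q_def using power_increasing[OF k, of "2::nat"] by simp
  have "CHAR(bit) = 2"
  proof (rule CHAR_eqI)
    show "2 dvd n" if "of_nat n = (0 :: bit)" for n
      using even_of_nat_iff[where 'a = bit, of n] that by simp
  qed simp
  then have char: "CHAR(bit alg_closure) = 2" by simp
  have two: "(2 :: bit alg_closure) = 0"
    using of_nat_CHAR[where 'a = "bit alg_closure"] unfolding char by simp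
  then have qz: "of_nat q = (0 :: bit alg_closure)" unfolding q_def using k by simp
  define K :: "bit alg_closure set" where "K = {x. x ^ q = x}"
  define p :: "bit alg_closure poly" where "p = Polynomial.monom 1 q + Polynomial.monom (- 1) 1"
  have root: "poly p x = 0 \<longleftrightarrow> x \<in> K" for x
    by (simp add: p_def K_def poly_monom)
  have p': "pderiv p = - 1"
    using qz by (simp add: p_def pderiv_add pderiv_monom monom_0 one_pCons)
  have deg: "Polynomial.degree p = q"
    unfolding p_def using q2 by (subst degree_add_eq_left) (auto simp: degree_monom_eq)
  then have p0: "p \<noteq> 0" using q2 by auto
  obtain A where A: "size A = Polynomial.degree p"
    "p = Polynomial.smult (Polynomial.lead_coeff p) (\<Prod>x\<in>#A. [:- x, 1:])"
    using alg_closed_imp_factorization[OF p0] by blast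
  have "count A x \<le> 1" for x
  proof (rule ccontr)
    assume "\<not> count A x \<le> 1"
    then have "{#x, x#} \<subseteq># A" by (simp add: subseteq_mset_def)
    then obtain B where "A = {#x, x#} + B" by (metis subset_mset.le_iff_add)
    then have "[:- x, 1:] * [:- x, 1:] dvd p"
      by (subst A(2))
         (auto intro!: dvd_smult simp: mult.assoc simp del: mult_pCons_left mult_pCons_right)
    then obtain r where r: "p = [:- x, 1:] * [:- x, 1:] * r" by (elim dvdE)
    have "poly (pderiv p) x = 0" unfolding r pderiv_mult by simp
    then show False unfolding p' by simp
  qed
  then have "count A x = 1" if "x \<in># A" for x
    using that count_greater_zero_iff[of A x] by (simp add: le_antisym Suc_leI)
  then have "size A = (\<Sum>x\<in>set_mset A. 1)"
    unfolding size_multiset_overloaded_eq by (intro sum.cong) auto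
  then have "card (set_mset A) = size A" by simp
  moreover have "set_mset A = K"
  proof -
    have "poly p x = 0 \<longleftrightarrow> x \<in># A" for x
    proof -
      have "poly p x = Polynomial.lead_coeff p * (\<Prod>y\<in>#A. x - y)"
        by (subst A(2)) (simp add: poly_prod_mset)
      then show ?thesis using p0 by (auto simp: prod_mset_zero_iff)
    qed
    then show ?thesis using root by blast
  qed
  ultimately have cK: "card K = q" "finite K" using A(1) deg by auto
  have frob: "(x + y) ^ q = x ^ q + y ^ q" for x y :: "bit alg_closure"
    using freshmans_dream'[where 'a = "bit alg_closure", of q k x y] unfolding char q_def by simp
  \<comment> \<open>In characteristic 2 negation is the identity, which gives closure under
    negation.\<close>
  have "- x = x" for x :: "bit alg_closure"
  proof -
    have "x + x = 0" using two by (metis mult_2 mult_zero_left)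
    then show ?thesis by (simp add: eq_neg_iff_add_eq_0)
  qed
  then have "(- x) ^ q = - x" if "x ^ q = x" for x :: "bit alg_closure"
    using that by (simp only:)
  then have "subfield_set K"
    unfolding subfield_set_def K_def using q2 frob
    by (simp add: power_mult_distrib power_inverse)
  then show ?thesis using cK unfolding q_def by blast
qed

section \<open>Finite fields as ring structures and hyperplanes as graphs\<close>

definition subfield_ring :: "'f::field set \<Rightarrow> 'f ring" where
  "subfield_ring K = \<lparr>carrier = K, monoid.mult = (*), one = 1, ring.zero = 0, add = (+)\<rparr>"

lemma field_subfield_ring:
  assumes K: "subfield_set K"
  shows "field (subfield_ring K)"
proof -
  have K': "0 \<in> K" "1 \<in> K" "\<And>x y. x \<in> K \<Longrightarrow> y \<in> K \<Longrightarrow> x + y \<in> K"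
    "\<And>x y. x \<in> K \<Longrightarrow> y \<in> K \<Longrightarrow> x * y \<in> K" "\<And>x. x \<in> K \<Longrightarrow> - x \<in> K" "\<And>x. x \<in> K \<Longrightarrow> inverse x \<in> K"
    using K unfolding subfield_set_def by blast+
  let ?R = "subfield_ring K"
  have R: "carrier ?R = K" "\<one>\<^bsub>?R\<^esub> = 1" "\<zero>\<^bsub>?R\<^esub> = 0"
    "\<And>x y. x \<otimes>\<^bsub>?R\<^esub> y = x * y" "\<And>x y. x \<oplus>\<^bsub>?R\<^esub> y = x + y"
    by (simp_all add: subfield_ring_def)
  interpret cring ?R
  proof (rule cringI)
    show "abelian_group ?R"
    proof (rule abelian_groupI)
      show "\<exists>y\<in>carrier ?R. y \<oplus>\<^bsub>?R\<^esub> x = \<zero>\<^bsub>?R\<^esub>" if "x \<in> carrier ?R" for x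
        using that K'(5) unfolding R by (intro bexI[of _ "- x"]) auto
    qed (simp_all add: R K' add.assoc add.commute)
    show "comm_monoid ?R"
    proof (rule comm_monoidI)
      fix x y z assume "x \<in> carrier ?R" "y \<in> carrier ?R" "z \<in> carrier ?R"
      show "x \<otimes>\<^bsub>?R\<^esub> y \<otimes>\<^bsub>?R\<^esub> z = x \<otimes>\<^bsub>?R\<^esub> (y \<otimes>\<^bsub>?R\<^esub> z)"
        unfolding R by (rule mult.assoc)
    next
      fix x y assume xy: "x \<in> carrier ?R" "y \<in> carrier ?R"
      show "x \<otimes>\<^bsub>?R\<^esub> y = y \<otimes>\<^bsub>?R\<^esub> x" unfolding R by (rule mult.commute)
      show "x \<otimes>\<^bsub>?R\<^esub> y \<in> carrier ?R" using xy unfolding R by (rule K'(4))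
    next
      show "\<one>\<^bsub>?R\<^esub> \<in> carrier ?R" unfolding R by (rule K'(2))
      show "\<one>\<^bsub>?R\<^esub> \<otimes>\<^bsub>?R\<^esub> x = x" for x unfolding R by (rule mult_1_left)
    qed
  qed (simp add: R distrib_right)
  show ?thesis
  proof (rule cring_fieldI)
    have "x \<in> Units ?R \<longleftrightarrow> x \<in> K - {0}" for x
    proof
      assume "x \<in> Units ?R"
      then show "x \<in> K - {0}" unfolding Units_def R by auto
    next
      assume "x \<in> K - {0}"
      then have "x \<in> K" "inverse x \<in> K" "inverse x * x = 1" "x * inverse x = 1" using K'(6) by auto
      then show "x \<in> Units ?R" unfolding Units_def R by blast
    qed
    then show "Units ?R = carrier ?R - {\<zero>\<^bsub>?R\<^esub>}" unfolding R by blast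
  qed
qed

lemma finsum_subfield_ring:
  assumes K: "subfield_set K" and I: "finite I" "\<And>i. i \<in> I \<Longrightarrow> g i \<in> K"
  shows "(\<Oplus>\<^bsub>subfield_ring K\<^esub>i\<in>I. g i) = sum g I"
proof -
  interpret field "subfield_ring K" by (rule field_subfield_ring[OF K])
  show ?thesis
    using I
  proof (induction I)
    case empty
    show ?case unfolding finsum_empty by (simp add: subfield_ring_def)
  next
    case (insert i I)
    then have "(\<Oplus>\<^bsub>subfield_ring K\<^esub>i\<in>insert i I. g i)
        = g i \<oplus>\<^bsub>subfield_ring K\<^esub> (\<Oplus>\<^bsub>subfield_ring K\<^esub>i\<in>I. g i)"
      by (intro finsum_insert) (auto simp: subfield_ring_def)
    then show ?case using insert by (simp add: subfield_ring_def)
  qed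
qed

text \<open>
  The hyperplane with parameter \<open>y\<close> is the graph of an affine function of the first \<open>d - 1\<close> coordinates, so
  that incidence is symmetric in \<open>x\<close> and \<open>y\<close>. For all \<open>x\<close> and \<open>y\<close> there is exactly one shift \<open>\<tau>\<close> that makes
  them incident.
\<close>

definition graph_incident :: "nat \<Rightarrow> 'f::field \<Rightarrow> (nat \<Rightarrow> 'f) \<Rightarrow> (nat \<Rightarrow> 'f) \<Rightarrow> bool" where
  "graph_incident d \<tau> x y \<longleftrightarrow> x (d - 1) + y (d - 1) + \<tau> = (\<Sum>i<d - 1. x i * y i)"

definition graph_hyperplane :: "'f::field set \<Rightarrow> nat \<Rightarrow> 'f \<Rightarrow> (nat \<Rightarrow> 'f) \<Rightarrow> (nat \<Rightarrow> 'f) set" where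
  "graph_hyperplane K d \<tau> y = {x \<in> {..<d} \<rightarrow>\<^sub>E K. graph_incident d \<tau> x y}"

lemma affine_hyperplane_graph_hyperplane:
  fixes K :: "'f::field set"
  assumes K: "subfield_set K" and d: "d \<ge> 1" and \<tau>: "\<tau> \<in> K" and y: "y \<in> {..<d} \<rightarrow>\<^sub>E K"
  shows "affine_hyperplane (subfield_ring K) d (graph_hyperplane K d \<tau> y)"
proof -
  have space: "affine_space (subfield_ring K) d = ({..<d} \<rightarrow>\<^sub>E K)"
    by (simp add: affine_space_def subfield_ring_def)
  \<comment> \<open>The graph has the coefficients of \<open>y\<close> in the first d - 1 variables
    and -1 in the last, so the coefficient vector is nonzero for every \<open>y\<close>.\<close>
  define a where "a = y(d - 1 := - 1)"
  have a: "a \<in> {..<d} \<rightarrow>\<^sub>E K"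
    unfolding a_def using y K d by (auto simp: PiE_def Pi_def extensional_def subfield_set_def)
  have "(\<Oplus>\<^bsub>subfield_ring K\<^esub>i\<in>{..<d}. a i \<otimes>\<^bsub>subfield_ring K\<^esub> x i) = y (d - 1) + \<tau>
      \<longleftrightarrow> graph_incident d \<tau> x y" if x: "x \<in> {..<d} \<rightarrow>\<^sub>E K" for x
  proof -
    have "(\<Oplus>\<^bsub>subfield_ring K\<^esub>i\<in>{..<d}. a i \<otimes>\<^bsub>subfield_ring K\<^esub> x i)
        = (\<Oplus>\<^bsub>subfield_ring K\<^esub>i\<in>{..<d}. a i * x i)"
      by (simp add: subfield_ring_def)
    also have "\<dots> = (\<Sum>i<d. a i * x i)"
      using a x K by (intro finsum_subfield_ring[OF K]) (auto simp: subfield_set_def PiE_def Pi_def)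
    also have "\<dots> = (\<Sum>i\<in>insert (d - 1) {..<d - 1}. a i * x i)" using d by (intro sum.cong) auto
    also have "\<dots> = - x (d - 1) + (\<Sum>i<d - 1. a i * x i)"
      by (simp add: a_def)
    also have "(\<Sum>i<d - 1. a i * x i) = (\<Sum>i<d - 1. x i * y i)"
      by (rule sum.cong) (auto simp: a_def)
    finally have "(\<Oplus>\<^bsub>subfield_ring K\<^esub>i\<in>{..<d}. a i \<otimes>\<^bsub>subfield_ring K\<^esub> x i)
        = - x (d - 1) + (\<Sum>i<d - 1. x i * y i)" .
    moreover have "- u + v = w \<longleftrightarrow> u + w = v" for u v w :: 'f
      by (metis add_minus_cancel minus_add_cancel)
    ultimately show ?thesis unfolding graph_incident_def by (simp only: add.assoc)
  qed
  then have "graph_hyperplane K d \<tau> y = {x \<in> affine_space (subfield_ring K) d.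
      (\<Oplus>\<^bsub>subfield_ring K\<^esub>i\<in>{..<d}. a i \<otimes>\<^bsub>subfield_ring K\<^esub> x i) = y (d - 1) + \<tau>}"
    unfolding graph_hyperplane_def space by blast
  moreover have "\<exists>i<d. a i \<noteq> \<zero>\<^bsub>subfield_ring K\<^esub>"
    using d by (intro exI[of _ "d - 1"]) (simp add: a_def subfield_ring_def)
  moreover have "y (d - 1) + \<tau> \<in> carrier (subfield_ring K)"
    using y K d \<tau> by (auto simp: subfield_ring_def subfield_set_def PiE_def Pi_def)
  ultimately show ?thesis
    unfolding affine_hyperplane_def using a space by blast
qed

text \<open>With the last coordinate as height, the point of the hyperplane above the origin
  determines the last coordinate of the parameter, and the points above the unit vectors determine
  the others.\<close>

lemma inj_on_graph_hyperplane:
  assumes K: "subfield_set K" and d: "d \<ge> 1" and \<tau>: "\<tau> \<in> K"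
  shows "inj_on (graph_hyperplane K d \<tau>) ({..<d} \<rightarrow>\<^sub>E K)"
proof (rule inj_onI)
  fix y z assume y: "y \<in> {..<d} \<rightarrow>\<^sub>E K" and z: "z \<in> {..<d} \<rightarrow>\<^sub>E K"
    and eq: "graph_hyperplane K d \<tau> y = graph_hyperplane K d \<tau> z"
  have inc: "graph_incident d \<tau> x y \<longleftrightarrow> graph_incident d \<tau> x z" if "x \<in> {..<d} \<rightarrow>\<^sub>E K" for x
    using eq that unfolding graph_hyperplane_def by blast
  have yK: "y i \<in> K" if "i < d" for i using y that by auto
  define u where "u = - (y (d - 1) + \<tau>)"
  have "y (d - 1) + \<tau> \<in> K" using K \<tau> yK[of "d - 1"] d by (simp add: subfield_set_def)
  then have u: "u \<in> K" unfolding u_def using K by (simp only: subfield_set_def)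
  define x0 where "x0 = restrict (\<lambda>i. if i = d - 1 then u else 0) {..<d}"
  have "x0 \<in> {..<d} \<rightarrow>\<^sub>E K"
    using K u by (auto simp: x0_def subfield_set_def)
  moreover have pair0: "(\<Sum>l<d - 1. x0 l * w l) = 0" for w
    by (rule sum.neutral) (auto simp: x0_def)
  moreover have "graph_incident d \<tau> x0 y"
    unfolding graph_incident_def pair0 using d by (simp add: x0_def u_def)
  ultimately have "graph_incident d \<tau> x0 z" using inc by blast
  then have last: "z (d - 1) = y (d - 1)"
    unfolding graph_incident_def pair0 using d by (simp add: x0_def u_def algebra_simps)
  have "z i = y i" if i: "i < d - 1" for i
  proof -
    define x where "x = restrict (\<lambda>l. if l = d - 1 then y i + u else if l = i then 1 else 0) {..<d}"
    have "x \<in> {..<d} \<rightarrow>\<^sub>E K"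
      using K u yK[of i] i unfolding x_def subfield_set_def by auto
    moreover have pair: "(\<Sum>l<d - 1. x l * w l) = w i" for w
    proof -
      have "(\<Sum>l<d - 1. x l * w l) = (\<Sum>l<d - 1. if l = i then w l else 0)"
        by (rule sum.cong) (auto simp: x_def)
      then show ?thesis using i by simp
    qed
    have "graph_incident d \<tau> x y"
      unfolding graph_incident_def pair using d by (simp add: x_def u_def)
    ultimately have "graph_incident d \<tau> x z" using inc by blast
    then show ?thesis unfolding graph_incident_def pair using d last by (simp add: x_def u_def)
  qed
  then have "y i = z i" if "i < d" for i using last that by (cases "i = d - 1") auto
  then show "y = z" using y z by (intro PiE_ext[of y "{..<d}" "\<lambda>_. K" z]) auto
qed

section \<open>Realizable numbers of points, hyperplanes and incidences\<close>

definition realizable :: "nat \<Rightarrow> nat \<Rightarrow> nat \<Rightarrow> nat \<Rightarrow> nat \<Rightarrow> bool" where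
  "realizable d s m n I \<longleftrightarrow> (\<exists>(F :: int ring) P H. field F \<and>
     P \<subseteq> affine_space F d \<and> finite P \<and> card P = m \<and>
     (\<forall>h\<in>H. affine_hyperplane F d h) \<and> finite H \<and> card H = n \<and>
     biclique_free s P H \<and> incidences P H = I)"

lemma realizable_graph_incidences:
  fixes K :: "'f::field set"
  assumes K: "subfield_set K" "finite K" and d: "d \<ge> 1" and s: "s \<ge> 1" and \<tau>: "\<tau> \<in> K"
    and P: "P \<subseteq> {..<d} \<rightarrow>\<^sub>E K" and Y: "Y \<subseteq> {..<d} \<rightarrow>\<^sub>E K"
    and free: "no_biclique s (graph_incident d \<tau>) P Y"
  shows "realizable d s (card P) (card Y) (card {(x, y). x \<in> P \<and> y \<in> Y \<and> graph_incident d \<tau> x y})"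
proof -
  define H where "H = graph_hyperplane K d \<tau> ` Y"
  have "finite ({..<d} \<rightarrow>\<^sub>E K)" using K(2) by (simp add: finite_PiE)
  then have fin: "finite P" "finite Y" using P Y finite_subset by blast+
  have inj: "inj_on (graph_hyperplane K d \<tau>) Y"
    using inj_on_graph_hyperplane[OF K(1) d \<tau>] Y by (rule inj_on_subset)
  have mem: "x \<in> graph_hyperplane K d \<tau> y \<longleftrightarrow> graph_incident d \<tau> x y" if "x \<in> P" for x y
    using that P unfolding graph_hyperplane_def by blast
  have space: "P \<subseteq> affine_space (subfield_ring K) d"
    using P by (simp add: affine_space_def subfield_ring_def)
  have hyp: "\<forall>h\<in>H. affine_hyperplane (subfield_ring K) d h"
    unfolding H_def using affine_hyperplane_graph_hyperplane[OF K(1) d \<tau>] Y by blast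
  have finH: "finite H" unfolding H_def using fin by simp
  have "bij_betw (map_prod id (graph_hyperplane K d \<tau>))
      {(x, y). x \<in> P \<and> y \<in> Y \<and> graph_incident d \<tau> x y} {(x, h). x \<in> P \<and> h \<in> H \<and> x \<in> h}"
    unfolding bij_betw_def
  proof
    show "inj_on (map_prod id (graph_hyperplane K d \<tau>))
        {(x, y). x \<in> P \<and> y \<in> Y \<and> graph_incident d \<tau> x y}"
      using inj by (auto simp: inj_on_def)
    show "map_prod id (graph_hyperplane K d \<tau>) ` {(x, y). x \<in> P \<and> y \<in> Y \<and> graph_incident d \<tau> x y}
        = {(x, h). x \<in> P \<and> h \<in> H \<and> x \<in> h}"
      using mem by (force simp: H_def image_iff)
  qed
  then have I: "incidences P H = card {(x, y). x \<in> P \<and> y \<in> Y \<and> graph_incident d \<tau> x y}"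
    unfolding incidences_eq by (rule bij_betw_same_card[symmetric])
  have free': "biclique_free s P H"
    unfolding biclique_free_iff[OF s] no_biclique_def
  proof (intro allI impI)
    fix A B assume AB: "A \<subseteq> P" "B \<subseteq> H" "finite A" "finite B" "card A = s" "card B = s"
    obtain B' where B': "B' \<subseteq> Y" "B = graph_hyperplane K d \<tau> ` B'"
      using AB(2) unfolding H_def by (meson subset_imageE)
    have "inj_on (graph_hyperplane K d \<tau>) B'" using inj B'(1) by (rule inj_on_subset)
    then have "card B' = s" using AB(6) unfolding B'(2) by (simp add: card_image)
    then have "\<exists>x\<in>A. \<exists>y\<in>B'. \<not> graph_incident d \<tau> x y"
      using AB B'(1) fin(2) by (intro no_bicliqueD[OF free]) (auto intro: finite_subset)
    then show "\<exists>x\<in>A. \<exists>h\<in>B. x \<notin> h" using mem AB(1) B'(2) by blast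
  qed
  obtain G :: "int ring" and f g where G: "field G" "inj_on f P" "f ` P \<subseteq> affine_space G d"
    "inj_on g H" "\<forall>h\<in>g ` H. affine_hyperplane G d h"
    and fg: "\<And>x h. x \<in> P \<Longrightarrow> h \<in> H \<Longrightarrow> f x \<in> g h \<longleftrightarrow> x \<in> h"
    by (rule configuration_int_copy[OF field_subfield_ring[OF K(1)] fin(1) space finH hyp]) blast
  have "incidences (f ` P) (g ` H) = incidences P H"
    using G(2,4) fg by (rule incidences_image)
  moreover have "biclique_free s (f ` P) (g ` H)"
    using s free' G(2,4) fg by (rule biclique_free_image)
  moreover have "card (f ` P) = card P" "card (g ` H) = card Y"
    using G(2,4) inj by (simp_all add: card_image H_def)
  ultimately show ?thesis
    unfolding realizable_def I[symmetric] using G(1,3,5) fin(1) finH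
    by (intro exI[of _ G] exI[of _ "f ` P"] exI[of _ "g ` H"]) simp
qed

text \<open>The pivot sets of the two classes of a biclique are disjoint in a set of d - 1 = (t - 2)
  + (d - t) + 1 coordinates. So one class has few enough pivots for its evasiveness to apply, and
  \<open>s\<close> exceeds the resulting bound, in which d + 1 bounds the exponents of the
  equations.\<close>

lemma no_biclique_graph_incident:
  fixes P Y :: "(nat \<Rightarrow> 'f::field) set"
  assumes d: "d \<ge> 2" and t: "2 \<le> t" "t \<le> d" and s: "s = (d + 1) ^ d + 1"
    and P: "\<And>A. A \<subseteq> P \<Longrightarrow> card (coord_pivots d (\<lambda>i. d - i) A) \<le> t - 2 \<Longrightarrow> card A \<le> (d + 1) ^ d"
    and Y: "\<And>B. B \<subseteq> Y \<Longrightarrow> card (coord_pivots d (\<lambda>i. if i = d - 1 then 1 else i + 2) B) \<le> d - t \<Longrightarrow>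
      card B \<le> (d + 1) ^ d"
  shows "no_biclique s (graph_incident d \<tau>) P Y"
  unfolding no_biclique_def
proof (intro allI impI, rule ccontr)
  fix A B assume AB: "A \<subseteq> P" "B \<subseteq> Y" "card A = s" "card B = s"
    and "\<not> (\<exists>x\<in>A. \<exists>y\<in>B. \<not> graph_incident d \<tau> x y)"
  then have inc: "x (d - 1) + y (d - 1) + \<tau> = (\<Sum>i<d - 1. x i * y i)" if "x \<in> A" "y \<in> B" for x y
    using that unfolding graph_incident_def by blast
  let ?eA = "\<lambda>i. d - i" and ?eB = "\<lambda>i. if i = d - 1 then 1 else i + 2"
  let ?I = "coord_pivots d ?eA A" and ?J = "coord_pivots d ?eB B"
  have ne: "A \<noteq> {}" "B \<noteq> {}" using AB(3,4) s by auto
  have "?I \<union> ?J \<subseteq> {..<d - 1}" and disj: "?I \<inter> ?J = {}"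
    by (rule pivots_disjoint[OF ne _ inc, where eA = ?eA and eB = ?eB]; use d in auto)+
  then have "card (?I \<union> ?J) \<le> d - 1" "finite ?I" "finite ?J"
    using card_mono[of "{..<d - 1}" "?I \<union> ?J"] by (auto intro: finite_subset)
  then have "card ?I + card ?J \<le> d - 1" using disj by (simp add: card_Un_disjoint)
  then have "card ?I \<le> t - 2 \<or> card ?J \<le> d - t" using t by linarith
  then show False using P[OF AB(1)] Y[OF AB(2)] AB(3,4) s by auto
qed

text \<open>Evasiveness passes to subsets, and freeness holds for every translation. Hence the
  numbers of points and hyperplanes can be prescribed first and the translation chosen last.\<close>

lemma realizable_dense:
  assumes d: "d \<ge> 2" and t: "2 \<le> t" "t \<le> d" and k: "k \<ge> 1" and dq: "d \<le> 2 ^ k"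
    and m: "m \<le> (2 ^ k) ^ (d + 2 - t)" and n: "n \<le> (2 ^ k) ^ t"
  shows "\<exists>I. realizable d ((d + 1) ^ d + 1) m n I \<and> m * n \<le> I * 2 ^ k"
proof -
  obtain K :: "bit alg_closure set" where K: "subfield_set K" "finite K" and cK: "card K = 2 ^ k"
    using exists_subfield_set_card[OF k] by blast
  have dK: "d \<le> card K" using dq cK by simp
  \<comment> \<open>With q the size of the field, imposing t - 2 equations on the points and d - t
    on the parameters of hyperplanes leaves at least q^(d + 2 - t) and q^t elements.\<close>
  obtain E1 where E1: "E1 \<subseteq> {..<d} \<rightarrow>\<^sub>E K" "card K ^ (d - (t - 2)) \<le> card E1"
    "\<And>A. A \<subseteq> E1 \<Longrightarrow> card (coord_pivots d (\<lambda>i. d - i) A) \<le> t - 2 \<Longrightarrow> card A \<le> (d + 1) ^ d"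
    by (rule exists_evasive_set[OF K dK, of "t - 2" "\<lambda>i. d - i" "d + 1"]) (use t in auto)
  obtain E2 where E2: "E2 \<subseteq> {..<d} \<rightarrow>\<^sub>E K" "card K ^ (d - (d - t)) \<le> card E2"
    "\<And>A. A \<subseteq> E2 \<Longrightarrow> card (coord_pivots d (\<lambda>i. if i = d - 1 then 1 else i + 2) A) \<le> d - t \<Longrightarrow>
      card A \<le> (d + 1) ^ d"
    by (rule exists_evasive_set[OF K dK, of "d - t" "\<lambda>i. if i = d - 1 then 1 else i + 2" "d + 1"])
       (use t in auto)
  have "d - (t - 2) = d + 2 - t" "d - (d - t) = t" using t by auto
  then have "m \<le> card E1" "n \<le> card E2" using E1(2) E2(2) m n cK by simp_all
  then obtain P Y where P: "P \<subseteq> E1" "card P = m" and Y: "Y \<subseteq> E2" "card Y = n"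
    by (meson obtain_subset_with_card_n)
  have PY: "P \<subseteq> {..<d} \<rightarrow>\<^sub>E K" "Y \<subseteq> {..<d} \<rightarrow>\<^sub>E K" using P(1) Y(1) E1(1) E2(1) by auto
  have "finite ({..<d} \<rightarrow>\<^sub>E K)" using K(2) by (simp add: finite_PiE)
  then have fin: "finite P" "finite Y" using PY finite_subset by blast+
  have free: "no_biclique ((d + 1) ^ d + 1) (graph_incident d \<tau>) P Y" for \<tau>
    by (rule no_biclique_graph_incident[OF d t refl])
       (use P(1) Y(1) E1(3) E2(3) in \<open>meson order_trans\<close>)+
  define I where "I \<tau> = {p \<in> P \<times> Y. graph_incident d \<tau> (fst p) (snd p)}" for \<tau>
  \<comment> \<open>\<open>f p\<close> is the only translation for which the pair \<open>p\<close>
    is incident.\<close>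
  define f where "f p = (\<Sum>i<d - 1. fst p i * snd p i) + - (fst p (d - 1) + snd p (d - 1))"
    for p :: "(nat \<Rightarrow> bit alg_closure) \<times> (nat \<Rightarrow> bit alg_closure)"
  have I_eq: "I \<tau> = {p \<in> P \<times> Y. f p = \<tau>}" for \<tau>
  proof -
    have "u + \<tau> = v \<longleftrightarrow> v + - u = \<tau>" for u v :: "bit alg_closure"
      by (metis add.commute add_minus_cancel minus_add_cancel)
    then show ?thesis unfolding I_def f_def graph_incident_def by blast
  qed
  have "f p \<in> K" if p: "p \<in> P \<times> Y" for p
  proof -
    have "fst p i \<in> K" "snd p i \<in> K" if "i < d" for i
      using p PY that by (auto simp: PiE_def Pi_def)
    then have "(\<Sum>i<d - 1. fst p i * snd p i) \<in> K" "fst p (d - 1) \<in> K" "snd p (d - 1) \<in> K"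
      using K(1) d by (auto intro!: subfield_set_sum[OF K(1)] simp: subfield_set_def)
    then show ?thesis
      using K(1) unfolding f_def subfield_set_def by blast
  qed
  then have fK: "f ` (P \<times> Y) \<subseteq> K" by blast
  have "finite (P \<times> Y)" "K \<noteq> {}" using fin K(1) by (auto simp: subfield_set_def)
  then obtain \<tau> where \<tau>: "\<tau> \<in> K" "card (P \<times> Y) \<le> card {p \<in> P \<times> Y. f p = \<tau>} * card K"
    by (rule exists_large_fiber[OF _ K(2) fK])
  have "m * n \<le> card (I \<tau>) * 2 ^ k"
    using \<tau>(2) P(2) Y(2) cK unfolding I_eq[symmetric] by (simp add: card_cartesian_product)
  moreover have "I \<tau> = {(x, y). x \<in> P \<and> y \<in> Y \<and> graph_incident d \<tau> x y}"
    unfolding I_def by auto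
  then have "realizable d ((d + 1) ^ d + 1) m n (card (I \<tau>))"
    using realizable_graph_incidences[OF K _ _ \<tau>(1) PY free] d P(2) Y(2) by simp
  ultimately show ?thesis by blast
qed

text \<open>Points on the first axis and parameters on the last give parallel hyperplanes, one of
  which contains all the points. With the roles exchanged, all hyperplanes pass through the origin
  and through none of the other points. A biclique would need a second such hyperplane or point, as
  \<open>s\<close> is at least 2.\<close>

lemma realizable_aligned:
  assumes d: "d \<ge> 2" and s: "s \<ge> 2" and mn: "m \<ge> 1" "n \<ge> 1"
  shows "realizable d s m n m" "realizable d s m n n"
proof -
  obtain K :: "bit alg_closure set"
    where K: "subfield_set K" "finite K" and cK: "card K = 2 ^ (m + n)"
    using exists_subfield_set_card[of "m + n"] mn by auto
  have K0: "0 \<in> K" using K(1) by (simp add: subfield_set_def)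
  have big: "m \<le> card K" "n \<le> card K"
    unfolding cK using less_exp[of "m + n"] by linarith+
  \<comment> \<open>The sets have to contain 0, the label of the hyperplane or point that carries
    all incidences.\<close>
  have sub: "\<exists>C. C \<subseteq> K \<and> card C = l \<and> 0 \<in> C" if l: "1 \<le> l" "l \<le> card K" for l
  proof -
    have "l - 1 \<le> card (K - {0})" using l K0 K(2) by (simp add: card_Diff_singleton)
    then obtain C where C: "C \<subseteq> K - {0}" "card C = l - 1" by (meson obtain_subset_with_card_n)
    then have "finite C" using K(2) by (meson finite_Diff finite_subset)
    then have "card (insert 0 C) = l" using C l by (subst card_insert_disjoint) auto
    then show ?thesis using C K0 by (intro exI[of _ "insert 0 C"]) auto
  qed
  define v :: "bit alg_closure \<Rightarrow> nat \<Rightarrow> bit alg_closure"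
    where "v c = restrict (\<lambda>i. if i = 0 then c else 0) {..<d}" for c
  define w :: "bit alg_closure \<Rightarrow> nat \<Rightarrow> bit alg_closure"
    where "w c = restrict (\<lambda>i. if i = d - 1 then c else 0) {..<d}" for c
  have inj: "inj v" "inj w"
    using d
    by (auto simp: inj_on_def v_def w_def fun_eq_iff split: if_splits
        dest: spec[of _ 0] spec[of _ "d - 1"])
  have VW: "v ` C \<subseteq> {..<d} \<rightarrow>\<^sub>E K" "w ` C \<subseteq> {..<d} \<rightarrow>\<^sub>E K" if "C \<subseteq> K" for C
    using that K0 by (auto simp: v_def w_def split: if_splits)
  have inc: "graph_incident d 0 (v c) (w c') \<longleftrightarrow> c' = 0"
    "graph_incident d 0 (w c') (v c) \<longleftrightarrow> c' = 0" for c c'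
  proof -
    have "(\<Sum>i<d - 1. v c i * w c' i) = 0" "(\<Sum>i<d - 1. w c' i * v c i) = 0"
      by (rule sum.neutral; auto simp: v_def w_def)+
    then show "graph_incident d 0 (v c) (w c') \<longleftrightarrow> c' = 0" "graph_incident d 0 (w c') (v c) \<longleftrightarrow> c' = 0"
      using d unfolding graph_incident_def by (auto simp: v_def w_def)
  qed
  have free: "no_biclique s (graph_incident d 0) (v ` C) (w ` C')"
    "no_biclique s (graph_incident d 0) (w ` C') (v ` C)" for C C'
  proof -
    have *: "\<exists>y\<in>B. y \<noteq> w 0" if "card B = s" for B
    proof (rule ccontr)
      assume "\<not> ?thesis"
      then have "B \<subseteq> {w 0}" by blast
      then show False using card_mono[of "{w 0}" B] that s by simp
    qed
    have ninc: "\<not> graph_incident d 0 x y" "\<not> graph_incident d 0 y x"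
      if xy: "x \<in> v ` C" "y \<in> w ` C'" "y \<noteq> w 0" for x y
    proof -
      obtain c c' where "x = v c" "y = w c'" "c' \<noteq> 0" using xy by blast
      then show "\<not> graph_incident d 0 x y" "\<not> graph_incident d 0 y x" using inc by simp_all
    qed
    show "no_biclique s (graph_incident d 0) (v ` C) (w ` C')"
      unfolding no_biclique_def
    proof (intro allI impI)
      fix A B assume AB: "A \<subseteq> v ` C" "B \<subseteq> w ` C'" "card A = s" "card B = s"
      obtain y where "y \<in> B" "y \<noteq> w 0" using *[OF AB(4)] by blast
      moreover obtain x where "x \<in> A" using AB(3) s by fastforce
      ultimately show "\<exists>x\<in>A. \<exists>h\<in>B. \<not> graph_incident d 0 x h"
        using ninc(1)[of x y] AB(1,2) by blast
    qed
    show "no_biclique s (graph_incident d 0) (w ` C') (v ` C)"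
      unfolding no_biclique_def
    proof (intro allI impI)
      fix B A assume AB: "B \<subseteq> w ` C'" "A \<subseteq> v ` C" "card B = s" "card A = s"
      obtain y where "y \<in> B" "y \<noteq> w 0" using *[OF AB(3)] by blast
      moreover obtain x where "x \<in> A" using AB(4) s by fastforce
      ultimately show "\<exists>x\<in>B. \<exists>h\<in>A. \<not> graph_incident d 0 x h"
        using ninc(2)[of x y] AB(1,2) by blast
    qed
  qed
  obtain C C' where C: "C \<subseteq> K" "card C = m" "0 \<in> C" and C': "C' \<subseteq> K" "card C' = n" "0 \<in> C'"
    using sub[OF mn(1) big(1)] sub[OF mn(2) big(2)] by blast
  have card: "card (v ` S) = card S" "card (w ` S) = card S" for S
    using inj by (auto intro!: card_image inj_on_subset[OF _ subset_UNIV])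
  have "{(x, y). x \<in> v ` C \<and> y \<in> w ` C' \<and> graph_incident d 0 x y} = v ` C \<times> {w 0}"
    using inc C'(3) by auto
  then show "realizable d s m n m"
    using realizable_graph_incidences[OF K _ _ K0 VW(1)[OF C(1)] VW(2)[OF C'(1)] free(1)] d s C C'
    by (simp add: card card_cartesian_product)
  have "{(x, y). x \<in> w ` C \<and> y \<in> v ` C' \<and> graph_incident d 0 x y} = {w 0} \<times> v ` C'"
    using inc C(3) by auto
  then show "realizable d s m n n"
    using realizable_graph_incidences[OF K _ _ K0 VW(2)[OF C(1)] VW(1)[OF C'(1)] free(2)] d s C C'
    by (simp add: card card_cartesian_product)
qed

section \<open>Parameter ranges\<close>

text \<open>Rounding \<open>n\<close> down costs a factor of at most 2, and only in the comparison
  where \<open>n\<close> has to be large; a \<ge> 1 keeps 2^(1/a) at most 2.\<close>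

lemma floor_powr_compare:
  fixes m n :: nat and \<alpha> a b :: real
  assumes m: "m \<ge> 1" and \<alpha>: "\<alpha> > 0" and n: "n = nat \<lfloor>real m powr \<alpha>\<rfloor>" and b: "b > 0"
  shows "n \<ge> 1"
    and "a > 0 \<Longrightarrow> \<alpha> * b \<le> a \<Longrightarrow> real m powr (1 - 1 / b) * real n \<le> real m * real n powr (1 - 1 / a)"
    and "a \<ge> 1 \<Longrightarrow> a \<le> \<alpha> * b \<Longrightarrow>
           real m * real n powr (1 - 1 / a) \<le> 2 * (real m powr (1 - 1 / b) * real n)"
proof -
  define r where "r = real m powr \<alpha>"
  have r1: "r \<ge> 1" unfolding r_def using m \<alpha> by (intro ge_one_powr_ge_zero) auto
  then show n1: "n \<ge> 1" unfolding n r_def[symmetric] by (simp add: le_nat_iff)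
  have nr: "real n \<le> r" "r \<le> 2 * real n"
  proof -
    have "real n = of_int \<lfloor>r\<rfloor>" unfolding n r_def[symmetric] using r1 by simp
    then show "real n \<le> r" "r \<le> 2 * real n" using n1 by linarith+
  qed
  define u where "u = real m powr (1 / b)"
  define v where "v = real n powr (1 / a)"
  have uv: "u > 0" "v > 0" unfolding u_def v_def using m n1 by simp_all
  have mu: "real m powr (1 - 1 / b) = real m / u" and nv: "real n powr (1 - 1 / a) = real n / v"
    unfolding u_def v_def using m n1 by (simp_all add: powr_diff)
  have ra: "r powr (1 / a) = real m powr (\<alpha> / a)" unfolding r_def by (simp add: powr_powr)
  show "real m powr (1 - 1 / b) * real n \<le> real m * real n powr (1 - 1 / a)"
    if a: "a > 0" "\<alpha> * b \<le> a"
  proof -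
    have "v \<le> r powr (1 / a)" unfolding v_def using nr a by (intro powr_mono2) auto
    also have "\<dots> \<le> u" unfolding ra u_def using m a b by (intro powr_mono) (auto simp: field_simps)
    finally show ?thesis unfolding mu nv using uv by (simp add: frac_le)
  qed
  show "real m * real n powr (1 - 1 / a) \<le> 2 * (real m powr (1 - 1 / b) * real n)"
    if a: "a \<ge> 1" "a \<le> \<alpha> * b"
  proof -
    have "u \<le> r powr (1 / a)"
      unfolding ra u_def using m a b by (intro powr_mono) (auto simp: field_simps)
    also have "\<dots> \<le> (2 * real n) powr (1 / a)" using nr r1 a by (intro powr_mono2) auto
    also have "\<dots> = 2 powr (1 / a) * v" unfolding v_def by (simp add: powr_mult)
    also have "\<dots> \<le> 2 powr 1 * v" using a uv by (intro mult_right_mono powr_mono) auto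
    finally have "u \<le> 2 * v" by simp
    then have "1 / v \<le> 2 / u" using uv by (simp add: field_simps)
    then have "(real m * real n) * (1 / v) \<le> (real m * real n) * (2 / u)"
      by (rule mult_left_mono) simp
    then show ?thesis unfolding mu nv by (simp only: divide_inverse mult_ac mult_1_left)
  qed
qed

lemma beta_exp_alpha_exp_less:
  assumes "2 \<le> t" "t \<le> d"
  shows "beta_exp d (t - 1) < alpha_exp d t" "alpha_exp d t < beta_exp d t"
proof -
  have eq: "real d + 1 - real (t - 1) = real d + 2 - real t" using assms by (simp add: of_nat_diff)
  show "beta_exp d (t - 1) < alpha_exp d t"
    unfolding beta_exp_def alpha_exp_def eq using assms by (intro divide_strict_right_mono) auto
  show "alpha_exp d t < beta_exp d t"
    unfolding beta_exp_def alpha_exp_def using assms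
    by (intro divide_strict_left_mono mult_pos_pos) auto
qed

lemma beta_exp_mono:
  assumes "t \<le> t'" "t' \<le> d"
  shows "beta_exp d t \<le> beta_exp d t'"
  unfolding beta_exp_def using assms by (intro frac_le) auto

lemma exists_power_two_between:
  fixes M :: real
  assumes "M > 1"
  obtains k where "k \<ge> 1" "M \<le> 2 ^ k" "2 ^ k \<le> 2 * M"
proof -
  define k where "k = (LEAST k. M \<le> 2 ^ k)"
  obtain l where "M < 2 ^ l" using real_arch_pow[of 2 M] by auto
  then have k: "M \<le> 2 ^ k" unfolding k_def using LeastI[of "\<lambda>k. M \<le> 2 ^ k" l] by simp
  have "k \<noteq> 0"
  proof
    assume "k = 0"
    then show False using k assms by simp
  qed
  then have "\<not> M \<le> 2 ^ (k - 1)"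
    using not_less_Least[of "k - 1" "\<lambda>k. M \<le> 2 ^ k"] unfolding k_def[symmetric] by simp
  then have "2 ^ k \<le> 2 * M" using \<open>k \<noteq> 0\<close> by (cases k) auto
  then show thesis using that[of k] k \<open>k \<noteq> 0\<close> by simp
qed

text \<open>Up to rounding to a power of two, \<open>M\<close> is the field size that leaves room
  for \<open>m\<close> points and \<open>n\<close> hyperplanes. The incidence density divides m * n
  by the larger of the two roots, hence the minimum of the two terms; the factor 2 is the
  rounding.\<close>

lemma realizable_min:
  fixes m n :: nat
  assumes d: "d \<ge> 2" and t: "2 \<le> t" "t \<le> d" and m: "m \<ge> d ^ d" and n: "n \<ge> 1"
  shows "\<exists>I. realizable d ((d + 1) ^ d + 1) m n I \<and>
    min (real m powr (1 - 1 / (real d + 2 - real t)) * real n)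
        (real m * real n powr (1 - 1 / real t)) \<le> 2 * real I"
proof -
  define b where "b = d + 2 - t"
  have b: "b \<ge> 2" "b \<le> d" "real b = real d + 2 - real t"
    unfolding b_def using t by (auto simp: of_nat_diff)
  have m0: "m \<ge> 1" using m d by (meson le_trans one_le_power one_le_numeral)
  define M where "M = max (real m powr (1 / b)) (real n powr (1 / t))"
  \<comment> \<open>The bound \<open>d ^ d\<close> on \<open>m\<close> comes from here: as
    \<open>b\<close> is at most \<open>d\<close>, it makes the field at least as large as
    \<open>d\<close>, as the Vandermonde nodes require.\<close>
  have "real d = (real d ^ d) powr (1 / d)"
    using d by (simp add: powr_powr flip: powr_realpow)
  also have "\<dots> \<le> real m powr (1 / d)" using m by (intro powr_mono2) (auto simp flip: of_nat_power)
  also have "\<dots> \<le> real m powr (1 / b)" using m0 b d by (intro powr_mono) (auto simp: field_simps)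
  finally have dM: "real d \<le> M" unfolding M_def by simp
  then obtain k where k: "k \<ge> 1" "M \<le> 2 ^ k" "2 ^ k \<le> 2 * M"
    using exists_power_two_between[of M] d by auto
  have pw: "x \<le> (2 ^ k) ^ l" if x: "real x powr (1 / l) \<le> M" "x \<ge> 1" "l \<ge> 1" for x l :: nat
  proof -
    have "real x = (real x powr (1 / l)) ^ l" using x by (simp add: powr_powr flip: powr_realpow)
    also have "\<dots> \<le> (2 ^ k) ^ l" using x k by (intro power_mono) auto
    finally have "real x \<le> real ((2 ^ k) ^ l)" by simp
    then show ?thesis by (simp only: of_nat_le_iff)
  qed
  have "real d \<le> 2 ^ k" using dM k(2) by linarith
  then have "d \<le> 2 ^ k" by simp
  moreover have "m \<le> (2 ^ k) ^ (d + 2 - t)"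
    unfolding b_def[symmetric] using b m0 by (intro pw) (auto simp: M_def)
  moreover have "n \<le> (2 ^ k) ^ t" using t n by (intro pw) (auto simp: M_def)
  ultimately obtain I where I: "realizable d ((d + 1) ^ d + 1) m n I" "m * n \<le> I * 2 ^ k"
    using realizable_dense[OF d t k(1)] by blast
  have M0: "M > 0" using dM d by simp
  have "real m * real n \<le> real I * 2 ^ k"
    using of_nat_mono[OF I(2), where 'a = real] by simp
  also have "\<dots> \<le> real I * (2 * M)" using k by (intro mult_left_mono) auto
  also have "\<dots> = (2 * real I) * M" by simp
  finally have I2: "real m * real n / M \<le> 2 * real I" using M0 by (simp only: pos_divide_le_eq)
  have "min (real m powr (1 - 1 / b) * real n) (real m * real n powr (1 - 1 / t))
      \<le> real m * real n / M"
  proof (cases "M = real m powr (1 / b)")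
    case True
    have "real m powr (1 - 1 / b) * real n = real m * real n / M"
      unfolding True using m0 by (simp add: powr_diff)
    then show ?thesis by simp
  next
    case False
    then have M: "M = real n powr (1 / t)" unfolding M_def by linarith
    have "real m * real n powr (1 - 1 / t) = real m * real n / M"
      unfolding M using n by (simp add: powr_diff)
    then show ?thesis by simp
  qed
  then show ?thesis using I(1) I2 unfolding b(3) by (intro exI[of _ I]) linarith
qed

text \<open>Adjacent ranges share an endpoint, so one configuration has to satisfy all clauses that
  apply there. In the constant 1/4, one factor 2 is lost by the size of the field and one by
  rounding \<open>n\<close>.\<close>

lemma realizable_lower_bounds:
  fixes m n :: nat
  assumes d: "d \<ge> 2" and \<alpha>: "\<alpha> > 0" and m: "m \<ge> d ^ d" and n: "n = nat \<lfloor>real m powr \<alpha>\<rfloor>"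
  shows "\<exists>I. realizable d ((d + 1) ^ d + 1) m n I \<and>
    (\<alpha> \<in> {0<..beta_exp d 1} \<longrightarrow> real I \<ge> real m) \<and>
    (\<forall>t\<in>{2..d}. \<alpha> \<in> {beta_exp d (t - 1)..alpha_exp d t} \<longrightarrow>
       real I \<ge> 1 / 4 * (real m powr (1 - 1 / (real d + 2 - real t)) * real n)) \<and>
    (\<forall>t\<in>{2..d}. \<alpha> \<in> {alpha_exp d t..beta_exp d t} \<longrightarrow>
       real I \<ge> 1 / 4 * (real m * real n powr (1 - 1 / real t))) \<and>
    (\<alpha> \<in> {beta_exp d d..} \<longrightarrow> real I \<ge> real n)"
    (is "\<exists>I. realizable d ?s m n I \<and> ?low I \<and> ?first I \<and> ?second I \<and> ?high I")
proof -
  have m1: "m \<ge> 1" using m d by (meson le_trans one_le_power one_le_numeral)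
  note cmp = floor_powr_compare[OF m1 \<alpha> n]
  have n1: "n \<ge> 1" using cmp(1)[of 1] by simp
  have s2: "?s \<ge> 2" by simp
  define A where "A b = real m powr (1 - 1 / b) * real n" for b
  define B where "B a = real m * real n powr (1 - 1 / a)" for a
  have A0: "A b \<ge> 0" for b unfolding A_def by simp
  have B0: "B a \<ge> 0" for a unfolding B_def by simp
  have le_alpha: "\<alpha> * (real d + 2 - real t) \<le> real t \<longleftrightarrow> \<alpha> \<le> alpha_exp d t"
    and ge_alpha: "real t \<le> \<alpha> * (real d + 2 - real t) \<longleftrightarrow> alpha_exp d t \<le> \<alpha>"
    and le_beta: "\<alpha> * (real d + 1 - real t) \<le> real t \<longleftrightarrow> \<alpha> \<le> beta_exp d t"
    and ge_beta: "real t \<le> \<alpha> * (real d + 1 - real t) \<longleftrightarrow> beta_exp d t \<le> \<alpha>"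
    if "t \<le> d" for t
    using that unfolding alpha_exp_def beta_exp_def by (simp_all add: field_simps)
  have "beta_exp d 1 \<le> beta_exp d (d - 1)" using d by (intro beta_exp_mono) auto
  then have beta_less: "beta_exp d 1 < beta_exp d d"
    using beta_exp_alpha_exp_less[of d d] d by simp
  consider (low) "\<alpha> \<le> beta_exp d 1" | (high) "beta_exp d d \<le> \<alpha>"
    | (mid) "beta_exp d 1 < \<alpha>" "\<alpha> < beta_exp d d"
    by linarith
  then show ?thesis
  proof cases
    case low
    have "?first m"
    proof (intro ballI impI)
      fix t assume t: "t \<in> {2..d}" and "\<alpha> \<in> {beta_exp d (t - 1)..alpha_exp d t}"
      \<comment> \<open>The two ranges meet only in \<alpha> = \<open>beta_exp d 1\<close>, where
        the term for t = 2 is at most \<open>m\<close>.\<close>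
      have "t = 2"
      proof (rule ccontr)
        assume "t \<noteq> 2"
        then have "beta_exp d 1 < alpha_exp d 2" "alpha_exp d 2 < beta_exp d 2"
          "beta_exp d 2 \<le> beta_exp d (t - 1)"
          using beta_exp_alpha_exp_less[of 2 d] beta_exp_mono[of 2 "t - 1" d] t d by auto
        then show False using low \<open>\<alpha> \<in> {beta_exp d (t - 1)..alpha_exp d t}\<close> by simp
      qed
      have "A (real d) \<le> B 1"
        unfolding A_def B_def using cmp(2)[of "real d" 1] le_beta[of 1] low d by simp
      moreover have "B 1 = real m" using n1 by (simp add: B_def)
      ultimately show "1 / 4 * (real m powr (1 - 1 / (real d + 2 - real t)) * real n) \<le> real m"
        using A0[of "real d"] by (simp add: A_def \<open>t = 2\<close>)
    qed
    moreover have "?second m"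
    proof (intro ballI impI)
      fix t assume t: "t \<in> {2..d}" and "\<alpha> \<in> {alpha_exp d t..beta_exp d t}"
      moreover have "beta_exp d 1 \<le> beta_exp d (t - 1)" using t by (intro beta_exp_mono) auto
      ultimately have False
        using beta_exp_alpha_exp_less[of t d] low by simp
      then show "1 / 4 * (real m * real n powr (1 - 1 / real t)) \<le> real m" ..
    qed
    moreover have "?high m"
      using low beta_less by simp
    ultimately show ?thesis using realizable_aligned(1)[OF d s2 m1 n1] by blast
  next
    case high
    have "?second n"
    proof (intro ballI impI)
      fix t assume t: "t \<in> {2..d}" and \<alpha>t: "\<alpha> \<in> {alpha_exp d t..beta_exp d t}"
      have "t = d"
      proof (rule ccontr)
        assume "t \<noteq> d"
        then have "beta_exp d t \<le> beta_exp d (d - 1)" "beta_exp d (d - 1) < beta_exp d d"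
          using beta_exp_alpha_exp_less[of d d] beta_exp_mono[of t "d - 1" d] t d by auto
        then show False using high \<alpha>t by simp
      qed
      have "B d \<le> 2 * A 1"
        unfolding A_def B_def using cmp(3)[of 1 "real d"] ge_beta[of d] high d by simp
      moreover have "A 1 = real n" using m1 by (simp add: A_def)
      ultimately show "1 / 4 * (real m * real n powr (1 - 1 / real t)) \<le> real n"
        using B0[of "real d"] by (simp add: B_def \<open>t = d\<close>)
    qed
    moreover have "?first n"
    proof (intro ballI impI)
      fix t assume t: "t \<in> {2..d}" and "\<alpha> \<in> {beta_exp d (t - 1)..alpha_exp d t}"
      moreover have "beta_exp d t \<le> beta_exp d d" using t by (intro beta_exp_mono) auto
      ultimately have False
        using beta_exp_alpha_exp_less[of t d] high by simp
      then show "1 / 4 * (real m powr (1 - 1 / (real d + 2 - real t)) * real n) \<le> real n" ..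
    qed
    moreover have "?low n"
      using high beta_less by simp
    ultimately show ?thesis using realizable_aligned(2)[OF d s2 m1 n1] by blast
  next
    case mid
    \<comment> \<open>Taking the least \<open>t\<close> cuts the middle range into the disjoint
      intervals above \<open>beta_exp d (t - 1)\<close> and up to
      \<open>beta_exp d t\<close>.\<close>
    define t where "t = (LEAST t. \<alpha> \<le> beta_exp d t)"
    have t\<alpha>: "\<alpha> \<le> beta_exp d t" and td: "t \<le> d"
      unfolding t_def using mid(2) LeastI[of "\<lambda>t. \<alpha> \<le> beta_exp d t" d]
        Least_le[of "\<lambda>t. \<alpha> \<le> beta_exp d t" d] by simp_all
    have small: "beta_exp d u < \<alpha>" if "u < t" for u
      using not_less_Least[of u "\<lambda>t. \<alpha> \<le> beta_exp d t"] that unfolding t_def by simp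
    have t2: "2 \<le> t"
    proof (rule ccontr)
      assume "\<not> 2 \<le> t"
      then have "beta_exp d t \<le> beta_exp d 1" using d by (intro beta_exp_mono) auto
      then show False using t\<alpha> mid(1) by simp
    qed
    obtain I where I: "realizable d ?s m n I" and "min (A (real d + 2 - real t)) (B t) \<le> 2 * real I"
      using realizable_min[OF d t2 td m n1] unfolding A_def B_def by blast
    then have AB: "A (real d + 2 - real t) \<le> 2 * real I \<or> B t \<le> 2 * real I" by linarith
    have AI: "A (real d + 2 - real t) \<le> 4 * real I" if "\<alpha> \<le> alpha_exp d t"
    proof -
      have "A (real d + 2 - real t) \<le> B t"
        unfolding A_def B_def
        using cmp(2)[of "real d + 2 - real t" "real t"] le_alpha[OF td] that t2 td by simp
      then show ?thesis using AB by linarith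
    qed
    have BI: "B t \<le> 4 * real I" if "alpha_exp d t \<le> \<alpha>"
    proof -
      have "B t \<le> 2 * A (real d + 2 - real t)"
        unfolding A_def B_def
        using cmp(3)[of "real d + 2 - real t" "real t"] ge_alpha[OF td] that t2 td by simp
      then show ?thesis using AB by linarith
    qed
    have "?first I"
    proof (intro ballI impI)
      fix u assume u: "u \<in> {2..d}" and \<alpha>u: "\<alpha> \<in> {beta_exp d (u - 1)..alpha_exp d u}"
      consider "u < t" | "u = t" | "t < u" by linarith
      then have "A (real d + 2 - real u) \<le> 4 * real I"
      proof cases
        case 1
        then show ?thesis using small[of u] beta_exp_alpha_exp_less[of u d] u \<alpha>u by simp
      next
        case 2
        then show ?thesis using AI \<alpha>u by simp
      next
        case 3
        \<comment> \<open>This is the shared endpoint \<alpha> = \<open>beta_exp d t\<close>. The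
          term of the next range is bounded by the second term for \<open>t\<close>, because the
          exponents \<open>t\<close> and d + 1 - t balance there.\<close>
        have "t + 1 = u"
        proof (rule ccontr)
          assume "t + 1 \<noteq> u"
          then have "beta_exp d (t + 1) \<le> beta_exp d (u - 1)" "beta_exp d t < beta_exp d (t + 1)"
            using 3 u beta_exp_mono[of "t + 1" "u - 1" d] beta_exp_alpha_exp_less[of "t + 1" d] t2
            by auto
          then show False using t\<alpha> \<alpha>u by simp
        qed
        then have eq: "real d + 2 - real u = real d + 1 - real t" by auto
        have "A (real d + 2 - real u) \<le> B t"
          unfolding A_def B_def eq
          using cmp(2)[of "real d + 1 - real t" "real t"] le_beta[OF td] t\<alpha> t2 td
          by simp
        moreover have "alpha_exp d t \<le> \<alpha>"
          using \<alpha>u beta_exp_alpha_exp_less[OF t2 td] \<open>t + 1 = u\<close> by auto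
        ultimately show ?thesis using BI by linarith
      qed
      then show "1 / 4 * (real m powr (1 - 1 / (real d + 2 - real u)) * real n) \<le> real I"
        unfolding A_def by simp
    qed
    moreover have "?second I"
    proof (intro ballI impI)
      fix u assume u: "u \<in> {2..d}" and \<alpha>u: "\<alpha> \<in> {alpha_exp d u..beta_exp d u}"
      have "u = t"
      proof (rule ccontr)
        assume "u \<noteq> t"
        then consider "u < t" | "t < u" by linarith
        then show False
        proof cases
          case 1
          then show ?thesis using small[of u] \<alpha>u by simp
        next
          case 2
          then have "beta_exp d t \<le> beta_exp d (u - 1)" using u by (intro beta_exp_mono) auto
          then show ?thesis
            using beta_exp_alpha_exp_less[of u d] u \<alpha>u t\<alpha> by simp
        qed
      qed
      then show "1 / 4 * (real m * real n powr (1 - 1 / real u)) \<le> real I"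
        using BI \<alpha>u unfolding B_def by simp
    qed
    moreover have "?low I" "?high I" using mid by simp_all
    ultimately show ?thesis using I by blast
  qed
qed

theorem theorem1p2:
  shows "(\<forall>(d::nat) (s::nat) (F :: 'a ring). d \<ge> 1 \<longrightarrow> s \<ge> 1 \<longrightarrow> field F \<longrightarrow>
            upper_bounds F d s (upper_const s d))
       \<and>
         (\<forall>d::nat. d \<ge> 2 \<longrightarrow>
           (\<exists>(s::nat) (c::real). s \<ge> 1 \<and> c > 0 \<and>
             (\<forall>\<alpha>::real. \<alpha> > 0 \<longrightarrow>
               (\<exists>m0::nat. \<forall>m\<ge>m0.
                 (\<exists>(F :: int ring) P H (n::nat).
                    field F \<and> n = nat \<lfloor>real m powr \<alpha>\<rfloor> \<and>
                    P \<subseteq> affine_space F d \<and> finite P \<and> card P = m \<and>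
                    (\<forall>h\<in>H. affine_hyperplane F d h) \<and> finite H \<and> card H = n \<and>
                    biclique_free s P H \<and>
                    (\<alpha> \<in> {0<..beta_exp d 1} \<longrightarrow> real (incidences P H) \<ge> real m) \<and>
                    (\<forall>t\<in>{2..d}. \<alpha> \<in> {beta_exp d (t - 1)..alpha_exp d t} \<longrightarrow>
                       real (incidences P H)
                         \<ge> c * (real m powr (1 - 1 / (real d + 2 - real t)) * real n)) \<and>
                    (\<forall>t\<in>{2..d}. \<alpha> \<in> {alpha_exp d t..beta_exp d t} \<longrightarrow>
                       real (incidences P H) \<ge> c * (real m * real n powr (1 - 1 / real t))) \<and>
                    (\<alpha> \<in> {beta_exp d d..} \<longrightarrow> real (incidences P H) \<ge> real n))))))"
proof (intro conjI allI impI, goal_cases)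
  case (1 d s F)
  then show ?case by (rule upper_bounds_upper_const)
next
  case (2 d)
  show ?case
  proof (rule exI[of _ "(d + 1) ^ d + 1"], rule exI[of _ "1 / 4"],
      intro conjI allI impI, goal_cases)
    case (3 \<alpha>)
    show ?case
    \<comment> \<open>The same threshold serves every \<alpha>; it makes the finite field large
      enough for the \<open>d\<close> nodes.\<close>
    proof (rule exI[of _ "d ^ d"], intro allI impI)
      fix m assume m: "d ^ d \<le> m"
      from realizable_lower_bounds[OF 2 3 m refl]
      show "\<exists>(F :: int ring) P H (n::nat).
                    field F \<and> n = nat \<lfloor>real m powr \<alpha>\<rfloor> \<and>
                    P \<subseteq> affine_space F d \<and> finite P \<and> card P = m \<and>
                    (\<forall>h\<in>H. affine_hyperplane F d h) \<and> finite H \<and> card H = n \<and>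
                    biclique_free ((d + 1) ^ d + 1) P H \<and>
                    (\<alpha> \<in> {0<..beta_exp d 1} \<longrightarrow> real (incidences P H) \<ge> real m) \<and>
                    (\<forall>t\<in>{2..d}. \<alpha> \<in> {beta_exp d (t - 1)..alpha_exp d t} \<longrightarrow>
                       real (incidences P H)
                         \<ge> 1 / 4 * (real m powr (1 - 1 / (real d + 2 - real t)) * real n)) \<and>
                    (\<forall>t\<in>{2..d}. \<alpha> \<in> {alpha_exp d t..beta_exp d t} \<longrightarrow>
                       real (incidences P H) \<ge> 1 / 4 * (real m * real n powr (1 - 1 / real t))) \<and>
                    (\<alpha> \<in> {beta_exp d d..} \<longrightarrow> real (incidences P H) \<ge> real n)"
        unfolding realizable_def by blast
    qed
  qed simp_all
qed

end
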